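(* Let $(G, K) = (\mathrm{SL}_n(\mathbb{C}), \mathrm{SO}_n(\mathbb{C}))$ with $n \ge 3$ (type AI), or $(G, K) = (\mathrm{SL}_{2m}(\mathbb{C}), \mathrm{Sp}_{2m}(\mathbb{C}))$ with $m \ge 2$ (type AII). Let $P \subset G$ and $Q \subset K$ be parabolic subgroups satisfying (1) or (2) below. Then there are finitely many $K$-orbits in $G/P \times K/Q$ (diagonal action). (1) $P$ is a maximal parabolic subgroup of $G$, and $Q$ is an arbitrary parabolic subgroup of $K$. (2) $n \ge 4$ is an even integer if $(G, K) = (\mathrm{SL}_n, \mathrm{SO}_n)$; $P = P_{\lambda}$ is a parabolic subgroup of $G$ with $\lambda = (\lambda_1, \lambda_2, \lambda_3)$ of length $3$; and $Q$ is a Siegel parabolic subgroup of $K$.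
   Context: For a composition $\lambda = (\lambda_1, \dots, \lambda_\ell)$ of $N$ (an ordered tuple of positive integers with sum $N$; its length is $\ell$), $P_\lambda$ denotes the standard (block upper triangular) parabolic subgroup of $\mathrm{GL}_N$ (or of $\mathrm{SL}_N$, by intersecting with $\mathrm{SL}_N$) with diagonal blocks of sizes $\lambda_1, \dots, \lambda_\ell$, i.e. the stabilizer of a partial flag of subspaces of $\mathbb{C}^N$ of dimensions $\lambda_1, \lambda_1+\lambda_2, \dots, \lambda_1 + \cdots + \lambda_\ell$. A Siegel parabolic subgroup of $K = \mathrm{SO}_n$ ($n$ even) or $K = \mathrm{Sp}_{2m}$ is the stabilizer in $K$ of a maximal isotropic subspace for the symmetric (respectively symplectic) form defining $K$. *)

theory Defs
  imports
    "HOL-Analysis.Abstract_Topology"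
    "HOL-Algebra.Left_Coset"
    "HOL-Algebra.Group_Action"
    "HOL-Algebra.Solvable_Groups"
    "Jordan_Normal_Form.VS_Connect"
begin

definition mat_group :: "nat \<Rightarrow> complex mat set \<Rightarrow> complex mat monoid" where
  "mat_group n X = \<lparr>carrier = X, mult = (*), one = 1\<^sub>m n\<rparr>"

definition SL :: "nat \<Rightarrow> complex mat monoid" where
  "SL n = mat_group n {g \<in> carrier_mat n n. det g = 1}"

text \<open>The forms are given by their Gram matrices \<open>S\<close>, the form being \<open>(u, v) \<mapsto> u\<^sup>T S v\<close>.
  Any nondegenerate symmetric (alternating) \<open>S\<close> is allowed, so every usual realization of the
  orthogonal (symplectic) group is covered. Over the complex numbers alternating means
  skew-symmetric.\<close>

definition nondeg_symmetric :: "nat \<Rightarrow> complex mat \<Rightarrow> bool" where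
  "nondeg_symmetric n S \<longleftrightarrow> S \<in> carrier_mat n n \<and> transpose_mat S = S \<and> invertible_mat S"

definition nondeg_alternating :: "nat \<Rightarrow> complex mat \<Rightarrow> bool" where
  "nondeg_alternating n S \<longleftrightarrow> S \<in> carrier_mat n n \<and> transpose_mat S = - S \<and> invertible_mat S"

definition SO :: "nat \<Rightarrow> complex mat \<Rightarrow> complex mat monoid" where
  "SO n S = mat_group n {g \<in> carrier_mat n n. transpose_mat g * S * g = S \<and> det g = 1}"

text \<open>No determinant condition is needed here: isometries of an alternating form have
  determinant 1.\<close>

definition Sp :: "nat \<Rightarrow> complex mat \<Rightarrow> complex mat monoid" where
  "Sp n S = mat_group n {g \<in> carrier_mat n n. transpose_mat g * S * g = S}"

text \<open>Polynomial functions in the \<open>n\<^sup>2\<close> entries of a matrix, and the Zariski topology on the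
  space of \<open>n \<times> n\<close> matrices, given by its basis of principal open sets. The matrix groups
  above are closed in it, so a subset of one of them is closed in the group iff it is closed
  among all matrices.\<close>

inductive_set mat_polyfun :: "nat \<Rightarrow> (complex mat \<Rightarrow> complex) set" for n :: nat where
  const: "(\<lambda>A. c) \<in> mat_polyfun n"
| entry: "i < n \<Longrightarrow> j < n \<Longrightarrow> (\<lambda>A. A $$ (i, j)) \<in> mat_polyfun n"
| add: "f \<in> mat_polyfun n \<Longrightarrow> g \<in> mat_polyfun n \<Longrightarrow> (\<lambda>A. f A + g A) \<in> mat_polyfun n"
| mult: "f \<in> mat_polyfun n \<Longrightarrow> g \<in> mat_polyfun n \<Longrightarrow> (\<lambda>A. f A * g A) \<in> mat_polyfun n"

definition zariski :: "nat \<Rightarrow> complex mat topology" where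
  "zariski n = topology_generated_by {{A \<in> carrier_mat n n. f A \<noteq> 0} | f. f \<in> mat_polyfun n}"

definition closed_conn_solvable :: "nat \<Rightarrow> complex mat monoid \<Rightarrow> complex mat set \<Rightarrow> bool" where
  "closed_conn_solvable n H B \<longleftrightarrow>
     subgroup B H \<and> closedin (zariski n) B \<and> connectedin (zariski n) B \<and>
     solvable (H\<lparr>carrier := B\<rparr>)"

definition borel_subgroup :: "nat \<Rightarrow> complex mat monoid \<Rightarrow> complex mat set \<Rightarrow> bool" where
  "borel_subgroup n H B \<longleftrightarrow>
     closed_conn_solvable n H B \<and>
     (\<forall>B'. closed_conn_solvable n H B' \<and> B \<subseteq> B' \<longrightarrow> B' = B)"

definition parabolic :: "nat \<Rightarrow> complex mat monoid \<Rightarrow> complex mat set \<Rightarrow> bool" where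
  "parabolic n H P \<longleftrightarrow>
     subgroup P H \<and> closedin (zariski n) P \<and> (\<exists>B. borel_subgroup n H B \<and> B \<subseteq> P)"

definition maximal_parabolic :: "nat \<Rightarrow> complex mat monoid \<Rightarrow> complex mat set \<Rightarrow> bool" where
  "maximal_parabolic n H P \<longleftrightarrow>
     parabolic n H P \<and> P \<noteq> carrier H \<and>
     (\<forall>P'. parabolic n H P' \<and> P' \<noteq> carrier H \<and> P \<subseteq> P' \<longrightarrow> P' = P)"

definition composition :: "nat \<Rightarrow> nat list \<Rightarrow> bool" where
  "composition N lam \<longleftrightarrow> (\<forall>k\<in>set lam. 0 < k) \<and> sum_list lam = N"

text \<open>A matrix is block upper triangular for \<open>lam\<close> iff, for each partial sum
  \<open>s = sum_list (take k lam)\<close>, its entries in rows \<open>\<ge> s\<close> and columns \<open>< s\<close> (indices from 0) vanish,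
  that is, iff it preserves the span of the first \<open>s\<close> unit vectors.\<close>

definition std_parabolic :: "nat \<Rightarrow> nat list \<Rightarrow> complex mat set" where
  "std_parabolic n lam =
     {g \<in> carrier (SL n). \<forall>k\<le>length lam. \<forall>i<n. \<forall>j<n.
        j < sum_list (take k lam) \<and> sum_list (take k lam) \<le> i \<longrightarrow> g $$ (i, j) = 0}"

definition isotropic :: "nat \<Rightarrow> complex mat \<Rightarrow> complex vec set \<Rightarrow> bool" where
  "isotropic n S W \<longleftrightarrow>
     VectorSpace.subspace class_ring W (module_vec TYPE(complex) n) \<and>
     (\<forall>u\<in>W. \<forall>v\<in>W. u \<bullet> (S *\<^sub>v v) = 0)"

definition maximal_isotropic :: "nat \<Rightarrow> complex mat \<Rightarrow> complex vec set \<Rightarrow> bool" where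
  "maximal_isotropic n S W \<longleftrightarrow>
     isotropic n S W \<and> (\<forall>W'. isotropic n S W' \<and> W \<subseteq> W' \<longrightarrow> W' = W)"

definition siegel_parabolic ::
  "nat \<Rightarrow> complex mat \<Rightarrow> complex mat monoid \<Rightarrow> complex mat set \<Rightarrow> bool" where
  "siegel_parabolic n S K Q \<longleftrightarrow>
     (\<exists>W. maximal_isotropic n S W \<and> Q = {g \<in> carrier K. (\<lambda>v. g *\<^sub>v v) ` W = W})"

end

theory Submission
  imports Defs "HOL-Computational_Algebra.Fundamental_Theorem_Algebra"
begin

text \<open>A point of \<open>G/P \<times> K/Q\<close> corresponds to a configuration of subspaces of \<open>\<complex>\<^sup>n\<close>, and the
  orbits of \<open>K\<close> are counted by classifying configurations, first up to linear isomorphism and then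
  up to isometry.

  From parabolic subgroups to subspaces. The Lie-Kolchin theorem gives a complete flag that is
  invariant under a Borel subgroup of \<open>SL\<^sub>n\<close>, and for \<open>K\<close> a complete flag \<open>F\<close> that is
  moreover self-dual, \<open>F\<^sub>n\<^sub>-\<^sub>j = F\<^sub>j\<^sup>\<bottom>\<close> (\<open>stable_full_flag\<close>,
  \<open>self_dual_stable_flag\<close>). The stabilizer of such a flag is closed, connected and solvable, hence
  equal to the Borel subgroup (\<open>borel_SL_flag\<close>, \<open>borel_form_flag\<close>). A maximal parabolic subgroup
  of \<open>SL\<^sub>n\<close> contains the stabilizer of a single subspace \<open>W\<close>
  (\<open>maximal_parabolic_contains_stabilizer\<close>). Therefore, for a maximal parabolic subgroup \<open>P\<close>, the
  \<open>K\<close>-orbit of \<open>(gP, kQ)\<close> is determined by the \<open>K\<close>-orbit of the configuration of \<open>gW\<close> and the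
  self-dual flag \<open>kF\<close>. For \<open>P = P\<^sub>\<lambda>\<close> with three blocks and a Siegel parabolic subgroup \<open>Q\<close>
  it is determined by the configuration of \<open>gW\<^sub>1 \<subseteq> gW\<^sub>2\<close> and \<open>kU\<close>, where \<open>P\<close> is the
  stabilizer of \<open>W\<^sub>1 \<subseteq> W\<^sub>2\<close> and \<open>Q\<close> is the stabilizer of a maximal isotropic space
  \<open>U\<close>; the parity of \<open>n\<close> forces \<open>U = U\<^sup>\<bottom>\<close>.

  From isometries to linear maps. Enlarge the configuration by the orthogonal spaces of its
  members. If a linear isomorphism \<open>h\<close> carries one self-dual family of subspaces to another, then
  so does an isometry (\<open>isometry_of_linear_iso\<close>). With \<open>h\<^sup>*\<close> the adjoint of \<open>h\<close>, the map
  \<open>a = h\<^sup>* h\<close> is self-adjoint and preserves every member of the first family, and over the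
  complex numbers it has a square root \<open>r\<close> that is a polynomial in \<open>a\<close>; the map
  \<open>(h\<^sup>*)\<^sup>-\<^sup>1 r\<close> is the required isometry. Isometries have determinant 1 or -1,
  so the passage to determinant 1 at most doubles the number of classes (\<open>isometry_classes\<close>).

  Linear classification. What remains are finiteness statements for the general linear group:
  finitely many classes of a complete flag with two further subspaces (\<open>gW\<close> and its orthogonal
  space), and of a subspace together with two chains of two subspaces (\<open>gW\<^sub>1 \<subseteq> gW\<^sub>2\<close>
  and their orthogonal spaces). Both come from one Gaussian elimination (\<open>normal_form\<close>): if the
  coordinates are preordered without three pairwise incomparable ones, the operations that add a
  multiple of one coordinate to a smaller one bring every subspace into one of finitely many
  normal forms. It is applied once for each subspace, with the preorder whose operations preserve
  what has been normalized before; the length three of \<open>\<lambda>\<close> keeps three pairwise incomparable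
  coordinates from arising in the last application (\<open>sub_normal_form\<close>).\<close>

section \<open>Subspaces of coordinate spaces\<close>

text \<open>Vectors are functions on all natural numbers, and the dimension enters only as a bound on
  the support. Inductions can thus run over sets of coordinates without a change of type.\<close>

definition coord :: "nat set \<Rightarrow> (nat \<Rightarrow> complex) set" where
  "coord D = {x. \<forall>i. i \<notin> D \<longrightarrow> x i = 0}"

abbreviation V :: "nat \<Rightarrow> (nat \<Rightarrow> complex) set" where "V n \<equiv> coord {..<n}"

definition subsp :: "(nat \<Rightarrow> complex) set \<Rightarrow> bool" where
  "subsp X \<longleftrightarrow> (\<lambda>_. 0) \<in> X \<and> (\<forall>x\<in>X. \<forall>y\<in>X. \<forall>c d. (\<lambda>i. c * x i + d * y i) \<in> X)"

definition unit :: "nat \<Rightarrow> nat \<Rightarrow> complex" where "unit k = (\<lambda>i. if i = k then 1 else 0)"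

lemma subspD:
  assumes "subsp X"
  shows subsp_zero: "(\<lambda>_. 0) \<in> X"
    and subsp_comb: "x \<in> X \<Longrightarrow> y \<in> X \<Longrightarrow> (\<lambda>i. c * x i + d * y i) \<in> X"
    and subsp_scale: "x \<in> X \<Longrightarrow> (\<lambda>i. c * x i) \<in> X"
    and subsp_add: "x \<in> X \<Longrightarrow> y \<in> X \<Longrightarrow> (\<lambda>i. x i + y i) \<in> X"
    and subsp_diff: "x \<in> X \<Longrightarrow> y \<in> X \<Longrightarrow> (\<lambda>i. x i - y i) \<in> X"
    and subsp_axpy: "x \<in> X \<Longrightarrow> y \<in> X \<Longrightarrow> (\<lambda>i. x i - d * y i) \<in> X"
proof -
  have *: "x \<in> X \<Longrightarrow> y \<in> X \<Longrightarrow> (\<lambda>i. c * x i + d * y i) \<in> X" for x y c d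
    using assms by (auto simp: subsp_def)
  show "(\<lambda>_. 0) \<in> X" using assms by (auto simp: subsp_def)
  show "x \<in> X \<Longrightarrow> y \<in> X \<Longrightarrow> (\<lambda>i. c * x i + d * y i) \<in> X" by (rule *)
  show "x \<in> X \<Longrightarrow> (\<lambda>i. c * x i) \<in> X" using *[of x x c 0] by simp
  show "x \<in> X \<Longrightarrow> y \<in> X \<Longrightarrow> (\<lambda>i. x i + y i) \<in> X" using *[of x y 1 1] by simp
  show "x \<in> X \<Longrightarrow> y \<in> X \<Longrightarrow> (\<lambda>i. x i - y i) \<in> X" using *[of x y 1 "-1"] by simp
  show "x \<in> X \<Longrightarrow> y \<in> X \<Longrightarrow> (\<lambda>i. x i - d * y i) \<in> X" using *[of x y 1 "-d"] by simp
qed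

lemma subsp_coord: "subsp (coord D)"
  by (auto simp: subsp_def coord_def)

lemma subsp_sum:
  assumes "subsp X" "\<And>k. k \<in> J \<Longrightarrow> f k \<in> X"
  shows "(\<lambda>i. \<Sum>k\<in>J. c k * f k i) \<in> X"
  using assms(2)
proof (induction J rule: infinite_finite_induct)
  case (insert k J)
  then have "(\<lambda>i. c k * f k i + 1 * (\<Sum>k\<in>J. c k * f k i)) \<in> X"
    by (intro subsp_comb[OF assms(1)]) auto
  then show ?case using insert.hyps by simp
qed (use subsp_zero[OF assms(1)] in auto)

text \<open>The dimension is the number of pivots, the positions at which the last nonzero entry of an
  element can occur; an echelon basis has one vector for each of them.\<close>

definition lead :: "nat \<Rightarrow> (nat \<Rightarrow> complex) \<Rightarrow> bool" where
  "lead i x \<longleftrightarrow> x i \<noteq> 0 \<and> (\<forall>j>i. x j = 0)"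

definition piv :: "(nat \<Rightarrow> complex) set \<Rightarrow> nat set" where
  "piv X = {i. \<exists>x\<in>X. lead i x}"

definition dm :: "(nat \<Rightarrow> complex) set \<Rightarrow> nat" where "dm X = card (piv X)"

definition ins :: "(nat \<Rightarrow> complex) set \<Rightarrow> (nat \<Rightarrow> complex) \<Rightarrow> (nat \<Rightarrow> complex) set" where
  "ins A v = {\<lambda>i. a i + c * v i | a c. a \<in> A}"

lemma lead_exists:
  assumes "x \<in> V n" "x \<noteq> (\<lambda>_. 0)"
  shows "\<exists>i<n. lead i x"
proof -
  let ?P = "{i. x i \<noteq> 0}"
  have sub: "?P \<subseteq> {..<n}" using assms(1) by (auto simp: coord_def)
  then have fin: "finite ?P" by (rule finite_subset) simp
  have ne: "?P \<noteq> {}" using assms(2) by auto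
  have "lead (Max ?P) x"
    unfolding lead_def using Max_in[OF fin ne] Max_ge[OF fin] by (auto simp: not_le[symmetric])
  moreover have "Max ?P < n" using Max_in[OF fin ne] sub by auto
  ultimately show ?thesis by blast
qed

lemma piv_sub: "X \<subseteq> V n \<Longrightarrow> piv X \<subseteq> {..<n}"
  by (force simp: piv_def lead_def coord_def)

lemma finite_piv: "X \<subseteq> V n \<Longrightarrow> finite (piv X)"
  by (erule finite_subset[OF piv_sub]) simp

lemma dm_le: "X \<subseteq> V n \<Longrightarrow> dm X \<le> n"
  using card_mono[of "{..<n}", OF _ piv_sub] by (simp add: dm_def)

lemma dm_mono: "A \<subseteq> C \<Longrightarrow> C \<subseteq> V n \<Longrightarrow> dm A \<le> dm C"
  unfolding dm_def by (rule card_mono[OF finite_piv]) (auto simp: piv_def)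

lemma dm_zero: "dm {\<lambda>_. 0} = 0"
  by (simp add: dm_def piv_def lead_def)

lemma dm_coord: "dm (V n) = n"
proof -
  have "piv (V n) = {..<n}"
  proof
    show "{..<n} \<subseteq> piv (V n)"
    proof
      fix i assume "i \<in> {..<n}"
      then have "unit i \<in> V n" "lead i (unit i)" by (auto simp: unit_def coord_def lead_def)
      then show "i \<in> piv (V n)" by (auto simp: piv_def)
    qed
  qed (rule piv_sub, simp)
  then show ?thesis by (simp add: dm_def)
qed

lemma reduce_lead:
  assumes A: "subsp A" "A \<subseteq> V n" and x: "x \<in> V n" "x \<notin> A" and i: "lead i x" "i \<in> piv A"
  obtains a j where "a \<in> A" "lead j (\<lambda>k. x k - a k)" "j < i"
proof -
  obtain b where b: "b \<in> A" "lead i b" using i by (auto simp: piv_def)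
  let ?a = "\<lambda>k. (x i / b i) * b k"
  let ?y = "\<lambda>k. x k - ?a k"
  have a: "?a \<in> A" by (rule subsp_scale[OF A(1) b(1)])
  have "?y \<noteq> (\<lambda>_. 0)"
  proof
    assume "?y = (\<lambda>_. 0)"
    then have "x k = ?a k" for k by (meson eq_iff_diff_eq_0)
    then have "x = ?a" by blast
    then show False using a x by simp
  qed
  moreover have "?y \<in> V n" using x a A by (auto simp: coord_def)
  ultimately obtain j where j: "lead j ?y" using lead_exists by blast
  have "?y k = 0" if "k \<ge> i" for k
    using b(2) i(1) that by (cases "k = i") (auto simp: lead_def)
  then have "j < i" using j by (meson lead_def not_le)
  with j a that show thesis by blast
qed

text \<open>A vector of \<open>C - A\<close> whose leading position is least leads at a position that is no pivot of
  \<open>A\<close>, since it could be shortened otherwise.\<close>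

lemma dm_strict_mono:
  assumes A: "subsp A" and C: "subsp C" "A \<subseteq> C" "A \<noteq> C" "C \<subseteq> V n"
  shows "dm A < dm C"
proof -
  have AV: "A \<subseteq> V n" using C by auto
  have "piv A \<subseteq> piv C" using C by (auto simp: piv_def)
  moreover have "piv A \<noteq> piv C"
  proof
    assume eq: "piv A = piv C"
    let ?P = "\<lambda>i. \<exists>x\<in>C - A. lead i x"
    obtain x0 where x0: "x0 \<in> C - A" using C by auto
    then have "x0 \<noteq> (\<lambda>_. 0)" using subsp_zero[OF A] by auto
    then have ex: "\<exists>i. ?P i" using lead_exists[of x0 n] x0 C by blast
    define i where "i = (LEAST i. ?P i)"
    obtain x where x: "x \<in> C" "x \<notin> A" "lead i x" using LeastI_ex[OF ex] by (auto simp: i_def)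
    then have "i \<in> piv A" using eq by (auto simp: piv_def)
    then obtain a j where a: "a \<in> A" "lead j (\<lambda>k. x k - a k)" "j < i"
      using reduce_lead[OF A AV, of x i] x C by blast
    have "(\<lambda>k. x k - a k) \<in> C" using subsp_diff[OF C(1)] x a C by blast
    moreover have "(\<lambda>k. x k - a k) \<notin> A"
    proof
      assume "(\<lambda>k. x k - a k) \<in> A"
      from subsp_add[OF A this a(1)] show False using x by simp
    qed
    ultimately have "?P j" using a by blast
    then show False using a(3) not_less_Least i_def by blast
  qed
  ultimately show ?thesis unfolding dm_def
    by (intro psubset_card_mono) (use finite_piv[OF C(4)] in auto)
qed

lemma subsp_eqI: "subsp A \<Longrightarrow> subsp C \<Longrightarrow> A \<subseteq> C \<Longrightarrow> C \<subseteq> V n \<Longrightarrow> dm C \<le> dm A \<Longrightarrow> A = C"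
  using dm_strict_mono by fastforce

lemma insI: "a \<in> A \<Longrightarrow> x = (\<lambda>i. a i + c * v i) \<Longrightarrow> x \<in> ins A v"
  by (auto simp: ins_def)

lemma subsp_ins:
  assumes "subsp A" shows "subsp (ins A v)"
  unfolding subsp_def
proof (intro conjI ballI allI)
  show "(\<lambda>_. 0) \<in> ins A v"
    unfolding ins_def using subsp_zero[OF assms] by (force intro: exI[of _ "0::complex"])
  fix x y c d assume "x \<in> ins A v" "y \<in> ins A v"
  then obtain a e b f where x: "x = (\<lambda>i. a i + e * v i)" "a \<in> A" and y: "y = (\<lambda>i. b i + f * v i)" "b \<in> A"
    by (auto simp: ins_def)
  have "(\<lambda>i. c * x i + d * y i) = (\<lambda>i. (c * a i + d * b i) + (c * e + d * f) * v i)"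
    by (auto simp: x y algebra_simps)
  from insI[OF subsp_comb[OF assms x(2) y(2)] this]
  show "(\<lambda>i. c * x i + d * y i) \<in> ins A v" .
qed

lemma ins_sub: "A \<subseteq> ins A v"
proof
  fix a assume "a \<in> A"
  then have "\<exists>a' c. a = (\<lambda>i. a' i + c * v i) \<and> a' \<in> A" by (intro exI[of _ a] exI[of _ 0]) simp
  then show "a \<in> ins A v" by (simp add: ins_def)
qed

lemma ins_mem: "subsp A \<Longrightarrow> v \<in> ins A v"
  unfolding ins_def using subsp_zero by (force intro: exI[of _ "\<lambda>_. 0"] exI[of _ "1::complex"])

lemma ins_least: "subsp X \<Longrightarrow> A \<subseteq> X \<Longrightarrow> v \<in> X \<Longrightarrow> ins A v \<subseteq> X"
  unfolding ins_def using subsp_comb[of X _ v 1] by auto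

text \<open>All new pivots are at one position, the least leading position of a vector \<open>v - a\<close> with
  \<open>a \<in> A\<close>.\<close>

lemma dm_ins_le:
  assumes A: "subsp A" "A \<subseteq> V n" and v: "v \<in> V n"
  shows "dm (ins A v) \<le> Suc (dm A)"
proof (cases "v \<in> A")
  case True
  then have "ins A v = A" using ins_least[OF A(1) _ True] ins_sub by blast
  then show ?thesis by simp
next
  case False
  let ?P = "\<lambda>i. \<exists>a\<in>A. lead i (\<lambda>k. v k - a k)"
  have ex: "\<exists>i. ?P i"
    using lead_exists[OF v] False subsp_zero[OF A(1)] by force
  define i where "i = (LEAST i. ?P i)"
  obtain a0 where a0: "a0 \<in> A" "lead i (\<lambda>k. v k - a0 k)" using LeastI_ex[OF ex] by (auto simp: i_def)
  have "piv (ins A v) \<subseteq> insert i (piv A)"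
  proof
    fix j assume "j \<in> piv (ins A v)"
    then obtain a c where a: "a \<in> A" "lead j (\<lambda>k. a k + c * v k)" by (auto simp: piv_def ins_def)
    show "j \<in> insert i (piv A)"
    proof (cases "c = 0")
      case True then show ?thesis using a by (auto simp: piv_def)
    next
      case c: False
      let ?a = "\<lambda>k. (- 1 / c) * a k"
      have aA: "?a \<in> A" by (rule subsp_scale[OF A(1) a(1)])
      have eq: "v k - ?a k = (a k + c * v k) / c" for k using c by (simp add: field_simps)
      have l: "lead j (\<lambda>k. v k - ?a k)" using a(2) c unfolding eq by (auto simp: lead_def)
      have "?P j" by (rule bexI[OF _ aA]) (rule l)
      then have ij: "i \<le> j" unfolding i_def by (rule Least_le)
      show ?thesis
      proof (cases "i = j")
        case False
        then have "i < j" using ij by simp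
        then have "lead j (\<lambda>k. a0 k - ?a k)" using a0(2) l unfolding lead_def
          by (metis (no_types, lifting) eq_iff_diff_eq_0 less_trans)
        then show ?thesis using subsp_diff[OF A(1) a0(1) aA] by (auto simp: piv_def)
      qed simp
    qed
  qed
  then have "card (piv (ins A v)) \<le> card (insert i (piv A))"
    by (intro card_mono) (auto intro: finite_piv[OF A(2)])
  also have "\<dots> \<le> Suc (card (piv A))" by (rule card_insert_le_m1) auto
  finally show ?thesis by (simp add: dm_def)
qed

lemma ins_V: "A \<subseteq> V n \<Longrightarrow> v \<in> V n \<Longrightarrow> ins A v \<subseteq> V n"
  by (rule ins_least) (auto intro: subsp_coord)

lemma dm_ins:
  assumes A: "subsp A" "A \<subseteq> V n" and v: "v \<in> V n" "v \<notin> A"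
  shows "dm (ins A v) = Suc (dm A)"
proof -
  have "A \<noteq> ins A v" using ins_mem[OF A(1)] v by auto
  then have "dm A < dm (ins A v)"
    using dm_strict_mono[OF A(1) subsp_ins[OF A(1)] ins_sub _ ins_V[OF A(2) v(1)]] by blast
  with dm_ins_le[OF A v(1)] show ?thesis by simp
qed

section \<open>Matrices, bilinear forms and orthogonal spaces\<close>

definition act :: "nat \<Rightarrow> complex mat \<Rightarrow> (nat \<Rightarrow> complex) \<Rightarrow> nat \<Rightarrow> complex" where
  "act n A x = (\<lambda>i. if i < n then \<Sum>j<n. A $$ (i, j) * x j else 0)"

definition frm :: "nat \<Rightarrow> complex mat \<Rightarrow> (nat \<Rightarrow> complex) \<Rightarrow> (nat \<Rightarrow> complex) \<Rightarrow> complex" where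
  "frm n S x y = (\<Sum>i<n. x i * act n S y i)"

lemma act_V [simp, intro]: "act n A x \<in> V n"
  by (auto simp: act_def coord_def)

lemma act_comb: "act n A (\<lambda>i. c * x i + d * y i) = (\<lambda>i. c * act n A x i + d * act n A y i)"
  by (auto simp: act_def algebra_simps sum.distrib sum_distrib_left)

lemma act_zero: "act n A (\<lambda>_. 0) = (\<lambda>_. 0)"
  by (auto simp: act_def)

lemma act_scale: "act n A (\<lambda>i. c * x i) = (\<lambda>i. c * act n A x i)"
  using act_comb[of n A c x 0 x] by simp

lemma act_add: "act n A (\<lambda>i. x i + y i) = (\<lambda>i. act n A x i + act n A y i)"
  using act_comb[of n A 1 x 1 y] by simp

lemma act_diff: "act n A (\<lambda>i. x i - y i) = (\<lambda>i. act n A x i - act n A y i)"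
  using act_comb[of n A 1 x "-1" y] by simp

lemma act_mult:
  assumes "A \<in> carrier_mat n n" "B \<in> carrier_mat n n"
  shows "act n (A * B) x = act n A (act n B x)"
proof
  fix i show "act n (A * B) x i = act n A (act n B x) i"
  proof (cases "i < n")
    case True
    have "(A * B) $$ (i, j) = (\<Sum>k<n. A $$ (i, k) * B $$ (k, j))" if "j < n" for j
      using assms True that by (simp add: scalar_prod_def atLeast0LessThan)
    then have "act n (A * B) x i = (\<Sum>j<n. \<Sum>k<n. A $$ (i, k) * B $$ (k, j) * x j)"
      using True by (simp add: act_def sum_distrib_right)
    also have "\<dots> = (\<Sum>k<n. \<Sum>j<n. A $$ (i, k) * B $$ (k, j) * x j)" by (rule sum.swap)
    also have "\<dots> = act n A (act n B x) i"
      using True by (simp add: act_def sum_distrib_left mult.assoc)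
    finally show ?thesis .
  qed (simp add: act_def)
qed

lemma act_one: "x \<in> V n \<Longrightarrow> act n (1\<^sub>m n) x = x"
proof
  fix i assume x: "x \<in> V n"
  show "act n (1\<^sub>m n) x i = x i"
  proof (cases "i < n")
    case True
    have "(\<Sum>j<n. (1\<^sub>m n) $$ (i, j) * x j) = (\<Sum>j<n. if j = i then x j else 0)"
      using True by (intro sum.cong) auto
    then show ?thesis using True by (simp add: act_def)
  qed (use x in \<open>auto simp: act_def coord_def\<close>)
qed

lemma act_unit: "j < n \<Longrightarrow> act n A (unit j) = (\<lambda>i. if i < n then A $$ (i, j) else 0)"
  by (auto simp: act_def unit_def if_distrib[of "\<lambda>t. _ * t"] cong: if_cong)

lemma coord_stable_iff:
  assumes k: "k \<le> n"
  shows "act n t ` coord {..<k} \<subseteq> coord {..<k} \<longleftrightarrow> (\<forall>i j. k \<le> i \<and> i < n \<and> j < k \<longrightarrow> t $$ (i, j) = 0)"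
proof
  assume st: "act n t ` coord {..<k} \<subseteq> coord {..<k}"
  show "\<forall>i j. k \<le> i \<and> i < n \<and> j < k \<longrightarrow> t $$ (i, j) = 0"
  proof (intro allI impI, elim conjE)
    fix i j assume ij: "k \<le> i" "i < n" "j < k"
    have "unit j \<in> coord {..<k}" using ij by (auto simp: unit_def coord_def)
    then have "act n t (unit j) \<in> coord {..<k}" using st by blast
    then have "act n t (unit j) i = 0" using ij by (auto simp: coord_def)
    then show "t $$ (i, j) = 0" using ij k by (simp add: act_unit)
  qed
next
  assume e: "\<forall>i j. k \<le> i \<and> i < n \<and> j < k \<longrightarrow> t $$ (i, j) = 0"
  show "act n t ` coord {..<k} \<subseteq> coord {..<k}"
  proof
    fix y assume "y \<in> act n t ` coord {..<k}"
    then obtain x where x: "x \<in> coord {..<k}" "y = act n t x" by blast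
    have "t $$ (i, j) * x j = 0" if "i < n" "\<not> i < k" for i j
      using e x(1) that by (cases "j < k") (auto simp: coord_def)
    then show "y \<in> coord {..<k}" unfolding x(2) by (auto simp: act_def coord_def)
  qed
qed

lemma V_expand: "x \<in> V n \<Longrightarrow> x = (\<lambda>i. \<Sum>k<n. x k * unit k i)"
proof
  fix i assume "x \<in> V n"
  have "(\<Sum>k<n. x k * unit k i) = (\<Sum>k<n. if k = i then x k else 0)"
    by (intro sum.cong) (auto simp: unit_def)
  then show "x i = (\<Sum>k<n. x k * unit k i)" using \<open>x \<in> V n\<close> by (auto simp: coord_def)
qed

lemma act_eqI:
  assumes "A \<in> carrier_mat n n" "B \<in> carrier_mat n n" "\<And>x. x \<in> V n \<Longrightarrow> act n A x = act n B x"
  shows "A = B"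
proof (rule eq_matI)
  fix i j assume ij: "i < dim_row B" "j < dim_col B"
  then have "unit j \<in> V n" using assms by (auto simp: unit_def coord_def)
  from assms(3)[OF this] have "act n A (unit j) i = act n B (unit j) i" by simp
  then show "A $$ (i, j) = B $$ (i, j)" using ij assms by (auto simp: act_unit)
qed (use assms in auto)

lemma act_mat_of:
  assumes lin: "\<And>x y c d. f (\<lambda>i. c * x i + d * y i) = (\<lambda>i. c * f x i + d * f y i)"
    and f: "\<And>x. x \<in> V n \<Longrightarrow> f x \<in> V n" and x: "x \<in> V n"
  shows "act n (mat n n (\<lambda>(i, j). f (unit j) i)) x = f x"
proof -
  have f0: "f (\<lambda>_. 0) = (\<lambda>_. 0)" using lin[of 0 "\<lambda>_. 0" 0 "\<lambda>_. 0"] by simp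
  have sums: "f (\<lambda>i. \<Sum>k<m. c k * g k i) = (\<lambda>i. \<Sum>k<m. c k * f (g k) i)" for m :: nat and c g
  proof (induction m)
    case (Suc m)
    have "f (\<lambda>i. \<Sum>k<Suc m. c k * g k i) = f (\<lambda>i. 1 * (\<Sum>k<m. c k * g k i) + c m * g m i)" by simp
    then show ?case by (simp only: lin Suc) simp
  qed (simp add: f0)
  have "f x = (\<lambda>i. \<Sum>k<n. x k * f (unit k) i)"
    using sums[where m = n and c = x and g = unit] V_expand[OF x] by simp
  moreover have "f x \<in> V n" using f x by blast
  ultimately show ?thesis
    by (auto simp: act_def coord_def fun_eq_iff intro!: sum.cong)
qed

lemma subsp_act_image:
  assumes "subsp X" shows "subsp (act n A ` X)"
  unfolding subsp_def
proof (intro conjI ballI allI)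
  show "(\<lambda>_. 0) \<in> act n A ` X" by (rule image_eqI[OF _ subsp_zero[OF assms]]) (simp add: act_zero)
  fix x y c d assume "x \<in> act n A ` X" "y \<in> act n A ` X"
  then obtain a b where "x = act n A a" "y = act n A b" "a \<in> X" "b \<in> X" by auto
  then show "(\<lambda>i. c * x i + d * y i) \<in> act n A ` X"
    by (intro image_eqI[OF _ subsp_comb[OF assms, of a b]]) (simp_all add: act_comb)
qed

lemma frm_comb_right: "frm n S x (\<lambda>i. c * y i + d * z i) = c * frm n S x y + d * frm n S x z"
  by (simp add: frm_def act_comb algebra_simps sum.distrib sum_distrib_left)

lemma frm_comb_left: "frm n S (\<lambda>i. c * y i + d * z i) x = c * frm n S y x + d * frm n S z x"
  by (simp add: frm_def algebra_simps sum.distrib sum_distrib_left)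

lemma frm_sum: "frm n S x y = (\<Sum>i<n. \<Sum>j<n. x i * S $$ (i, j) * y j)"
  by (auto simp: frm_def act_def sum_distrib_left mult.assoc intro!: sum.cong)

lemma frm_transpose:
  assumes "S \<in> carrier_mat n n"
  shows "frm n (transpose_mat S) x y = frm n S y x"
proof -
  have "frm n (transpose_mat S) x y = (\<Sum>i<n. \<Sum>j<n. y j * S $$ (j, i) * x i)"
    using assms by (auto simp: frm_sum algebra_simps intro!: sum.cong)
  also have "\<dots> = frm n S y x" unfolding frm_sum by (rule sum.swap)
  finally show ?thesis .
qed

lemma frm_act_left:
  assumes "A \<in> carrier_mat n n" "S \<in> carrier_mat n n"
  shows "frm n S (act n A x) y = frm n (transpose_mat A * S) x y"
proof -
  have "frm n S (act n A x) y = (\<Sum>i<n. \<Sum>j<n. A $$ (i, j) * x j * act n S y i)"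
    by (auto simp: frm_def act_def sum_distrib_right intro!: sum.cong)
  also have "\<dots> = (\<Sum>j<n. \<Sum>i<n. A $$ (i, j) * x j * act n S y i)" by (rule sum.swap)
  also have "\<dots> = (\<Sum>j<n. x j * act n (transpose_mat A) (act n S y) j)"
    using assms by (auto simp: act_def sum_distrib_left algebra_simps intro!: sum.cong)
  also have "\<dots> = frm n (transpose_mat A * S) x y"
    using assms by (simp add: frm_def act_mult)
  finally show ?thesis .
qed

lemma frm_act_right:
  assumes "A \<in> carrier_mat n n" "S \<in> carrier_mat n n"
  shows "frm n S x (act n A y) = frm n (S * A) x y"
  using assms by (simp add: frm_def act_mult)

lemma unit_V: "j < n \<Longrightarrow> unit j \<in> V n" by (auto simp: unit_def coord_def)

lemma frm_unit_left: "i < n \<Longrightarrow> frm n S (unit i) y = act n S y i"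
proof -
  assume i: "i < n"
  have "frm n S (unit i) y = (\<Sum>k<n. if k = i then act n S y k else 0)"
    unfolding frm_def by (intro sum.cong) (auto simp: unit_def)
  then show ?thesis using i by simp
qed

lemma frm_unit_unit: "i < n \<Longrightarrow> j < n \<Longrightarrow> frm n S (unit i) (unit j) = S $$ (i, j)"
  by (simp add: frm_unit_left act_unit)

lemma frm_eqI:
  assumes "A \<in> carrier_mat n n" "B \<in> carrier_mat n n"
    "\<And>x y. x \<in> V n \<Longrightarrow> y \<in> V n \<Longrightarrow> frm n A x y = frm n B x y"
  shows "A = B"
  by (rule eq_matI) (use assms unit_V in \<open>auto simp: frm_unit_unit[symmetric]\<close>)

definition perp :: "nat \<Rightarrow> complex mat \<Rightarrow> (nat \<Rightarrow> complex) set \<Rightarrow> (nat \<Rightarrow> complex) set" where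
  "perp n S X = {y \<in> V n. \<forall>x\<in>X. frm n S x y = 0}"

lemma subsp_perp: "subsp (perp n S X)"
  unfolding subsp_def perp_def using subsp_comb[OF subsp_coord]
  by (auto simp: frm_comb_right) (auto simp: frm_def act_zero coord_def)

lemma perp_V: "perp n S X \<subseteq> V n" by (auto simp: perp_def)

lemma perp_mono: "A \<subseteq> C \<Longrightarrow> perp n S C \<subseteq> perp n S A" by (auto simp: perp_def)

lemma perp_zero: "perp n S {\<lambda>_. 0} = V n"
  by (auto simp: perp_def frm_def)

lemma perp_ins:
  assumes "subsp A" shows "perp n S (ins A v) = {y \<in> perp n S A. frm n S v y = 0}"
proof -
  have "frm n S (\<lambda>i. a i + c * v i) y = frm n S a y + c * frm n S v y" for a c y
    using frm_comb_left[of n S 1 a c v y] by simp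
  then have "perp n S (ins A v) \<supseteq> {y \<in> perp n S A. frm n S v y = 0}"
    by (auto simp: perp_def ins_def)
  moreover have "perp n S (ins A v) \<subseteq> {y \<in> perp n S A. frm n S v y = 0}"
    using ins_sub[of A v] ins_mem[OF assms, of v] by (auto simp: perp_def)
  ultimately show ?thesis by blast
qed

lemma dm_perp_ins:
  assumes A: "subsp A"
  shows "dm (perp n S A) \<le> Suc (dm (perp n S (ins A v)))"
proof (cases "\<exists>w\<in>perp n S A. frm n S v w \<noteq> 0")
  case False
  then have "perp n S (ins A v) = perp n S A" by (auto simp: perp_ins[OF A])
  then show ?thesis by simp
next
  case True
  then obtain w where w: "w \<in> perp n S A" "frm n S v w \<noteq> 0" by blast
  let ?B = "perp n S (ins A v)"
  have "perp n S A \<subseteq> ins ?B w"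
  proof
    fix y assume y: "y \<in> perp n S A"
    let ?c = "frm n S v y / frm n S v w"
    let ?z = "\<lambda>i. 1 * y i + (- ?c) * w i"
    have "?z \<in> perp n S A" by (rule subsp_comb[OF subsp_perp y w(1)])
    moreover have "frm n S v ?z = 0" unfolding frm_comb_right using w by simp
    ultimately have "?z \<in> ?B" by (simp add: perp_ins[OF A])
    then show "y \<in> ins ?B w" by (rule insI[where c = ?c]) auto
  qed
  then have "dm (perp n S A) \<le> dm (ins ?B w)"
    by (rule dm_mono[of _ _ n]) (use ins_V perp_V w in blast)
  also have "\<dots> \<le> Suc (dm ?B)" by (rule dm_ins_le[OF subsp_perp perp_V]) (use w perp_V in blast)
  finally show ?thesis .
qed

text \<open>Each vector that enlarges \<open>A\<close> costs the orthogonal space at most one dimension. The chains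
  from \<open>0\<close> to \<open>X\<close> and from \<open>X\<close> to \<open>V n\<close> give the two inequalities for the dimension of the
  orthogonal space of \<open>X\<close>.\<close>

lemma dm_perp_step:
  assumes "subsp A" "subsp X" "A \<subseteq> X" "X \<subseteq> V n"
  shows "dm (perp n S A) + dm A \<le> dm (perp n S X) + dm X"
  using assms
proof (induction "dm X - dm A" arbitrary: A rule: less_induct)
  case less
  show ?case
  proof (cases "A = X")
    case False
    then obtain v where v: "v \<in> X" "v \<notin> A" using less.prems by blast
    have AV: "A \<subseteq> V n" and vV: "v \<in> V n" using less.prems v by auto
    have d: "dm (ins A v) = Suc (dm A)" using dm_ins[OF less.prems(1) AV vV v(2)] .
    have sub: "ins A v \<subseteq> X" using ins_least less.prems v by blast
    then have "Suc (dm A) \<le> dm X" using dm_mono[OF sub less.prems(4)] d by simp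
    then have "dm (perp n S (ins A v)) + dm (ins A v) \<le> dm (perp n S X) + dm X"
      by (intro less.hyps) (use d sub less.prems subsp_ins in auto)
    then show ?thesis using dm_perp_ins[OF less.prems(1), of n S v] d by linarith
  qed simp
qed

lemma dm_perp:
  assumes X: "subsp X" "X \<subseteq> V n" and nondeg: "perp n S (V n) = {\<lambda>_. 0}"
  shows "dm (perp n S X) + dm X = n"
proof (rule antisym)
  show "dm (perp n S X) + dm X \<le> n"
    using dm_perp_step[OF X(1) subsp_coord X(2) subset_refl, where S=S] by (simp add: nondeg dm_zero dm_coord)
  have "subsp {\<lambda>_. 0::complex}" by (auto simp: subsp_def)
  from dm_perp_step[OF this X(1) _ X(2), where S=S] subsp_zero[OF X(1)]
  show "n \<le> dm (perp n S X) + dm X" by (simp add: perp_zero dm_zero dm_coord)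
qed

section \<open>Normal forms of subspaces under order-preserving operations\<close>

definition addc :: "nat \<Rightarrow> nat \<Rightarrow> complex \<Rightarrow> (nat \<Rightarrow> complex) \<Rightarrow> nat \<Rightarrow> complex" where
  "addc i j c x = x(i := x i + c * x j)"

definition scl :: "nat \<Rightarrow> complex \<Rightarrow> (nat \<Rightarrow> complex) \<Rightarrow> nat \<Rightarrow> complex" where
  "scl i c x = x(i := c * x i)"

text \<open>The pair \<open>p\<close>, \<open>q\<close> of labels preorders the coordinates by \<open>p i \<le> p j \<and> q i \<le> q j\<close>; a multiple
  of a coordinate may be added to a smaller one. These operations preserve \<open>coord D\<close> for every set
  \<open>D\<close> that is closed downwards, in particular the flags given by \<open>p\<close> and by \<open>q\<close>.\<close>

inductive_set moves :: "(nat \<Rightarrow> nat) \<Rightarrow> (nat \<Rightarrow> nat) \<Rightarrow> nat set \<Rightarrow>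
    ((nat \<Rightarrow> complex) \<Rightarrow> nat \<Rightarrow> complex) set"
  for p q :: "nat \<Rightarrow> nat" and I :: "nat set" where
  id: "(\<lambda>x. x) \<in> moves p q I"
| addc: "g \<in> moves p q I \<Longrightarrow> i \<in> I \<Longrightarrow> j \<in> I \<Longrightarrow> i \<noteq> j \<Longrightarrow> p i \<le> p j \<Longrightarrow> q i \<le> q j \<Longrightarrow>
    (\<lambda>x. addc i j c (g x)) \<in> moves p q I"
| scl: "g \<in> moves p q I \<Longrightarrow> i \<in> I \<Longrightarrow> c \<noteq> 0 \<Longrightarrow> (\<lambda>x. scl i c (g x)) \<in> moves p q I"

lemma moves_comp:
  assumes "g \<in> moves p q I" "h \<in> moves p q I"
  shows "(\<lambda>x. g (h x)) \<in> moves p q I"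
  using assms(1) by induction (auto intro: moves.intros assms(2))

lemma moves_mono: "g \<in> moves p q I \<Longrightarrow> I \<subseteq> J \<Longrightarrow> g \<in> moves p q J"
  by (induction rule: moves.induct) (auto intro: moves.intros)

lemma moves_scl: "i \<in> I \<Longrightarrow> c \<noteq> 0 \<Longrightarrow> scl i c \<in> moves p q I"
  using moves.scl[OF moves.id] by fastforce

lemma moves_linear:
  "g \<in> moves p q I \<Longrightarrow> g (\<lambda>i. c * x i + d * y i) = (\<lambda>i. c * g x i + d * g y i)"
  by (induction arbitrary: x y rule: moves.induct)
     (auto simp: addc_def scl_def algebra_simps fun_eq_iff)

lemma moves_upd: "g \<in> moves p q I \<Longrightarrow> m \<notin> I \<Longrightarrow> g (x(m := c)) = (g x)(m := c)"
  by (induction rule: moves.induct) (auto simp: addc_def scl_def fun_eq_iff)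

lemma moves_coord:
  assumes "g \<in> moves p q I"
    and D: "\<And>i j. i \<in> I \<Longrightarrow> j \<in> I \<Longrightarrow> p i \<le> p j \<Longrightarrow> q i \<le> q j \<Longrightarrow> j \<in> D \<Longrightarrow> i \<in> D"
  shows "g x \<in> coord D \<longleftrightarrow> x \<in> coord D"
  using assms(1)
proof (induction rule: moves.induct)
  case (addc g i j c)
  have "addc i j c y \<in> coord D \<longleftrightarrow> y \<in> coord D" for y
  proof (cases "j \<in> D")
    case True
    then have "i \<in> D" using D addc.hyps by blast
    then show ?thesis by (auto simp: coord_def addc_def)
  next
    case j: False
    have "addc i j c y = y" if "y j = 0" using that by (simp add: addc_def)
    moreover have "y \<in> coord D \<Longrightarrow> y j = 0" "addc i j c y \<in> coord D \<Longrightarrow> addc i j c y j = 0"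
      using j by (auto simp: coord_def)
    moreover have "addc i j c y j = y j" using addc.hyps(4) by (simp add: addc_def)
    ultimately show ?thesis by metis
  qed
  then show ?case using addc.IH by simp
next
  case (scl g i c)
  then show ?case by (auto simp: coord_def scl_def)
qed simp

lemma moves_inj_surj: "g \<in> moves p q I \<Longrightarrow> bij g"
proof (induction rule: moves.induct)
  case id show ?case by (simp add: bij_def)
next
  case (addc g i j c)
  have "bij (addc i j c)"
  proof (rule o_bij[of "addc i j (- c)"])
    show "addc i j (- c) \<circ> addc i j c = id" "addc i j c \<circ> addc i j (- c) = id"
      using addc.hyps by (auto simp: addc_def fun_eq_iff)
  qed
  then show ?case using bij_comp[OF addc.IH] by (simp add: comp_def)
next
  case (scl g i c)
  have "bij (scl i c)"
  proof (rule o_bij[of "scl i (1 / c)"])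
    show "scl i (1 / c) \<circ> scl i c = id" "scl i c \<circ> scl i (1 / c) = id"
      using scl.hyps by (auto simp: scl_def fun_eq_iff)
  qed
  then show ?case using bij_comp[OF scl.IH] by (simp add: comp_def)
qed

lemma moves_image_coord:
  assumes "g \<in> moves p q I"
    and D: "\<And>i j. i \<in> I \<Longrightarrow> j \<in> I \<Longrightarrow> p i \<le> p j \<Longrightarrow> q i \<le> q j \<Longrightarrow> j \<in> D \<Longrightarrow> i \<in> D"
  shows "g ` coord D = coord D"
proof
  show "g ` coord D \<subseteq> coord D" using moves_coord[OF assms] by auto
  show "coord D \<subseteq> g ` coord D"
  proof
    fix y assume y: "y \<in> coord D"
    obtain x where "y = g x" using moves_inj_surj[OF assms(1)] by (meson bij_pointE)
    then show "y \<in> g ` coord D" using moves_coord[OF assms, where x = x] y by auto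
  qed
qed

lemma subsp_moves_image:
  assumes g: "g \<in> moves p q I" and X: "subsp X" shows "subsp (g ` X)"
  unfolding subsp_def
proof (intro conjI ballI allI)
  have "g (\<lambda>_. 0) = (\<lambda>_. 0)" using moves_linear[OF g, where c = 0 and d = 0] by simp
  then show "(\<lambda>_. 0) \<in> g ` X" using subsp_zero[OF X] by (metis image_eqI)
  fix x y c d assume "x \<in> g ` X" "y \<in> g ` X"
  then obtain a b where "x = g a" "y = g b" "a \<in> X" "b \<in> X" by auto
  then show "(\<lambda>i. c * x i + d * y i) \<in> g ` X"
    by (intro image_eqI[OF _ subsp_comb[OF X, of a b]]) (simp_all add: moves_linear[OF g])
qed

lemma moves_add_many:
  assumes "finite D" "m \<in> I" "D \<subseteq> I - {m}" "\<And>r. r \<in> D \<Longrightarrow> p m \<le> p r \<and> q m \<le> q r"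
  shows "(\<lambda>x. x(m := x m + (\<Sum>r\<in>D. c r * x r))) \<in> moves p q I"
  using assms
proof (induction D rule: finite_induct)
  case empty then show ?case by (simp add: moves.id)
next
  case (insert r D)
  then have g: "(\<lambda>x. x(m := x m + (\<Sum>r\<in>D. c r * x r))) \<in> moves p q I"
    by (intro insert.IH) auto
  have "(\<lambda>x. addc m r (c r) (x(m := x m + (\<Sum>r\<in>D. c r * x r)))) \<in> moves p q I"
    by (rule moves.addc[OF g]) (use insert in auto)
  moreover have "(\<lambda>x. addc m r (c r) (x(m := x m + (\<Sum>r\<in>D. c r * x r))))
      = (\<lambda>x. x(m := x m + (\<Sum>r\<in>insert r D. c r * x r)))"
    using insert by (auto simp: addc_def fun_eq_iff)
  ultimately show ?case by (simp only:)
qed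

text \<open>For an involution \<open>\<pi>\<close> that fixes everything outside \<open>R\<close>, this is the span of the unit
  vectors of the fixed points in \<open>R\<close> and of the sums \<open>e\<^sub>i + e\<^sub>\<pi>\<^sub>i\<close> for the
  pairs.\<close>

definition NF :: "nat set \<Rightarrow> (nat \<Rightarrow> nat) \<Rightarrow> (nat \<Rightarrow> complex) set" where
  "NF R \<pi> = {x \<in> coord R. \<forall>i. x (\<pi> i) = x i}"

text \<open>Only incomparable coordinates may be paired: in \<open>e\<^sub>i + e\<^sub>j\<close> with \<open>i\<close> below \<open>j\<close>,
  an operation removes \<open>e\<^sub>i\<close>.\<close>

definition pairing :: "(nat \<Rightarrow> nat) \<Rightarrow> (nat \<Rightarrow> nat) \<Rightarrow> nat set \<Rightarrow> (nat \<Rightarrow> nat) \<Rightarrow> bool" where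
  "pairing p q R \<pi> \<longleftrightarrow> (\<forall>i. \<pi> (\<pi> i) = i) \<and> (\<forall>i. i \<notin> R \<longrightarrow> \<pi> i = i) \<and>
     (\<forall>i. \<pi> i \<noteq> i \<longrightarrow> \<not> (p i \<le> p (\<pi> i) \<and> q i \<le> q (\<pi> i)))"

text \<open>There are no three pairwise incomparable coordinates. (Indices need not be distinct, as
  equal ones are comparable.)\<close>

definition width2 :: "(nat \<Rightarrow> nat) \<Rightarrow> (nat \<Rightarrow> nat) \<Rightarrow> nat set \<Rightarrow> bool" where
  "width2 p q I \<longleftrightarrow> (\<forall>i\<in>I. \<forall>j\<in>I. \<forall>k\<in>I.
     (p i \<le> p j \<and> q i \<le> q j) \<or> (p j \<le> p i \<and> q j \<le> q i) \<or>
     (p i \<le> p k \<and> q i \<le> q k) \<or> (p k \<le> p i \<and> q k \<le> q i) \<or>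
     (p j \<le> p k \<and> q j \<le> q k) \<or> (p k \<le> p j \<and> q k \<le> q j))"

text \<open>Without the unit vector of \<open>m\<close>, the space \<open>Y\<close> is the graph of a linear functional over its
  projection. The functional is evaluated on the spanning vectors \<open>u r\<close> of the normal form; a pair
  occurs twice among them, for each of its two elements, whence the factors \<open>1/2\<close>.\<close>

lemma graph_functional:
  assumes Y: "subsp Y" and proj: "(\<lambda>y. y(m := 0)) ` Y = NF R \<pi>" and unit: "unit m \<notin> Y"
    and fin: "finite R" and P: "pairing p q R \<pi>" and mR: "m \<notin> R"
  obtains \<psi> where "\<And>y. y \<in> Y \<longleftrightarrow> y(m := 0) \<in> NF R \<pi> \<and> y m = (\<Sum>r\<in>R. \<psi> r * y r)"
proof -
  have inv: "\<pi> (\<pi> i) = i" for i using P by (auto simp: pairing_def)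
  have out: "i \<notin> R \<Longrightarrow> \<pi> i = i" for i using P by (auto simp: pairing_def)
  have piR: "\<pi> i \<in> R \<longleftrightarrow> i \<in> R" for i using inv out by metis
  define u where "u r = (\<lambda>i. if i = r \<or> i = \<pi> r then 1 else 0 :: complex)" for r
  have uNF: "u r \<in> NF R \<pi>" if "r \<in> R" for r
    using that inv piR by (auto simp: u_def NF_def coord_def) metis+
  have "\<forall>r\<in>R. \<exists>w. w \<in> Y \<and> w(m := 0) = u r" using uNF proj by (metis (no_types, lifting) image_iff)
  then obtain w where w: "\<And>r. r \<in> R \<Longrightarrow> w r \<in> Y" "\<And>r. r \<in> R \<Longrightarrow> (w r)(m := 0) = u r" by metis
  have wi: "w r i = u r i" if "r \<in> R" "i \<noteq> m" for r i
    using w(2)[OF that(1)] that(2) by (metis fun_upd_other)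
  have zero: "y = (\<lambda>_. 0)" if "y \<in> Y" "y(m := 0) = (\<lambda>_. 0)" for y
  proof (rule ccontr)
    assume "y \<noteq> (\<lambda>_. 0)"
    have y0: "y i = 0" if "i \<noteq> m" for i using \<open>y(m := 0) = _\<close> that by (metis fun_upd_other)
    then have "y m \<noteq> 0" using \<open>y \<noteq> _\<close> by (metis ext)
    then have "(\<lambda>i. (1 / y m) * y i) = unit m" using y0 by (auto simp: unit_def)
    then show False using subsp_scale[OF Y that(1), of "1 / y m"] unit by simp
  qed
  define \<psi> where "\<psi> r = (if \<pi> r = r then 1 else 1 / 2) * w r m" for r
  have comb: "y i = (\<Sum>r\<in>R. (if \<pi> r = r then 1 else 1 / 2) * y r * u r i)" if y: "y \<in> NF R \<pi>" and "i \<noteq> m" for y i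
  proof (cases "i \<in> R")
    case True
    have yp: "y (\<pi> i) = y i" using y by (auto simp: NF_def)
    have "(\<Sum>r\<in>R. (if \<pi> r = r then 1 else 1 / 2) * y r * u r i)
        = (\<Sum>r\<in>{i, \<pi> i}. (if \<pi> r = r then 1 else 1 / 2) * y r * u r i)"
      by (rule sum.mono_neutral_right[OF fin]) (use True piR inv in \<open>auto simp: u_def\<close>)
    also have "\<dots> = y i" using yp inv by (cases "\<pi> i = i") (auto simp: u_def)
    finally show ?thesis by simp
  next
    case False
    have "u r i = 0" if "r \<in> R" for r using False that piR by (auto simp: u_def)
    moreover have "y i = 0" using y False by (auto simp: NF_def coord_def)
    ultimately show ?thesis by simp
  qed
  have main: "y m = (\<Sum>r\<in>R. \<psi> r * y r)" if y: "y \<in> Y" for y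
  proof -
    let ?z = "\<lambda>i. \<Sum>r\<in>R. ((if \<pi> r = r then 1 else 1 / 2) * y r) * w r i"
    have yN: "y(m := 0) \<in> NF R \<pi>" using proj y by auto
    have z: "?z \<in> Y" by (rule subsp_sum[OF Y]) (rule w(1))
    have "y i = ?z i" if "i \<noteq> m" for i
    proof -
      have "y i = (\<Sum>r\<in>R. (if \<pi> r = r then 1 else 1 / 2) * (y(m:=0)) r * u r i)"
        using comb[OF yN that] that by simp
      also have "\<dots> = ?z i" using wi that mR by (intro sum.cong) auto
      finally show ?thesis .
    qed
    then have "(\<lambda>i. y i - ?z i) = (\<lambda>_. 0)"
      by (intro zero[OF subsp_diff[OF Y y z]]) auto
    from fun_cong[OF this, of m] have "y m = ?z m" by simp
    then show ?thesis by (simp add: \<psi>_def mult_ac)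
  qed
  show thesis
  proof (rule that)
    fix y
    show "y \<in> Y \<longleftrightarrow> y(m := 0) \<in> NF R \<pi> \<and> y m = (\<Sum>r\<in>R. \<psi> r * y r)"
    proof
      assume "y \<in> Y" then show "y(m := 0) \<in> NF R \<pi> \<and> y m = (\<Sum>r\<in>R. \<psi> r * y r)"
        using main proj by auto
    next
      assume y: "y(m := 0) \<in> NF R \<pi> \<and> y m = (\<Sum>r\<in>R. \<psi> r * y r)"
      then obtain z where z: "z \<in> Y" "z(m := 0) = y(m := 0)" using proj by (metis (no_types, lifting) image_iff)
      then have zy: "z i = y i" if "i \<noteq> m" for i using that by (metis fun_upd_other)
      have "z m = (\<Sum>r\<in>R. \<psi> r * z r)" by (rule main[OF z(1)])
      also have "\<dots> = (\<Sum>r\<in>R. \<psi> r * y r)"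
      proof (rule sum.cong)
        fix r assume "r \<in> R"
        then have "z r = y r" using zy mR by metis
        then show "\<psi> r * z r = \<psi> r * y r" by simp
      qed simp
      also have "\<dots> = y m" using y by simp
      finally have "z = y" using zy by (metis ext)
      then show "y \<in> Y" using z by simp
    qed
  qed
qed

lemma NF_upd_outside:
  assumes P: "pairing p q R \<pi>" and m: "m \<notin> R"
  shows "y(m := 0) \<in> NF R \<pi> \<longleftrightarrow> y \<in> NF (insert m R) \<pi>"
proof -
  have inv: "\<pi> (\<pi> i) = i" and out: "i \<notin> R \<Longrightarrow> \<pi> i = i" for i using P by (auto simp: pairing_def)
  have "\<pi> i = m \<longleftrightarrow> i = m" for i using inv out m by metis
  then show ?thesis by (auto simp: NF_def coord_def) metis
qed

text \<open>The coordinate \<open>m\<close> is minimal and equals a functional of the others. The terms at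
  coordinates \<open>r\<close> above \<open>m\<close> are removed by adding multiples of \<open>y r\<close> to \<open>y m\<close>. The coordinates
  that are not above \<open>m\<close> are incomparable to \<open>m\<close>, so they form a chain because the width is two.
  Hence each pair of \<open>\<pi>\<close>, being incomparable, has an element above \<open>m\<close>, and its whole term can be
  shifted there, as the two entries agree. What is left involves a chain of fixed points only. Its
  least element \<open>k\<close> can absorb all the others and the coefficients, after which the functional
  reads \<open>y m = y k\<close>: the pair \<open>{k, m}\<close> is added to \<open>\<pi>\<close>.\<close>

lemma clear_functional:
  assumes Y: "\<And>y. y \<in> Y \<longleftrightarrow> y(m := 0) \<in> NF R \<pi> \<and> y m = (\<Sum>r\<in>R. \<psi> r * y r)"
    and fin: "finite I" and P: "pairing p q R \<pi>" and mR: "m \<notin> R" and R: "R \<subseteq> I" and m: "m \<in> I"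
    and min: "\<And>j. j \<in> I \<Longrightarrow> p j \<le> p m \<Longrightarrow> q j \<le> q m \<Longrightarrow> p m \<le> p j \<and> q m \<le> q j"
    and w: "width2 p q I"
  shows "\<exists>g\<in>moves p q I. \<exists>R' \<pi>'. R' \<subseteq> I \<and> pairing p q R' \<pi>' \<and> g ` Y = NF R' \<pi>'"
proof -
  have inv: "\<pi> (\<pi> i) = i" and out: "i \<notin> R \<Longrightarrow> \<pi> i = i"
    and inc: "\<pi> i \<noteq> i \<Longrightarrow> \<not> (p i \<le> p (\<pi> i) \<and> q i \<le> q (\<pi> i))" for i
    using P by (auto simp: pairing_def)
  have piR: "\<pi> i \<in> R \<longleftrightarrow> i \<in> R" for i using inv out by metis
  have finR: "finite R" using fin R finite_subset by blast
  define up where "up r \<longleftrightarrow> p m \<le> p r \<and> q m \<le> q r" for r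
  have chain: "(p j \<le> p k \<and> q j \<le> q k) \<or> (p k \<le> p j \<and> q k \<le> q j)"
    if "j \<in> I" "k \<in> I" "\<not> up j" "\<not> up k" for j k
    using w[unfolded width2_def, rule_format, OF m that(1,2)] min[OF that(1)] min[OF that(2)] that(3,4)
    unfolding up_def by linarith
  have one_up: "up r \<or> up (\<pi> r)" if "r \<in> R" "\<pi> r \<noteq> r" for r
    using chain[of r "\<pi> r"] inc[of r] inc[of "\<pi> r"] inv that piR R by auto
  \<comment> \<open>The functional after the shift of the terms of pairs to elements above \<open>m\<close>.\<close>
  define \<psi>' where "\<psi>' r = (if \<pi> r = r then \<psi> r else if up r \<and> up (\<pi> r) then \<psi> r
      else if up r then \<psi> r + \<psi> (\<pi> r) else 0)" for r
  have same: "(\<Sum>r\<in>R. \<psi> r * y r) = (\<Sum>r\<in>R. \<psi>' r * y r)" if y: "y(m := 0) \<in> NF R \<pi>" for y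
  proof -
    let ?d = "\<lambda>r. (\<psi>' r - \<psi> r) * y r"
    have yp: "y (\<pi> r) = y r" if "r \<in> R" for r
    proof -
      have "\<pi> r \<noteq> m" "r \<noteq> m" using that piR mR by metis+
      then show ?thesis using y by (simp add: NF_def) (metis fun_upd_apply)
    qed
    have "?d (\<pi> r) = - ?d r" if "r \<in> R" for r
      using yp[OF that] one_up[OF that] inv[of r] by (auto simp: \<psi>'_def algebra_simps)
    then have "(\<Sum>r\<in>R. ?d (\<pi> r)) = - (\<Sum>r\<in>R. ?d r)" by (simp add: sum_negf)
    moreover have "(\<Sum>r\<in>R. ?d (\<pi> r)) = (\<Sum>r\<in>R. ?d r)"
      by (rule sum.reindex_bij_witness[of _ \<pi> \<pi>]) (use inv piR in auto)
    ultimately have "(\<Sum>r\<in>R. ?d r) = 0" by (simp add: eq_neg_iff_add_eq_0)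
    then show ?thesis by (simp add: algebra_simps sum_subtractf)
  qed
  define U where "U = {r \<in> R. up r}"
  define R0 where "R0 = {r \<in> R. \<not> up r \<and> \<psi>' r \<noteq> 0}"
  have finU: "finite U" "finite R0" using finR by (auto simp: U_def R0_def)
  \<comment> \<open>Removes the terms above \<open>m\<close>.\<close>
  define g1 where "g1 = (\<lambda>x. x(m := x m + (\<Sum>r\<in>U. (- \<psi>' r) * x r)))"
  have g1: "g1 \<in> moves p q I" unfolding g1_def
    by (rule moves_add_many[OF finU(1) m]) (use mR R in \<open>auto simp: U_def up_def\<close>)
  have split: "(\<Sum>r\<in>R. \<psi>' r * y r) = (\<Sum>r\<in>U. \<psi>' r * y r) + (\<Sum>r\<in>R0. \<psi>' r * y r)" for y :: "nat \<Rightarrow> complex"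
  proof -
    have "(\<Sum>r\<in>R. \<psi>' r * y r) = (\<Sum>r\<in>U \<union> R0. \<psi>' r * y r)"
      by (rule sum.mono_neutral_right[OF finR]) (auto simp: U_def R0_def)
    also have "\<dots> = (\<Sum>r\<in>U. \<psi>' r * y r) + (\<Sum>r\<in>R0. \<psi>' r * y r)"
      by (rule sum.union_disjoint) (use finU in \<open>auto simp: U_def R0_def\<close>)
    finally show ?thesis .
  qed
  have mU: "m \<notin> U" "m \<notin> R0" using mR by (auto simp: U_def R0_def)
  have sum_upd: "(\<Sum>r\<in>A. f r * (y(m := t)) r) = (\<Sum>r\<in>A. f r * y r)" if "m \<notin> A" for A t y and f :: "nat \<Rightarrow> complex"
    using that by (intro sum.cong) auto
  have Y1: "y \<in> g1 ` Y \<longleftrightarrow> y(m := 0) \<in> NF R \<pi> \<and> y m = (\<Sum>r\<in>R0. \<psi>' r * y r)" for y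
  proof
    assume "y \<in> g1 ` Y"
    then obtain x where x: "x \<in> Y" "y = g1 x" by auto
    have y: "y = x(m := x m - (\<Sum>r\<in>U. \<psi>' r * x r))" using x by (simp add: g1_def sum_negf)
    show "y(m := 0) \<in> NF R \<pi> \<and> y m = (\<Sum>r\<in>R0. \<psi>' r * y r)"
      using x(1) same[of x] split[of x] unfolding Y y by (simp add: sum_upd[OF mU(2)] del: fun_upd_apply) simp
  next
    assume y: "y(m := 0) \<in> NF R \<pi> \<and> y m = (\<Sum>r\<in>R0. \<psi>' r * y r)"
    let ?x = "y(m := y m + (\<Sum>r\<in>U. \<psi>' r * y r))"
    have "y = g1 ?x" by (simp add: g1_def sum_negf sum_upd[OF mU(1)] del: fun_upd_apply) simp
    moreover have "?x \<in> Y" unfolding Y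
      using y same[of ?x] split[of ?x] by (simp add: sum_upd[OF mU(1)] sum_upd[OF mU(2)] sum_upd[OF mR] del: fun_upd_apply) simp
    ultimately show "y \<in> g1 ` Y" by blast
  qed
  show ?thesis
  proof (cases "R0 = {}")
    case True
    have "g1 ` Y = NF R \<pi>"
    proof (rule Set.set_eqI)
      fix y :: "nat \<Rightarrow> complex"
      have "y(m := 0) = y" if "y m = 0" using that by auto
      moreover have "y \<in> NF R \<pi> \<Longrightarrow> y m = 0" using mR by (auto simp: NF_def coord_def)
      ultimately show "y \<in> g1 ` Y \<longleftrightarrow> y \<in> NF R \<pi>" unfolding Y1 using True by auto
    qed
    then show ?thesis using g1 R P by blast
  next
    case False
    obtain k where k: "k \<in> R0" and kmin0: "\<And>r. r \<in> R0 \<Longrightarrow> p k + q k \<le> p r + q r"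
      using False ex_has_least_nat[of "\<lambda>i. i \<in> R0" _ "\<lambda>i. p i + q i"] by blast
    have kmin: "p k \<le> p r \<and> q k \<le> q r" if "r \<in> R0" for r
    proof -
      have "k \<in> I" "r \<in> I" "\<not> up k" "\<not> up r" using k that R by (auto simp: R0_def)
      from chain[OF this] kmin0[OF that] show ?thesis by linarith
    qed
    have kk: "k \<in> R" "\<not> up k" "\<psi>' k \<noteq> 0" "k \<noteq> m" "\<pi> k = k"
      using k mR one_up[of k] by (auto simp: R0_def \<psi>'_def split: if_splits)
    \<comment> \<open>Makes the remaining functional the new coordinate \<open>k\<close>.\<close>
    define g2 where "g2 = (\<lambda>x. (scl k (\<psi>' k) x)(k := scl k (\<psi>' k) x k + (\<Sum>r\<in>R0 - {k}. \<psi>' r * scl k (\<psi>' k) x r)))"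
    have "(\<lambda>x. x(k := x k + (\<Sum>r\<in>R0 - {k}. \<psi>' r * x r))) \<in> moves p q I"
      by (rule moves_add_many) (use finU kmin kk R in \<open>auto simp: R0_def\<close>)
    from moves_comp[OF this moves_scl[of k I "\<psi>' k"]] have g2: "g2 \<in> moves p q I"
      unfolding g2_def using kk R by blast
    have sumk: "(\<Sum>r\<in>R0. f r) = f k + (\<Sum>r\<in>R0 - {k}. f r)" for f :: "nat \<Rightarrow> complex"
      by (rule sum.remove[OF finU(2) k])
    have g2e: "g2 x = x(k := \<Sum>r\<in>R0. \<psi>' r * x r)" for x
      unfolding g2_def sumk scl_def by auto
    let ?\<pi> = "\<pi>(k := m, m := k)"
    have pim: "\<pi> i = m \<longleftrightarrow> i = m" for i using out mR inv by metis
    have pik: "\<pi> i = k \<longleftrightarrow> i = k" for i using kk inv by metis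
    have "pairing p q (insert m R) ?\<pi>"
      unfolding pairing_def
      using inv out inc pim pik kk min[of k] R by (auto simp: up_def)
    moreover have "g2 ` (g1 ` Y) = NF (insert m R) ?\<pi>"
    proof (intro equalityI subsetI)
      fix z assume "z \<in> g2 ` (g1 ` Y)"
      then obtain y where y: "y \<in> g1 ` Y" "z = g2 y" by blast
      have zi: "i \<noteq> k \<Longrightarrow> z i = y i" for i using y(2) g2e by simp
      have y1: "y(m := 0) \<in> NF R \<pi>" "y m = (\<Sum>r\<in>R0. \<psi>' r * y r)" using y(1) Y1 by auto
      have zk: "z k = z m" using y(2) g2e y1(2) kk by simp
      have yp: "y (\<pi> i) = y i" if "i \<noteq> m" for i
        using y1(1) that pim[of i] by (simp add: NF_def) (metis fun_upd_apply)
      have "z \<in> coord (insert m R)"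
        using y1(1) zi kk by (auto simp: NF_def coord_def) metis
      moreover have "z (?\<pi> i) = z i" for i
        using zk zi[of i] zi[of "\<pi> i"] yp[of i] pik[of i] by auto
      ultimately show "z \<in> NF (insert m R) ?\<pi>" by (auto simp: NF_def)
    next
      fix z assume z: "z \<in> NF (insert m R) ?\<pi>"
      let ?y = "z(k := (z k - (\<Sum>r\<in>R0 - {k}. \<psi>' r * z r)) / \<psi>' k)"
      have "(\<Sum>r\<in>R0 - {k}. \<psi>' r * ?y r) = (\<Sum>r\<in>R0 - {k}. \<psi>' r * z r)"
        by (intro sum.cong) auto
      then have s: "(\<Sum>r\<in>R0. \<psi>' r * ?y r) = z k" unfolding sumk using kk by simp
      have zp: "z (?\<pi> i) = z i" for i using z by (auto simp: NF_def)
      have zmk: "z m = z k" using zp[of k] kk by simp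
      have "z = g2 ?y" unfolding g2e s by auto
      moreover have "?y \<in> g1 ` Y" unfolding Y1 s
      proof
        show "?y m = z k" using zmk kk by simp
        have "(?y(m := 0)) (\<pi> i) = (?y(m := 0)) i" for i
          using zp[of i] pim[of i] pik[of i] kk by auto
        moreover have "?y(m := 0) \<in> coord R" using z kk by (auto simp: NF_def coord_def)
        ultimately show "?y(m := 0) \<in> NF R \<pi>" by (auto simp: NF_def)
      qed
      ultimately show "z \<in> g2 ` (g1 ` Y)" by blast
    qed
    moreover have "(\<lambda>x. g2 (g1 x)) ` Y = g2 ` (g1 ` Y)" by auto
    ultimately show ?thesis using moves_comp[OF g2 g1] R m
      by (intro bexI[of _ "\<lambda>x. g2 (g1 x)"] exI[of _ "insert m R"] exI[of _ ?\<pi>]) auto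
  qed
qed

text \<open>Induction on the number of coordinates, splitting off a minimal one. If its unit vector lies
  in \<open>X\<close>, then \<open>X\<close> is a direct sum; otherwise \<open>X\<close> is a graph over its projection, and the
  functional is cleared once the projection is in normal form. Minimality is tested by the sum of
  the labels, which is monotone for the preorder.\<close>

theorem normal_form:
  assumes "finite I" "width2 p q I" "subsp X" "X \<subseteq> coord I"
  shows "\<exists>g\<in>moves p q I. \<exists>R \<pi>. R \<subseteq> I \<and> pairing p q R \<pi> \<and> g ` X = NF R \<pi>"
  using assms
proof (induction "card I" arbitrary: I X)
  case 0
  then have "I = {}" by simp
  then have "coord I = {\<lambda>_. 0}" by (auto simp: coord_def)
  then have "X = {\<lambda>_. 0}" using subsp_zero[OF "0.prems"(3)] "0.prems"(4) by auto
  moreover have "NF {} id = {\<lambda>_. 0}" by (auto simp: NF_def coord_def)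
  moreover have "pairing p q {} id" by (auto simp: pairing_def)
  ultimately have "{} \<subseteq> I \<and> pairing p q {} id \<and> (\<lambda>x. x) ` X = NF {} id" by simp
  then show ?case using moves.id[of p q I] by blast
next
  case (Suc l)
  then have "I \<noteq> {}" by auto
  then obtain m where m: "m \<in> I" and min0: "\<And>j. j \<in> I \<Longrightarrow> p m + q m \<le> p j + q j"
    using ex_has_least_nat[of "\<lambda>i. i \<in> I" _ "\<lambda>i. p i + q i"] by blast
  have min: "p m \<le> p j \<and> q m \<le> q j" if "j \<in> I" "p j \<le> p m" "q j \<le> q m" for j
    using min0[OF that(1)] that by auto
  let ?I = "I - {m}"
  have l: "l = card ?I" using Suc.hyps(2) m Suc.prems(1) by simp
  have w: "width2 p q ?I" using Suc.prems(2) by (auto simp: width2_def)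
  have X: "subsp X" "X \<subseteq> coord I" by fact+
  show ?case
  proof (cases "unit m \<in> X")
    case True
    let ?X = "{x \<in> X. x m = 0}"
    have "subsp ?X" using X(1) by (auto simp: subsp_def)
    moreover have "?X \<subseteq> coord ?I" using X(2) by (auto simp: coord_def)
    ultimately obtain g R \<pi> where g: "g \<in> moves p q ?I" and R: "R \<subseteq> ?I" and P: "pairing p q R \<pi>"
      and eq: "g ` ?X = NF R \<pi>"
      using Suc.hyps(1)[OF l _ w, of ?X] Suc.prems(1) by auto
    have mR: "m \<notin> R" using R by auto
    have upd: "x(m := t) = (\<lambda>i. 1 * x i + (t - x m) * unit m i)" for x t by (auto simp: unit_def)
    have updX: "x(m := t) \<in> X" if "x \<in> X" for x t
      unfolding upd by (rule subsp_comb[OF X(1) that True])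
    have gm: "g (x(m := t)) = (g x)(m := t)" for x t using moves_upd[OF g] by simp
    have "g ` X = NF (insert m R) \<pi>"
    proof (rule Set.set_eqI)
      fix y
      have "y \<in> g ` X \<longleftrightarrow> y(m := 0) \<in> g ` ?X"
      proof
        assume "y \<in> g ` X"
        then obtain x where "x \<in> X" "y = g x" by auto
        then have "y(m := 0) = g (x(m := 0))" "x(m := 0) \<in> ?X" using updX gm by auto
        then show "y(m := 0) \<in> g ` ?X" by blast
      next
        assume "y(m := 0) \<in> g ` ?X"
        then obtain x where x: "x \<in> X" "y(m := 0) = g x" by auto
        have "g (x(m := y m)) = (y(m := 0))(m := y m)" unfolding gm x(2) ..
        then have "y = g (x(m := y m))" by simp
        then show "y \<in> g ` X" using updX[OF x(1)] by blast
      qed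
      then show "y \<in> g ` X \<longleftrightarrow> y \<in> NF (insert m R) \<pi>" using eq NF_upd_outside[OF P mR] by simp
    qed
    moreover have "pairing p q (insert m R) \<pi>" using P by (auto simp: pairing_def)
    ultimately show ?thesis using moves_mono[OF g] R m
      by (intro bexI[of _ g] exI[of _ "insert m R"] exI[of _ \<pi>]) auto
  next
    case False
    let ?X = "(\<lambda>x. x(m := 0)) ` X"
    have "subsp ?X" unfolding subsp_def
    proof (intro conjI ballI allI)
      show "(\<lambda>_. 0) \<in> ?X" by (rule image_eqI[OF _ subsp_zero[OF X(1)]]) auto
      fix x y c d assume "x \<in> ?X" "y \<in> ?X"
      then obtain a b where "a \<in> X" "b \<in> X" "x = a(m := 0)" "y = b(m := 0)" by auto
      then show "(\<lambda>i. c * x i + d * y i) \<in> ?X"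
        by (intro image_eqI[OF _ subsp_comb[OF X(1), of a b c d]]) auto
    qed
    moreover have "?X \<subseteq> coord ?I" using X(2) by (auto simp: coord_def)
    ultimately obtain g R \<pi> where g: "g \<in> moves p q ?I" and R: "R \<subseteq> ?I" and P: "pairing p q R \<pi>"
      and eq: "g ` ?X = NF R \<pi>"
      using Suc.hyps(1)[OF l _ w, of ?X] Suc.prems(1) by auto
    have gm: "g (x(m := t)) = (g x)(m := t)" for x t using moves_upd[OF g] by simp
    have mR: "m \<notin> R" using R by auto
    have finR: "finite R" using R Suc.prems(1) finite_subset by blast
    have proj: "(\<lambda>y. y(m := 0)) ` (g ` X) = NF R \<pi>"
      using eq by (simp add: image_image gm)
    have "g (unit m) = unit m"
    proof -
      have "unit m = (\<lambda>_. 0)(m := 1)" by (auto simp: unit_def)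
      moreover have "g (\<lambda>_. 0) = (\<lambda>_. 0)" using moves_linear[OF g, where c = 0 and d = 0] by simp
      ultimately show ?thesis using gm by metis
    qed
    then have nu: "unit m \<notin> g ` X"
      using False bij_is_inj[OF moves_inj_surj[OF g]] by (metis (no_types, lifting) image_iff injD)
    obtain \<psi> where Y: "\<And>y. y \<in> g ` X \<longleftrightarrow> y(m := 0) \<in> NF R \<pi> \<and> y m = (\<Sum>r\<in>R. \<psi> r * y r)"
      using graph_functional[OF subsp_moves_image[OF g X(1)] proj nu finR P mR] by blast
    obtain h R' \<pi>' where h: "h \<in> moves p q I" "R' \<subseteq> I" "pairing p q R' \<pi>'" "h ` (g ` X) = NF R' \<pi>'"
      using clear_functional[OF Y Suc.prems(1) P mR _ m min Suc.prems(2)] R by blast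
    have "(\<lambda>x. h (g x)) \<in> moves p q I" by (rule moves_comp[OF h(1) moves_mono[OF g]]) auto
    moreover have "(\<lambda>x. h (g x)) ` X = NF R' \<pi>'" using h(4) by (simp add: image_image)
    ultimately show ?thesis using h by blast
  qed
qed

section \<open>Normal forms relative to a flag and a further subspace\<close>

definition inv2 :: "nat \<Rightarrow> complex mat \<Rightarrow> complex mat \<Rightarrow> bool" where
  "inv2 n A A' \<longleftrightarrow> A \<in> carrier_mat n n \<and> A' \<in> carrier_mat n n \<and> A * A' = 1\<^sub>m n \<and> A' * A = 1\<^sub>m n"

lemma inv2D:
  assumes "inv2 n A A'"
  shows "A \<in> carrier_mat n n" "A' \<in> carrier_mat n n" "A * A' = 1\<^sub>m n" "A' * A = 1\<^sub>m n"
    "inv2 n A' A"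
    "x \<in> V n \<Longrightarrow> act n A (act n A' x) = x" "x \<in> V n \<Longrightarrow> act n A' (act n A x) = x"
proof -
  show *: "A \<in> carrier_mat n n" "A' \<in> carrier_mat n n" "A * A' = 1\<^sub>m n" "A' * A = 1\<^sub>m n"
    "inv2 n A' A" using assms by (auto simp: inv2_def)
  show "x \<in> V n \<Longrightarrow> act n A (act n A' x) = x" "x \<in> V n \<Longrightarrow> act n A' (act n A x) = x"
    using act_mult[OF *(1,2), of x] act_mult[OF *(2,1), of x] by (simp_all add: * act_one)
qed

lemma inv2_mult:
  assumes "inv2 n A A'" "inv2 n B B'" shows "inv2 n (A * B) (B' * A')"
proof -
  note c = inv2D(1,2)[OF assms(1)] inv2D(1,2)[OF assms(2)]
  have "A * B * (B' * A') = A * (B * B') * A'"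
    using c by (simp add: assoc_mult_mat[of _ n n _ n _ n])
  moreover have "B' * A' * (A * B) = B' * (A' * A) * B"
    using c by (simp add: assoc_mult_mat[of _ n n _ n _ n])
  ultimately show ?thesis using c inv2D(3,4)[OF assms(1)] inv2D(3,4)[OF assms(2)]
    by (simp add: inv2_def)
qed

lemma moves_V:
  assumes "g \<in> moves p q I" "I \<subseteq> {..<n}" shows "g x \<in> V n \<longleftrightarrow> x \<in> V n"
  by (rule moves_coord[OF assms(1)]) (use assms(2) in auto)

lemma moves_matrix:
  assumes g: "g \<in> moves p q I" and I: "I \<subseteq> {..<n}"
  obtains A A' where "inv2 n A A'" "\<And>x. x \<in> V n \<Longrightarrow> act n A x = g x"
proof -
  have bij: "bij g" by (rule moves_inj_surj[OF g])
  let ?h = "inv_into UNIV g"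
  have gh: "g (?h x) = x" for x using bij by (simp add: bij_is_surj surj_f_inv_f)
  have hg: "?h (g x) = x" for x using bij by (simp add: bij_is_inj)
  have lin: "?h (\<lambda>i. c * x i + d * y i) = (\<lambda>i. c * ?h x i + d * ?h y i)" for x y c d
  proof -
    have "g (\<lambda>i. c * ?h x i + d * ?h y i) = (\<lambda>i. c * x i + d * y i)"
      by (simp add: moves_linear[OF g] gh)
    then show ?thesis using hg by metis
  qed
  have gV: "x \<in> V n \<Longrightarrow> g x \<in> V n" and hV: "x \<in> V n \<Longrightarrow> ?h x \<in> V n" for x
    using moves_V[OF g I] gh by metis+
  let ?A = "mat n n (\<lambda>(i, j). g (unit j) i)" and ?A' = "mat n n (\<lambda>(i, j). ?h (unit j) i)"
  have A: "x \<in> V n \<Longrightarrow> act n ?A x = g x" for x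
    by (rule act_mat_of[OF moves_linear[OF g] gV])
  have A': "x \<in> V n \<Longrightarrow> act n ?A' x = ?h x" for x
    by (rule act_mat_of[OF lin hV])
  have "?A * ?A' = 1\<^sub>m n"
    by (rule act_eqI) (auto simp: act_mult act_one A A' hV gh)
  moreover have "?A' * ?A = 1\<^sub>m n"
    by (rule act_eqI) (auto simp: act_mult act_one A A' gV hg)
  ultimately have "inv2 n ?A ?A'" by (simp add: inv2_def)
  then show thesis using that A by blast
qed

text \<open>In a chain nothing can be paired.\<close>

lemma pairing_chain:
  assumes "pairing p q R \<pi>" "\<And>i. q i = 0"
  shows "NF R \<pi> = coord R"
proof -
  have "\<pi> i = i" for i
  proof (rule ccontr)
    assume "\<pi> i \<noteq> i"
    moreover have "\<pi> (\<pi> i) = i" using assms(1) by (auto simp: pairing_def)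
    ultimately show False using assms unfolding pairing_def by (metis le_refl linear)
  qed
  then show ?thesis by (auto simp: NF_def)
qed

lemma pairing_permutes:
  assumes "pairing p q R \<pi>" "R \<subseteq> I" shows "\<pi> permutes I"
proof -
  have "bij \<pi>" by (rule o_bij[of \<pi>]) (use assms in \<open>auto simp: pairing_def fun_eq_iff\<close>)
  then show ?thesis using assms by (auto simp: permutes_def pairing_def bij_iff)
qed

lemma width2_chain: "width2 p (\<lambda>_. 0) I"
  by (auto simp: width2_def)

text \<open>As second label this puts the members of \<open>R\<close> first, so that \<open>coord R\<close> is preserved as well.\<close>

definition mark :: "nat set \<Rightarrow> nat \<Rightarrow> nat" where "mark R i = (if i \<in> R then 0 else 1)"

lemma width2_mark: "width2 p (mark R) I"
  by (auto simp: width2_def mark_def)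

lemma subset_moves_image:
  "g \<in> moves p q I \<Longrightarrow> I \<subseteq> {..<n} \<Longrightarrow> X \<subseteq> V n \<Longrightarrow> g ` X \<subseteq> V n"
  using moves_V by blast

text \<open>The operations that preserve the flag of \<open>w\<close> bring \<open>W\<close> into the form \<open>coord R1\<close>, as there
  are no incomparable coordinates yet. Those that also preserve \<open>coord R1\<close> belong to the labels
  \<open>w\<close> and \<open>mark R1\<close>; since the second label takes two values only, the width is two and \<open>X\<close> can be
  normalized.\<close>

lemma chain_pair_normal_form:
  fixes w :: "nat \<Rightarrow> nat"
  assumes W: "subsp W" "W \<subseteq> V n" and X: "subsp X" "X \<subseteq> V n"
  obtains g R1 R2 \<pi> where
    "\<And>h t. h \<in> moves w (mark R1) {..<n} \<Longrightarrow> h ` coord {i. i < n \<and> w i < t} = coord {i. i < n \<and> w i < t}"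
    "\<And>h t. h \<in> moves w (mark R1) {..<n} \<Longrightarrow> h ` coord R1 = coord R1"
    "\<exists>A A'. inv2 n A A' \<and> (\<forall>x\<in>V n. act n A x = g x)"
    "\<And>t. g ` coord {i. i < n \<and> w i < t} = coord {i. i < n \<and> w i < t}"
    "g ` W = coord R1" "R1 \<subseteq> {..<n}" "g ` X = NF R2 \<pi>" "R2 \<subseteq> {..<n}" "pairing w (mark R1) R2 \<pi>"
proof -
  obtain g1 R1 \<pi>1 where g1: "g1 \<in> moves w (\<lambda>_. 0) {..<n}" "R1 \<subseteq> {..<n}" "pairing w (\<lambda>_. 0) R1 \<pi>1"
      "g1 ` W = NF R1 \<pi>1"
    using normal_form[OF finite_lessThan width2_chain W, where p = w] by blast
  have W1: "g1 ` W = coord R1" using g1 pairing_chain by simp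
  obtain g2 R2 \<pi> where g2: "g2 \<in> moves w (mark R1) {..<n}" "R2 \<subseteq> {..<n}" "pairing w (mark R1) R2 \<pi>"
      "g2 ` (g1 ` X) = NF R2 \<pi>"
    using normal_form[OF finite_lessThan width2_mark[of w R1] subsp_moves_image[OF g1(1) X(1)]
        subset_moves_image[OF g1(1) subset_refl X(2)]] by blast
  have c1: "g1 ` coord {i. i < n \<and> w i < t} = coord {i. i < n \<and> w i < t}" for t
    by (rule moves_image_coord[OF g1(1)]) auto
  have c2: "h ` coord {i. i < n \<and> w i < t} = coord {i. i < n \<and> w i < t}"
    if "h \<in> moves w (mark R1) {..<n}" for h t
    by (rule moves_image_coord[OF that]) auto
  have c3: "h ` coord R1 = coord R1" if "h \<in> moves w (mark R1) {..<n}" for h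
    by (rule moves_image_coord[OF that]) (auto simp: mark_def split: if_splits)
  obtain A1 A1' where A1: "inv2 n A1 A1'" "\<And>x. x \<in> V n \<Longrightarrow> act n A1 x = g1 x"
    using moves_matrix[OF g1(1)] by blast
  obtain A2 A2' where A2: "inv2 n A2 A2'" "\<And>x. x \<in> V n \<Longrightarrow> act n A2 x = g2 x"
    using moves_matrix[OF g2(1)] by blast
  have "act n (A2 * A1) x = g2 (g1 x)" if "x \<in> V n" for x
    using that moves_V[OF g1(1) subset_refl, of x]
    by (simp add: act_mult[OF inv2D(1)[OF A2(1)] inv2D(1)[OF A1(1)]] A1(2) A2(2))
  then have mat: "\<exists>A A'. inv2 n A A' \<and> (\<forall>x\<in>V n. act n A x = g2 (g1 x))"
    using inv2_mult[OF A2(1) A1(1)] by blast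
  have im: "(\<lambda>x. g2 (g1 x)) ` Z = g2 ` (g1 ` Z)" for Z by auto
  show thesis
    using that[of R1 "\<lambda>x. g2 (g1 x)" R2 \<pi>] c1 c2 c3 g1(2) g2 W1 mat unfolding im by simp
qed

text \<open>The coordinates of a normal form are its values on a system \<open>T\<close> of representatives of the
  pairs and fixed points; this is the parametrization of the normal form by \<open>coord T\<close>.\<close>

definition unfold_NF :: "nat set \<Rightarrow> nat set \<Rightarrow> (nat \<Rightarrow> nat) \<Rightarrow> (nat \<Rightarrow> complex) \<Rightarrow> nat \<Rightarrow> complex" where
  "unfold_NF T R \<pi> y = (\<lambda>i. if i \<in> T then y i else if i \<in> R then y (\<pi> i) else 0)"

text \<open>The two members of a pair are incomparable for \<open>w\<close> and \<open>mark R1\<close>, so exactly one of them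
  lies in \<open>R1\<close>.\<close>

definition reps :: "nat set \<Rightarrow> nat set \<Rightarrow> (nat \<Rightarrow> nat) \<Rightarrow> nat set" where
  "reps R1 R \<pi> = {i \<in> R. \<pi> i = i \<or> i \<in> R1}"

text \<open>In the coordinates of \<open>NF R \<pi>\<close>, an operation on a representative \<open>s\<close> that belongs to a pair
  has to be performed on \<open>s\<close> and on \<open>\<pi> s\<close> at once. The label \<open>q\<close> of \<open>s\<close> says from which
  representatives \<open>t\<close> something may be added: a pair also needs \<open>w (\<pi> s) \<le> w (\<pi> t)\<close> with \<open>\<pi> t\<close>
  outside \<open>R1\<close>; an unpaired \<open>s\<close> outside \<open>R1\<close> takes from \<open>\<pi> t\<close>, which has to be above \<open>s\<close> and
  outside \<open>R1\<close>; an unpaired \<open>s\<close> in \<open>R1\<close> can take from every \<open>t\<close> with \<open>w s \<le> w t\<close>.\<close>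

lemma lift_moves:
  fixes w :: "nat \<Rightarrow> nat"
  assumes R: "R \<subseteq> {..<n}" and P: "pairing w (mark R1) R \<pi>"
  defines "T \<equiv> reps R1 R \<pi>"
  defines "q \<equiv> (\<lambda>s. if s \<in> R1 then (if \<pi> s = s then 0 else w (\<pi> s) + 1) else w s + 1)"
  assumes g: "g \<in> moves w q T"
  shows "\<exists>h\<in>moves w (mark R1) {..<n}. \<forall>y\<in>coord T. h (unfold_NF T R \<pi> y) = unfold_NF T R \<pi> (g y)"
  using g
proof (induction rule: moves.induct)
  case id
  show ?case by (rule bexI[OF _ moves.id]) simp
next
  have inv: "\<pi> (\<pi> i) = i" and out: "i \<notin> R \<Longrightarrow> \<pi> i = i" for i
    using P by (auto simp: pairing_def)
  have inc: "\<not> (w i \<le> w (\<pi> i) \<and> mark R1 i \<le> mark R1 (\<pi> i))"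
    "\<not> (w (\<pi> i) \<le> w i \<and> mark R1 (\<pi> i) \<le> mark R1 i)" if "\<pi> i \<noteq> i" for i
    using P that unfolding pairing_def by metis+
  have piR: "\<pi> i \<in> R \<longleftrightarrow> i \<in> R" for i using inv out by metis
  have pairT: "s \<in> R1" "\<pi> s \<notin> R1" "w (\<pi> s) < w s" "\<pi> s \<notin> T" if "s \<in> T" "\<pi> s \<noteq> s" for s
    using inc[OF that(2)] that inv[of s] by (auto simp: T_def reps_def mark_def split: if_splits)
  have TR: "s \<in> R" "\<pi> s \<in> R" "s < n" "\<pi> s < n" if "s \<in> T" for s
    using that piR[of s] R by (auto simp: T_def reps_def)
  have val: "unfold_NF T R \<pi> y t = y t" "unfold_NF T R \<pi> y (\<pi> t) = y t" if "t \<in> T" for y t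
    using that pairT[of t] TR[of t] inv[of t] by (cases "\<pi> t = t"; auto simp: unfold_NF_def)+
  {
    case (addc g s t c)
    then obtain h where h: "h \<in> moves w (mark R1) {..<n}"
      and hg: "\<And>y. y \<in> coord T \<Longrightarrow> h (unfold_NF T R \<pi> y) = unfold_NF T R \<pi> (g y)" by blast
    note st = addc.hyps(2-6)
    have qT: "0 < q t \<Longrightarrow> \<pi> t \<notin> R1 \<and> q t = w (\<pi> t) + 1"
      using pairT[OF st(2)] by (cases "\<pi> t = t") (auto simp: q_def split: if_splits)
    show ?case
    proof (cases "\<pi> s = s")
      case True
      have "\<exists>t'. t' < n \<and> t' \<noteq> s \<and> w s \<le> w t' \<and> mark R1 s \<le> mark R1 t' \<and> (t' = t \<or> t' = \<pi> t)"
      proof (cases "s \<in> R1")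
        case s: True
        then show ?thesis using st TR[OF st(2)] by (intro exI[of _ t]) (auto simp: mark_def)
      next
        case False
        then have "q s = w s + 1" by (simp add: q_def)
        then show ?thesis using st TR[OF st(2)] qT True inv[of t]
          by (intro exI[of _ "\<pi> t"]) (auto simp: mark_def)
      qed
      then obtain t' where t': "t' < n" "t' \<noteq> s" "w s \<le> w t'" "mark R1 s \<le> mark R1 t'" "t' = t \<or> t' = \<pi> t"
        by blast
      have vt: "unfold_NF T R \<pi> y t' = y t" for y using val[OF st(2)] t'(5) by auto
      have "addc s t' c (unfold_NF T R \<pi> y) = unfold_NF T R \<pi> (addc s t c y)" for y
      proof
        fix i
        show "addc s t' c (unfold_NF T R \<pi> y) i = unfold_NF T R \<pi> (addc s t c y) i"
          unfolding addc_def vt val(1)[OF st(1)] using True st(1) inv[of i]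
          by (auto simp: unfold_NF_def)
      qed
      moreover have "(\<lambda>x. addc s t' c (h x)) \<in> moves w (mark R1) {..<n}"
        by (rule moves.addc[OF h]) (use t' TR[OF st(1)] in auto)
      ultimately show ?thesis using hg by (intro bexI) auto
    next
      case False
      note ps = pairT[OF st(1) False]
      have "q s = w (\<pi> s) + 1" using ps(1) False by (simp add: q_def)
      then have t2: "\<pi> t \<notin> R1" "w (\<pi> s) \<le> w (\<pi> t)" using qT st(5) by auto
      have "\<pi> s \<noteq> \<pi> t" using inv st(3) by metis
      have "addc s t c (addc (\<pi> s) (\<pi> t) c (unfold_NF T R \<pi> y)) = unfold_NF T R \<pi> (addc s t c y)" for y
      proof
        fix i
        have "t \<noteq> \<pi> s" using ps st(2) by auto
        moreover have "unfold_NF T R \<pi> y (\<pi> s) = y s" "unfold_NF T R \<pi> y s = y s"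
            "unfold_NF T R \<pi> y (\<pi> t) = y t" "unfold_NF T R \<pi> y t = y t" using val st by auto
        moreover have "\<pi> i = s \<longleftrightarrow> i = \<pi> s" using inv by metis
        ultimately show "addc s t c (addc (\<pi> s) (\<pi> t) c (unfold_NF T R \<pi> y)) i = unfold_NF T R \<pi> (addc s t c y) i"
          using ps False st(1) TR(2)[OF st(1)] inv[of s] unfolding addc_def
          by (cases "i = s"; cases "i = \<pi> s") (auto simp: unfold_NF_def)
      qed
      moreover have "(\<lambda>x. addc s t c (addc (\<pi> s) (\<pi> t) c (h x))) \<in> moves w (mark R1) {..<n}"
        by (rule moves.addc[OF moves.addc[OF h]])
           (use st TR t2 ps \<open>\<pi> s \<noteq> \<pi> t\<close> in \<open>auto simp: mark_def\<close>)
      ultimately show ?thesis using hg by (intro bexI) auto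
    qed
  next
    case (scl g s c)
    then obtain h where h: "h \<in> moves w (mark R1) {..<n}"
      and hg: "\<And>y. y \<in> coord T \<Longrightarrow> h (unfold_NF T R \<pi> y) = unfold_NF T R \<pi> (g y)" by blast
    note s = scl.hyps(2)
    have swap: "\<pi> i = s \<longleftrightarrow> i = \<pi> s" for i using inv by metis
    show ?case
    proof (cases "\<pi> s = s")
      case True
      have "scl s c (unfold_NF T R \<pi> y) = unfold_NF T R \<pi> (scl s c y)" for y
      proof
        fix i show "scl s c (unfold_NF T R \<pi> y) i = unfold_NF T R \<pi> (scl s c y) i"
          using True s swap[of i] by (auto simp: unfold_NF_def scl_def)
      qed
      moreover have "(\<lambda>x. scl s c (h x)) \<in> moves w (mark R1) {..<n}"
        by (rule moves.scl[OF h]) (use TR s scl.hyps in auto)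
      ultimately show ?thesis using hg by (intro bexI) auto
    next
      case False
      note ps = pairT[OF s False]
      have "scl s c (scl (\<pi> s) c (unfold_NF T R \<pi> y)) = unfold_NF T R \<pi> (scl s c y)" for y
      proof
        fix i show "scl s c (scl (\<pi> s) c (unfold_NF T R \<pi> y)) i = unfold_NF T R \<pi> (scl s c y) i"
          using False s ps swap[of i] TR[OF s] inv[of s] by (auto simp: unfold_NF_def scl_def)
      qed
      moreover have "(\<lambda>x. scl s c (scl (\<pi> s) c (h x))) \<in> moves w (mark R1) {..<n}"
        by (rule moves.scl[OF moves.scl[OF h]]) (use TR s scl.hyps in auto)
      ultimately show ?thesis using hg by (intro bexI) auto
    qed
  }
qed

text \<open>The preorder of \<open>lift_moves\<close> on the representatives has width two because \<open>w\<close> takes at most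
  three values and \<open>q s \<le> w s + 1\<close>: three pairwise incomparable elements would have labels
  \<open>w = 0, 1, 2\<close> and strictly decreasing labels \<open>q\<close>, hence \<open>q \<ge> 2\<close> at \<open>w = 0\<close>. So a subspace of a
  normal form can be normalized in turn.\<close>

lemma sub_normal_form:
  fixes w :: "nat \<Rightarrow> nat"
  assumes R: "R \<subseteq> {..<n}" and P: "pairing w (mark R1) R \<pi>" and w: "\<And>i. w i \<le> 2"
    and X: "subsp X" "X \<subseteq> NF R \<pi>"
  shows "\<exists>h\<in>moves w (mark R1) {..<n}. \<exists>R3 \<pi>3. R3 \<subseteq> {..<n} \<and> \<pi>3 permutes {..<n} \<and> h ` NF R \<pi> = NF R \<pi> \<and>
    h ` X = unfold_NF (reps R1 R \<pi>) R \<pi> ` NF R3 \<pi>3"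
proof -
  define T where "T = reps R1 R \<pi>"
  define q where "q = (\<lambda>s. if s \<in> R1 then (if \<pi> s = s then 0 else w (\<pi> s) + 1) else w s + 1)"
  have inv: "\<pi> (\<pi> i) = i" and out: "i \<notin> R \<Longrightarrow> \<pi> i = i" for i
    using P by (auto simp: pairing_def)
  have inc: "\<not> (w i \<le> w (\<pi> i) \<and> mark R1 i \<le> mark R1 (\<pi> i))"
    "\<not> (w (\<pi> i) \<le> w i \<and> mark R1 (\<pi> i) \<le> mark R1 i)" if "\<pi> i \<noteq> i" for i
    using P that unfolding pairing_def by metis+
  have piR: "\<pi> i \<in> R \<longleftrightarrow> i \<in> R" for i using inv out by metis
  have T': "\<pi> i \<in> T" if "i \<in> R" "i \<notin> T" for i
    using that inc[of i] inv[of i] piR[of i] by (auto simp: T_def reps_def mark_def split: if_splits)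
  have TR: "T \<subseteq> R" by (auto simp: T_def reps_def)
  let ?u = "unfold_NF T R \<pi>"
  let ?r = "\<lambda>x i. if i \<in> T then x i else 0 :: complex"
  have ur: "?u (?r x) = x" if "x \<in> NF R \<pi>" for x
  proof
    fix i show "?u (?r x) i = x i"
      using that T'[of i] TR by (auto simp: unfold_NF_def NF_def coord_def)
  qed
  have uNF: "?u y \<in> NF R \<pi>" for y
  proof -
    have "\<pi> i = i" if "i \<in> T" "\<pi> i \<in> T" for i
    proof (rule ccontr)
      assume "\<pi> i \<noteq> i"
      with inc[OF this] that show False by (auto simp: T_def reps_def mark_def inv)
    qed
    then show ?thesis using TR T' piR inv by (auto simp: unfold_NF_def NF_def coord_def) metis
  qed
  have NFu: "NF R \<pi> = ?u ` coord T"
  proof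
    show "NF R \<pi> \<subseteq> ?u ` coord T"
    proof
      fix x assume x: "x \<in> NF R \<pi>"
      have "?r x \<in> coord T" by (auto simp: coord_def)
      from imageI[OF this, of ?u] have "?u (?r x) \<in> ?u ` coord T" .
      then show "x \<in> ?u ` coord T" by (simp only: ur[OF x])
    qed
    show "?u ` coord T \<subseteq> NF R \<pi>" using uNF by blast
  qed
  have "(\<lambda>x. ?u (?r x)) ` X = (\<lambda>x. x) ` X"
  proof (rule image_cong)
    fix x assume "x \<in> X"
    then show "?u (?r x) = x" by (intro ur subsetD[OF X(2)])
  qed simp
  then have Xu: "X = ?u ` (?r ` X)" by (simp only: image_image image_ident)
  have "subsp (?r ` X)" unfolding subsp_def
  proof (intro conjI ballI allI)
    show "(\<lambda>_. 0) \<in> ?r ` X" by (rule image_eqI[OF _ subsp_zero[OF X(1)]]) auto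
    fix x y c d assume "x \<in> ?r ` X" "y \<in> ?r ` X"
    then obtain a b where "a \<in> X" "b \<in> X" "x = ?r a" "y = ?r b" by auto
    then show "(\<lambda>i. c * x i + d * y i) \<in> ?r ` X"
      by (intro image_eqI[OF _ subsp_comb[OF X(1), of a b c d]]) auto
  qed
  moreover have "?r ` X \<subseteq> coord T" by (auto simp: coord_def)
  moreover have "finite T" using TR R by (meson finite_lessThan finite_subset subset_trans)
  moreover have "width2 w q T"
  proof -
    have q: "q s \<le> w s + 1" if "s \<in> T" for s
      using inc[of s] that by (auto simp: q_def T_def reps_def mark_def split: if_splits)
    show ?thesis unfolding width2_def
    proof (intro ballI)
      fix i j k assume "i \<in> T" "j \<in> T" "k \<in> T"
      then show "(w i \<le> w j \<and> q i \<le> q j) \<or> (w j \<le> w i \<and> q j \<le> q i) \<or>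
         (w i \<le> w k \<and> q i \<le> q k) \<or> (w k \<le> w i \<and> q k \<le> q i) \<or>
         (w j \<le> w k \<and> q j \<le> q k) \<or> (w k \<le> w j \<and> q k \<le> q j)"
        using q[of i] q[of j] q[of k] w[of i] w[of j] w[of k] by linarith
    qed
  qed
  ultimately obtain g R3 \<pi>3 where g: "g \<in> moves w q T" and R3: "R3 \<subseteq> T" "pairing w q R3 \<pi>3"
    and eq: "g ` (?r ` X) = NF R3 \<pi>3"
    using normal_form[of T w q "?r ` X"] by blast
  obtain h where h: "h \<in> moves w (mark R1) {..<n}" and hg: "\<And>y. y \<in> coord T \<Longrightarrow> h (?u y) = ?u (g y)"
    using lift_moves[OF R P] g unfolding T_def q_def by blast
  have gT: "g ` coord T = coord T" by (rule moves_image_coord[OF g])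
  have im: "h ` (?u ` Y) = ?u ` (g ` Y)" if "Y \<subseteq> coord T" for Y
    unfolding image_image by (rule image_cong) (use hg that in auto)
  have "h ` NF R \<pi> = NF R \<pi>" unfolding NFu using im[of "coord T"] gT by simp
  moreover have "h ` X = ?u ` NF R3 \<pi>3"
    using im[of "?r ` X"] eq \<open>?r ` X \<subseteq> coord T\<close> Xu by simp
  moreover have "R3 \<subseteq> {..<n}" using R3 TR R by blast
  moreover have "\<pi>3 permutes {..<n}" using pairing_permutes[OF R3(2)] R3 TR R by blast
  ultimately show ?thesis using h unfolding T_def by blast
qed

section \<open>Polynomials in a linear map\<close>

text \<open>The value of \<open>p(A)\<close> at \<open>x\<close>, computed by the scheme of Horner. Only values at vectors are
  needed, so the ring of matrices is avoided.\<close>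

definition pev :: "nat \<Rightarrow> complex mat \<Rightarrow> complex poly \<Rightarrow> (nat \<Rightarrow> complex) \<Rightarrow> nat \<Rightarrow> complex" where
  "pev n A p x = fold_coeffs (\<lambda>c y. (\<lambda>i. c * x i + act n A y i)) p (\<lambda>_. 0)"

lemma pev_0 [simp]: "pev n A 0 x = (\<lambda>_. 0)"
  by (simp add: pev_def)

lemma pev_pCons [simp]: "pev n A (pCons c p) x = (\<lambda>i. c * x i + act n A (pev n A p x) i)"
proof (cases "c = 0 \<and> p = 0")
  case True then show ?thesis by (simp add: act_zero)
next
  case False
  then show ?thesis
    by (cases "c = 0") (auto simp: pev_def fold_coeffs_pCons_coeff_not_0_eq fold_coeffs_pCons_not_0_0_eq)
qed

lemma pev_add: "pev n A (p + q) x = (\<lambda>i. pev n A p x i + pev n A q x i)"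
  by (induction p arbitrary: q rule: pCons_induct)
     (simp, case_tac q, auto simp: act_add algebra_simps)

lemma pev_smult: "pev n A (smult c p) x = (\<lambda>i. c * pev n A p x i)"
  by (induction p rule: pCons_induct) (auto simp: act_scale algebra_simps)

lemma pev_comb: "pev n A p (\<lambda>i. c * x i + d * y i) = (\<lambda>i. c * pev n A p x i + d * pev n A p y i)"
  by (induction p rule: pCons_induct) (auto simp: act_comb algebra_simps)

lemma pev_zero: "pev n A p (\<lambda>_. 0) = (\<lambda>_. 0)"
  by (induction p rule: pCons_induct) (auto simp: act_zero)

lemma pev_mult: "pev n A (p * q) x = pev n A p (pev n A q x)"
  by (induction p rule: pCons_induct) (auto simp: pev_add pev_smult)

lemma pev_1 [simp]: "pev n A 1 x = x"
  by (simp add: one_pCons act_zero)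

lemma pev_linear_factor: "pev n A [:- a, 1:] x = (\<lambda>i. act n A x i - a * x i)"
  by (simp add: act_zero)

lemma pev_X: "pev n A [:0, 1:] x = act n A x"
  by (simp add: act_zero)

lemma pev_act: "pev n A p (act n A x) = act n A (pev n A p x)"
  using pev_mult[of n A p "[:0, 1:]" x] pev_mult[of n A "[:0, 1:]" p x] by (simp add: pev_X mult.commute del: pev_pCons)

lemma pev_commute: "pev n A p (pev n A q x) = pev n A q (pev n A p x)"
  by (metis pev_mult mult.commute)

lemma pev_invariant:
  assumes "subsp Z" "\<And>x. x \<in> Z \<Longrightarrow> act n A x \<in> Z" "x \<in> Z"
  shows "pev n A p x \<in> Z"
proof (induction p rule: pCons_induct)
  case 0 show ?case using subsp_zero[OF assms(1)] by simp
next
  case (pCons c p)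
  have "(\<lambda>i. c * x i + 1 * act n A (pev n A p x) i) \<in> Z"
    by (rule subsp_comb[OF assms(1) assms(3) assms(2)[OF pCons(2)]])
  then show ?case by simp
qed

lemma pev_V: "x \<in> V n \<Longrightarrow> pev n A p x \<in> V n"
  by (rule pev_invariant[OF subsp_coord]) auto

fun krylov :: "nat \<Rightarrow> complex mat \<Rightarrow> (nat \<Rightarrow> complex) \<Rightarrow> nat \<Rightarrow> (nat \<Rightarrow> complex) set" where
  "krylov n A x 0 = {\<lambda>_. 0}"
| "krylov n A x (Suc k) = ins (krylov n A x k) (pev n A (monom 1 k) x)"

lemma subsp_krylov: "subsp (krylov n A x k)"
  by (induction k) (auto simp: subsp_ins, auto simp: subsp_def)

lemma krylov_V: "x \<in> V n \<Longrightarrow> krylov n A x k \<subseteq> V n"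
proof (induction k)
  case 0 then show ?case by (auto simp: coord_def)
next
  case (Suc k)
  then show ?case using ins_V[OF Suc.IH[OF Suc.prems] pev_V[OF Suc.prems]] by simp
qed

lemma krylov_pev: "y \<in> krylov n A x k \<Longrightarrow> \<exists>p. (\<forall>i\<ge>k. coeff p i = 0) \<and> y = pev n A p x"
proof (induction k arbitrary: y)
  case 0 then show ?case by (intro exI[of _ 0]) simp
next
  case (Suc k)
  then obtain a c where a: "a \<in> krylov n A x k" "y = (\<lambda>i. a i + c * pev n A (monom 1 k) x i)"
    by (auto simp: ins_def)
  then obtain p where "\<forall>i\<ge>k. coeff p i = 0" "a = pev n A p x" using Suc.IH by blast
  then show ?case
    by (intro exI[of _ "p + smult c (monom 1 k)"]) (auto simp: a(2) pev_add pev_smult)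
qed

text \<open>The spaces spanned by \<open>x, A x, A\<^sup>2 x, \<dots>\<close> cannot grow more than \<open>n\<close> times.\<close>

lemma annihilate_vector:
  assumes x: "x \<in> V n" shows "\<exists>p. p \<noteq> 0 \<and> pev n A p x = (\<lambda>_. 0)"
proof -
  have "\<exists>k. pev n A (monom 1 k) x \<in> krylov n A x k"
  proof (rule ccontr)
    assume *: "\<not> ?thesis"
    have dk: "dm (krylov n A x k) = k" for k
    proof (induction k)
      case (Suc k)
      then show ?case using dm_ins[OF subsp_krylov krylov_V[OF x] pev_V[OF x]] * by simp
    qed (simp add: dm_zero)
    show False using dm_le[OF krylov_V[OF x], of A "Suc n"] unfolding dk by simp
  qed
  then obtain k p where p: "\<forall>i\<ge>k. coeff p i = 0" "pev n A (monom 1 k) x = pev n A p x"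
    using krylov_pev by blast
  let ?q = "monom 1 k + smult (- 1) p"
  have "coeff ?q k = 1" using p by simp
  then have "?q \<noteq> 0" by (metis coeff_0 zero_neq_one)
  moreover have "pev n A ?q x = (\<lambda>_. 0)" unfolding pev_add pev_smult using p(2) by simp
  ultimately show ?thesis by blast
qed

text \<open>An annihilating polynomial of \<open>A\<close>, given by the multiset of its roots.\<close>

definition annih :: "nat \<Rightarrow> complex mat \<Rightarrow> complex multiset \<Rightarrow> bool" where
  "annih n A M \<longleftrightarrow> (\<forall>x\<in>V n. pev n A (\<Prod>a\<in>#M. [:- a, 1:]) x = (\<lambda>_. 0))"

lemma annih_exists: "\<exists>M. annih n A M"
proof -
  have "\<exists>p. p \<noteq> 0 \<and> (\<forall>i<m. pev n A p (unit i) = (\<lambda>_. 0))" if "m \<le> n" for m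
    using that
  proof (induction m)
    case 0 show ?case by (intro exI[of _ 1]) simp
  next
    case (Suc m)
    then obtain p where p: "p \<noteq> 0" "\<And>i. i < m \<Longrightarrow> pev n A p (unit i) = (\<lambda>_. 0)" by auto
    obtain q where q: "q \<noteq> 0" "pev n A q (unit m) = (\<lambda>_. 0)"
      using annihilate_vector[OF unit_V, of m n A] Suc.prems by auto
    have "pev n A (q * p) (unit i) = (\<lambda>_. 0)" if "i < Suc m" for i
    proof (cases "i = m")
      case True
      then show ?thesis using q(2) by (simp add: pev_mult pev_commute[of n A q p] pev_zero)
    next
      case False
      then show ?thesis using p(2)[of i] that by (simp add: pev_mult pev_zero)
    qed
    then show ?case using p q by (intro exI[of _ "q * p"]) auto
  qed
  then obtain p where p: "p \<noteq> 0" "\<And>i. i < n \<Longrightarrow> pev n A p (unit i) = (\<lambda>_. 0)" by blast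
  obtain M where M: "p = smult (lead_coeff p) (\<Prod>a\<in>#M. [:- a, 1:])"
    using alg_closed_imp_factorization[OF p(1)] by blast
  let ?P = "\<Prod>a\<in>#M. [:- a, 1:]"
  have "pev n A ?P x = (\<lambda>_. 0)" if x: "x \<in> V n" for x
  proof -
    let ?Z = "{x. pev n A ?P x = (\<lambda>_. 0)}"
    have "subsp ?Z" by (auto simp: subsp_def pev_zero pev_comb)
    moreover have "unit i \<in> ?Z" if "i < n" for i
    proof -
      have "(\<lambda>j. lead_coeff p * pev n A ?P (unit i) j) = (\<lambda>_. 0)"
        using p(2)[OF that] M pev_smult by metis
      then show ?thesis using p(1) by (auto simp: fun_eq_iff)
    qed
    ultimately have "(\<lambda>i. \<Sum>k<n. x k * unit k i) \<in> ?Z" by (intro subsp_sum) auto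
    then show ?thesis using V_expand[OF x] by simp
  qed
  then show ?thesis unfolding annih_def by blast
qed

lemma pev_add_mset: "pev n A (\<Prod>a\<in>#add_mset a M. [:- a, 1:]) x
    = (\<lambda>i. act n A (pev n A (\<Prod>a\<in>#M. [:- a, 1:]) x) i - a * pev n A (\<Prod>a\<in>#M. [:- a, 1:]) x i)"
  unfolding image_mset_add_mset prod_mset.add_mset pev_mult pev_linear_factor ..

text \<open>When the linear factors of an annihilating polynomial are applied to \<open>v\<close> one after the
  other, the last vector outside \<open>A0\<close> is an eigenvector modulo \<open>A0\<close>.\<close>

lemma eigenvector_mod:
  assumes v: "v \<in> C" "v \<notin> A0" and C: "C \<subseteq> V n" "subsp C" "\<And>x. x \<in> C \<Longrightarrow> act n T x \<in> C"
    and A0: "subsp A0"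
  obtains a u where "u \<in> C" "u \<notin> A0" "(\<lambda>i. act n T u i - a * u i) \<in> A0"
proof -
  obtain M where M: "annih n T M" using annih_exists by blast
  have "pev n T (\<Prod>a\<in>#M. [:- a, 1:]) v \<in> A0"
    using M v C(1) subsp_zero[OF A0] by (auto simp: annih_def)
  then have "\<exists>a u. u \<in> C \<and> u \<notin> A0 \<and> (\<lambda>i. act n T u i - a * u i) \<in> A0"
  proof (induction M)
    case empty then show ?case using v by simp
  next
    case (add a M)
    let ?u = "pev n T (\<Prod>a\<in>#M. [:- a, 1:]) v"
    have uC: "?u \<in> C" by (rule pev_invariant[OF C(2,3) v(1)])
    show ?case
    proof (cases "?u \<in> A0")
      case False
      have "(\<lambda>i. act n T ?u i - a * ?u i) \<in> A0"
        using add.prems unfolding pev_add_mset .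
      then show ?thesis using uC False by blast
    qed (rule add.IH)
  qed
  then show thesis using that by blast
qed

text \<open>On an eigenvector modulo \<open>A0\<close> the annihilating polynomial acts as its value at the
  eigenvalue, which is a product of nonzero factors unless the eigenvalue is a root.\<close>

lemma eigenvalues_mod:
  assumes M: "annih n T M" and v: "v \<in> V n" "v \<notin> A0" and A0: "subsp A0" "\<And>x. x \<in> A0 \<Longrightarrow> act n T x \<in> A0"
    and e: "(\<lambda>i. act n T v i - c * v i) \<in> A0"
  shows "c \<in># M"
proof (rule ccontr)
  assume c: "c \<notin># M"
  have "(\<lambda>i. pev n T (\<Prod>a\<in>#N. [:- a, 1:]) v i - (\<Prod>a\<in>#N. c - a) * v i) \<in> A0" for N
  proof (induction N)
    case empty then show ?case using subsp_zero[OF A0(1)] by simp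
  next
    case (add a N)
    let ?w = "pev n T (\<Prod>a\<in>#N. [:- a, 1:]) v" and ?k = "\<Prod>a\<in>#N. c - a"
    let ?d = "\<lambda>i. ?w i - ?k * v i"
    have 1: "(\<lambda>i. act n T ?d i - a * ?d i) \<in> A0"
      by (rule subsp_axpy[OF A0(1) A0(2)[OF add.IH] add.IH])
    have "(\<lambda>i. (act n T ?d i - a * ?d i) + ?k * (act n T v i - c * v i)) \<in> A0"
      using subsp_comb[OF A0(1) 1 e, of 1 ?k] by simp
    moreover have "act n T ?d = (\<lambda>i. act n T ?w i - ?k * act n T v i)"
      using act_comb[of n T 1 ?w "- ?k" v] by simp
    moreover have "(\<lambda>i. pev n T (\<Prod>a\<in>#add_mset a N. [:- a, 1:]) v i - (\<Prod>a\<in>#add_mset a N. c - a) * v i)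
        = (\<lambda>i. ((act n T ?w i - ?k * act n T v i) - a * ?d i) + ?k * (act n T v i - c * v i))"
      unfolding pev_add_mset by (rule ext) (simp add: algebra_simps)
    ultimately show ?case by simp
  qed
  from this[of M] have "(\<lambda>i. - (\<Prod>a\<in>#M. c - a) * v i) \<in> A0"
    using M v(1) by (simp add: annih_def)
  moreover have nz: "(\<Prod>a\<in>#M. c - a) \<noteq> 0" using c by (auto simp: prod_mset_zero_iff)
  ultimately show False
    using subsp_scale[OF A0(1), where c = "- 1 / (\<Prod>a\<in>#M. c - a)"
        and x = "\<lambda>i. - (\<Prod>a\<in>#M. c - a) * v i"] v(2) by simp
qed

section \<open>From linear isomorphisms to isometries\<close>

text \<open>Induction on the roots in the manner of Hensel. If \<open>p\<^sup>2 = X\<close> modulo \<open>f\<close>, then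
  \<open>p + c f\<close> is a root modulo \<open>(X - a) f\<close> provided \<open>c\<close> solves a quadratic equation. It degenerates
  when \<open>f(a) = 0\<close>, but then it is linear with leading coefficient \<open>2 p(a)\<close>, and
  \<open>p(a)\<^sup>2 = a \<noteq> 0\<close>.\<close>

lemma poly_sqrt_mod:
  assumes "0 \<notin># M"
  shows "\<exists>p. (\<Prod>a\<in>#M. [:- a, 1::complex:]) dvd p * p - [:0, 1:]"
  using assms
proof (induction M)
  case (add a M)
  let ?f = "\<Prod>a\<in>#M. [:- a, 1:]"
  obtain p q where pq: "p * p - [:0, 1:] = ?f * q" using add by (auto simp: dvd_def)
  have "\<exists>c. poly q a + 2 * c * poly p a + c\<^sup>2 * poly ?f a = 0"
  proof (cases "poly ?f a = 0")
    case True
    have "poly p a * poly p a - a = 0"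
      using arg_cong[OF pq, of "\<lambda>r. poly r a"] True by simp
    then have "poly p a \<noteq> 0" using add.prems by auto
    then show ?thesis using True by (intro exI[of _ "- poly q a / (2 * poly p a)"]) simp
  next
    case False
    let ?F = "poly ?f a" and ?p = "poly p a" and ?q = "poly q a"
    let ?s = "csqrt (?p\<^sup>2 - ?F * ?q)"
    have s: "?s\<^sup>2 = ?p\<^sup>2 - ?F * ?q" by (rule power2_csqrt)
    have "?q + 2 * ((?s - ?p) / ?F) * ?p + ((?s - ?p) / ?F)\<^sup>2 * ?F = (?q * ?F + 2 * (?s - ?p) * ?p + (?s - ?p)\<^sup>2) / ?F"
      using False by (simp add: field_simps power2_eq_square)
    also have "?q * ?F + 2 * (?s - ?p) * ?p + (?s - ?p)\<^sup>2 = 0"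
      using s by (simp add: algebra_simps power2_eq_square)
    finally have "?q + 2 * ((?s - ?p) / ?F) * ?p + ((?s - ?p) / ?F)\<^sup>2 * ?F = 0 / ?F" .
    then show ?thesis unfolding div_0 by blast
  qed
  then obtain c where c: "poly q a + 2 * c * poly p a + c\<^sup>2 * poly ?f a = 0" by blast
  let ?r = "q + (2 * [:c:] * p + [:c:] * [:c:] * ?f)"
  have "poly ?r a = 0" using c by (simp add: algebra_simps power2_eq_square)
  then have "[:- a, 1:] dvd ?r" by (rule iffD1[OF poly_eq_0_iff_dvd])
  then have "[:- a, 1:] * ?f dvd ?r * ?f" by (rule mult_dvd_mono) simp
  moreover have "(p + [:c:] * ?f) * (p + [:c:] * ?f) - [:0, 1:] = ?r * ?f"
  proof -
    have "(x + y * z) * (x + y * z) - t = (x * x - t) + (2 * y * x + y * y * z) * z"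
      for x y z t :: "complex poly" by (simp add: algebra_simps)
    from this[of p "[:c:]" ?f "[:0, 1:]"] show ?thesis unfolding pq by (simp only: distrib_right mult.commute[of q])
  qed
  ultimately have "(\<Prod>a\<in>#add_mset a M. [:- a, 1:]) dvd (p + [:c:] * ?f) * (p + [:c:] * ?f) - [:0, 1:]"
    unfolding image_mset_add_mset prod_mset.add_mset by (simp only:)
  then show ?case by blast
qed (auto intro: exI[of _ 0])

text \<open>An annihilating polynomial of least degree of an invertible matrix has no root \<open>0\<close>, so \<open>X\<close>
  has a square root modulo it.\<close>

lemma operator_sqrt:
  assumes A: "inv2 n A A'"
  shows "\<exists>p. \<forall>x\<in>V n. pev n A p (pev n A p x) = act n A x"
proof -
  have "\<exists>M. annih n A M \<and> (\<forall>N. annih n A N \<longrightarrow> size M \<le> size N)"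
    using annih_exists ex_has_least_nat[of "annih n A" _ size] by blast
  then obtain M where M: "annih n A M" and least: "\<And>N. annih n A N \<Longrightarrow> size M \<le> size N" by blast
  have "0 \<notin># M"
  proof
    assume "0 \<in># M"
    then obtain N where N: "M = add_mset 0 N" by (meson mset_add)
    have "annih n A N" unfolding annih_def
    proof
      fix x assume x: "x \<in> V n"
      let ?y = "pev n A (\<Prod>a\<in>#N. [:- a, 1:]) x"
      have "act n A ?y = (\<lambda>_. 0)" using M x using pev_add_mset[of n A 0 N x] by (simp add: annih_def N)
      then have "?y = act n A' (\<lambda>_. 0)" using inv2D(7)[OF A pev_V[OF x]] by metis
      then show "?y = (\<lambda>_. 0)" by (simp add: act_zero)
    qed
    from least[OF this] show False by (simp add: N)
  qed
  then obtain p q where pq: "p * p - [:0, 1:] = (\<Prod>a\<in>#M. [:- a, 1:]) * q"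
    using poly_sqrt_mod[OF \<open>0 \<notin># M\<close>] unfolding dvd_def by blast
  have "pev n A p (pev n A p x) = act n A x" if x: "x \<in> V n" for x
  proof -
    have "p * p = [:0, 1:] + q * (\<Prod>a\<in>#M. [:- a, 1:])" using pq by (simp add: algebra_simps)
    then have "pev n A p (pev n A p x) = (\<lambda>i. pev n A [:0, 1:] x i + pev n A (q * (\<Prod>a\<in>#M. [:- a, 1:])) x i)"
      by (metis pev_mult pev_add)
    then show ?thesis using M x by (simp add: pev_mult annih_def pev_zero act_zero)
  qed
  then show ?thesis by blast
qed

lemma frm_zero_right [simp]: "frm n S x (\<lambda>_. 0) = 0"
  by (simp add: frm_def act_zero)

lemma frm_zero_left [simp]: "frm n S (\<lambda>_. 0) x = 0"
  by (simp add: frm_def)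

lemma pev_self_adjoint:
  assumes "\<And>x y. frm n S (act n A x) y = frm n S x (act n A y)"
  shows "frm n S (pev n A q x) y = frm n S x (pev n A q y)"
proof (induction q arbitrary: x y rule: pCons_induct)
  case (pCons c q)
  have "frm n S (\<lambda>i. c * x i + 1 * act n A (pev n A q x) i) y = frm n S x (\<lambda>i. c * y i + 1 * act n A (pev n A q y) i)"
    unfolding frm_comb_left frm_comb_right by (simp add: assms pCons.IH pev_act)
  then show ?case by simp
qed simp

text \<open>Let \<open>hs\<close> be the adjoint of \<open>h\<close> and \<open>k0\<close> its inverse. Because the families are self-dual,
  \<open>k0\<close> also carries \<open>Z j\<close> to \<open>Z' j\<close>, and \<open>a = hs h\<close> preserves \<open>Z j\<close>. A square root \<open>r\<close> of \<open>a\<close> that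
  is a polynomial in \<open>a\<close> is again self-adjoint and preserves every \<open>Z j\<close>. Thus \<open>k0 r\<close> carries
  \<open>Z j\<close> to \<open>Z' j\<close>, and it is an isometry: its adjoint is \<open>r h\<^sup>-\<^sup>1\<close>, and
  \<open>r h\<^sup>-\<^sup>1 k0 r = r a\<^sup>-\<^sup>1 r = 1\<close>.\<close>

theorem isometry_of_linear_iso:
  assumes S: "inv2 n S S'" and sym: "\<And>x y. frm n S x y = \<epsilon> * frm n S y x" and h: "inv2 n h h'"
    and Z: "\<And>j. j \<in> J \<Longrightarrow> \<iota> j \<in> J" "\<And>j. j \<in> J \<Longrightarrow> Z j = perp n S (Z (\<iota> j))"
      "\<And>j. j \<in> J \<Longrightarrow> Z' j = perp n S (Z' (\<iota> j))" "\<And>j. j \<in> J \<Longrightarrow> act n h ` Z j = Z' j"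
  obtains k where "k \<in> carrier_mat n n" "transpose_mat k * S * k = S" "\<And>j. j \<in> J \<Longrightarrow> act n k ` Z j = Z' j"
proof -
  note SC = inv2D(1,2)[OF S] and hC = inv2D(1,2)[OF h]
  define hs where "hs = S' * (transpose_mat h * S)"
  define k0 where "k0 = S' * (transpose_mat h' * S)"
  have C: "hs \<in> carrier_mat n n" "k0 \<in> carrier_mat n n" using SC hC by (auto simp: hs_def k0_def)
  have adj: "frm n S x (act n hs y) = frm n S (act n h x) y"
    "frm n S x (act n k0 y) = frm n S (act n h' x) y" for x y
  proof -
    have "S * (S' * (transpose_mat g * S)) = transpose_mat g * S" if "g \<in> carrier_mat n n" for g
    proof -
      have "S * (S' * (transpose_mat g * S)) = S * S' * (transpose_mat g * S)"
        by (rule assoc_mult_mat[symmetric]) (use that SC in auto)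
      then show ?thesis using that SC inv2D(3)[OF S] by simp
    qed
    then show "frm n S x (act n hs y) = frm n S (act n h x) y"
      "frm n S x (act n k0 y) = frm n S (act n h' x) y"
      using SC hC C by (simp_all add: frm_act_right frm_act_left hs_def k0_def)
  qed
  have adj': "frm n S (act n hs x) y = frm n S x (act n h y)" "frm n S (act n k0 x) y = frm n S x (act n h' y)" for x y
    using adj sym by metis+
  have nondeg: "y = z" if "y \<in> V n" "z \<in> V n" "\<And>x. x \<in> V n \<Longrightarrow> frm n S x y = frm n S x z" for y z
  proof -
    have "act n S y = act n S z"
    proof
      fix i show "act n S y i = act n S z i"
        using that(3)[OF unit_V, of i] frm_unit_left[of i n S] by (cases "i < n") (auto simp: act_def)
    qed
    then show ?thesis using inv2D(7)[OF S] that by metis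
  qed
  have hsk0: "act n hs (act n k0 x) = x" "act n k0 (act n hs x) = x" if "x \<in> V n" for x
    using that by (auto intro!: nondeg simp: adj inv2D(6,7)[OF h])
  have a: "inv2 n (hs * h) (h' * k0)"
  proof -
    have "inv2 n hs k0" unfolding inv2_def
      using C by (auto intro!: act_eqI simp: act_mult act_one hsk0)
    from inv2_mult[OF this h] show ?thesis .
  qed
  let ?a = "hs * h"
  have aact: "act n ?a x = act n hs (act n h x)" for x by (rule act_mult[OF C(1) hC(1)])
  obtain p where p: "\<And>x. x \<in> V n \<Longrightarrow> pev n ?a p (pev n ?a p x) = act n ?a x"
    using operator_sqrt[OF a] by blast
  let ?r = "pev n ?a p"
  have aself: "frm n S (act n ?a x) y = frm n S x (act n ?a y)" for x y
    unfolding aact by (simp add: adj adj')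
  define kf where "kf x = act n k0 (?r x)" for x
  define k where "k = mat n n (\<lambda>(i, j). kf (unit j) i)"
  have kact: "act n k x = kf x" if "x \<in> V n" for x
    unfolding k_def by (rule act_mat_of[OF _ _ that]) (auto simp: kf_def pev_comb act_comb)
  have iso: "frm n S (kf x) (kf y) = frm n S x y" if "x \<in> V n" "y \<in> V n" for x y
  proof -
    let ?z = "act n (h' * k0) (?r y)"
    have ry: "?r y \<in> V n" by (rule pev_V[OF that(2)])
    have az: "act n ?a ?z = ?r y" by (rule inv2D(6)[OF a ry])
    have "act n ?a (?r ?z) = act n ?a y" using p[OF that(2)] az by (simp flip: pev_act)
    then have rz: "?r ?z = y" using inv2D(7)[OF a] that(2) pev_V act_V by metis
    have "frm n S (kf x) (kf y) = frm n S (?r x) (act n h' (act n k0 (?r y)))"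
      by (simp add: kf_def adj')
    also have "\<dots> = frm n S (?r x) ?z" using act_mult[OF hC(2) C(2)] by simp
    also have "\<dots> = frm n S x (?r ?z)" by (rule pev_self_adjoint[OF aself])
    finally show ?thesis by (simp add: rz)
  qed
  have kC: "k \<in> carrier_mat n n" by (simp add: k_def)
  have "transpose_mat k * S * k = S"
  proof (rule frm_eqI)
    fix x y assume xy: "x \<in> V n" "y \<in> V n"
    have "frm n (transpose_mat k * S * k) x y = frm n (transpose_mat k * S) x (act n k y)"
      using SC kC by (simp add: frm_act_right)
    also have "\<dots> = frm n S (act n k x) (act n k y)" using SC kC by (simp add: frm_act_left)
    finally show "frm n (transpose_mat k * S * k) x y = frm n S x y" using iso xy kact by simp
  qed (use SC kC in auto)
  moreover have "act n k ` Z j = Z' j" if j: "j \<in> J" for j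
  proof
    have ZV: "Z j \<subseteq> V n" "Z' j \<subseteq> V n" unfolding Z(2)[OF j] Z(3)[OF j] by (rule perp_V)+
    have sZ: "subsp (Z j)" unfolding Z(2)[OF j] by (rule subsp_perp)
    have "act n ?a x \<in> Z j" if x: "x \<in> Z j" for x
      unfolding Z(2)[OF j] perp_def
    proof (intro CollectI conjI ballI)
      fix y assume "y \<in> Z (\<iota> j)"
      then have "act n h y \<in> Z' (\<iota> j)" using Z(4)[OF Z(1)[OF j]] by blast
      moreover have "act n h x \<in> perp n S (Z' (\<iota> j))" using Z(4)[OF j] Z(3)[OF j] x by blast
      ultimately show "frm n S y (act n ?a x) = 0" by (simp add: aact adj perp_def)
    qed simp
    then have rZ: "?r x \<in> Z j" if "x \<in> Z j" for x using pev_invariant[OF sZ] that by blast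
    have k0Z: "act n k0 x \<in> Z' j" if x: "x \<in> Z j" for x
      unfolding Z(3)[OF j] perp_def
    proof (intro CollectI conjI ballI)
      fix y' assume "y' \<in> Z' (\<iota> j)"
      then obtain y where y: "y \<in> Z (\<iota> j)" "y' = act n h y" using Z(4)[OF Z(1)[OF j]] by blast
      have "y \<in> V n" using y(1) Z(2)[OF Z(1)[OF j]] perp_V by blast
      then have "frm n S y' (act n k0 x) = frm n S y x" by (simp add: adj y(2) inv2D(7)[OF h])
      then show "frm n S y' (act n k0 x) = 0" using x y(1) Z(2)[OF j] by (auto simp: perp_def)
    qed simp
    show "act n k ` Z j \<subseteq> Z' j"
    proof
      fix z assume "z \<in> act n k ` Z j"
      then obtain x where x: "x \<in> Z j" "z = act n k x" by blast
      then show "z \<in> Z' j" using k0Z rZ kact ZV by (auto simp: kf_def)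
    qed
    show "Z' j \<subseteq> act n k ` Z j"
    proof
      fix z assume z: "z \<in> Z' j"
      then obtain x where x: "x \<in> Z j" "z = act n h x" using Z(4)[OF j] by blast
      have xV: "x \<in> V n" using x ZV by blast
      have "act n k (?r x) = act n k0 (act n ?a x)"
        using kact[OF pev_V[OF xV]] p[OF xV] by (simp add: kf_def)
      also have "\<dots> = z" by (simp add: aact hsk0 x(2))
      finally have "z = act n k (?r x)" ..
      then show "z \<in> act n k ` Z j" using rZ[OF x(1)] by blast
    qed
  qed
  ultimately show thesis using that kC by blast
qed

section \<open>The Zariski topology\<close>

lemma topspace_zariski [simp]: "topspace (zariski n) = carrier_mat n n"
proof -
  let ?\<S> = "{{A \<in> carrier_mat n n. f A \<noteq> 0} |f. f \<in> mat_polyfun n}"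
  have "carrier_mat n n \<in> ?\<S>"
    by (intro CollectI exI[of _ "\<lambda>A. 1"] conjI mat_polyfun.const) simp
  from Union_upper[OF this] have "\<Union> ?\<S> = carrier_mat n n" by (intro equalityI) auto
  then show ?thesis unfolding zariski_def topology_generated_by_topspace .
qed

text \<open>Only the values on the \<open>n \<times> n\<close> matrices count, so that determinants and cofactors qualify.\<close>

definition regf :: "nat \<Rightarrow> (complex mat \<Rightarrow> complex) \<Rightarrow> bool" where
  "regf n f \<longleftrightarrow> (\<exists>g\<in>mat_polyfun n. \<forall>A\<in>carrier_mat n n. f A = g A)"

lemma regf_cong: "(\<And>A. A \<in> carrier_mat n n \<Longrightarrow> f A = g A) \<Longrightarrow> regf n g \<Longrightarrow> regf n f"
  by (auto simp: regf_def)

lemma regf_const [intro]: "regf n (\<lambda>A. c)"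
  by (auto simp: regf_def intro: mat_polyfun.const)

lemma regf_entry [intro]: "i < n \<Longrightarrow> j < n \<Longrightarrow> regf n (\<lambda>A. A $$ (i, j))"
  by (auto simp: regf_def intro: mat_polyfun.entry)

lemma regf_add [intro]:
  assumes "regf n f" "regf n g" shows "regf n (\<lambda>A. f A + g A)"
proof -
  obtain f' g' where "f' \<in> mat_polyfun n" "g' \<in> mat_polyfun n"
    "\<forall>A\<in>carrier_mat n n. f A = f' A" "\<forall>A\<in>carrier_mat n n. g A = g' A"
    using assms by (auto simp: regf_def)
  then show ?thesis unfolding regf_def by (intro bexI[OF _ mat_polyfun.add[of f' n g']]) auto
qed

lemma regf_mult [intro]:
  assumes "regf n f" "regf n g" shows "regf n (\<lambda>A. f A * g A)"
proof -
  obtain f' g' where "f' \<in> mat_polyfun n" "g' \<in> mat_polyfun n"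
    "\<forall>A\<in>carrier_mat n n. f A = f' A" "\<forall>A\<in>carrier_mat n n. g A = g' A"
    using assms by (auto simp: regf_def)
  then show ?thesis unfolding regf_def by (intro bexI[OF _ mat_polyfun.mult[of f' n g']]) auto
qed

lemma regf_diff [intro]: "regf n f \<Longrightarrow> regf n g \<Longrightarrow> regf n (\<lambda>A. f A - g A)"
  using regf_add[OF _ regf_mult[OF regf_const[of n "- 1"]], of f g] by simp

lemma regf_sum [intro]: "(\<And>k. k \<in> J \<Longrightarrow> regf n (f k)) \<Longrightarrow> regf n (\<lambda>A. \<Sum>k\<in>J. f k A)"
  by (induction J rule: infinite_finite_induct) auto

lemma regf_prod [intro]: "(\<And>k. k \<in> J \<Longrightarrow> regf n (f k)) \<Longrightarrow> regf n (\<lambda>A. \<Prod>k\<in>J. f k A)"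
  by (induction J rule: infinite_finite_induct) auto

lemma closedin_zeros:
  assumes "\<And>i. i \<in> I \<Longrightarrow> regf n (f i)"
  shows "closedin (zariski n) {A \<in> carrier_mat n n. \<forall>i\<in>I. f i A = 0}"
proof -
  have "\<forall>i\<in>I. \<exists>g. g \<in> mat_polyfun n \<and> (\<forall>A\<in>carrier_mat n n. f i A = g A)"
    using assms by (auto simp: regf_def)
  then obtain g where g: "\<And>i. i \<in> I \<Longrightarrow> g i \<in> mat_polyfun n"
    "\<And>i A. i \<in> I \<Longrightarrow> A \<in> carrier_mat n n \<Longrightarrow> f i A = g i A" by metis
  have "openin (zariski n) {A \<in> carrier_mat n n. g i A \<noteq> 0}" if "i \<in> I" for i
    unfolding zariski_def by (rule topology_generated_by_Basis) (use g(1)[OF that] in blast)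
  then have "openin (zariski n) (\<Union>i\<in>I. {A \<in> carrier_mat n n. g i A \<noteq> 0})"
    by (intro openin_Union) auto
  moreover have "topspace (zariski n) - {A \<in> carrier_mat n n. \<forall>i\<in>I. f i A = 0}
      = (\<Union>i\<in>I. {A \<in> carrier_mat n n. g i A \<noteq> 0})" using g(2) by auto
  ultimately show ?thesis unfolding closedin_def by auto
qed

definition regm :: "nat \<Rightarrow> (complex mat \<Rightarrow> complex mat) \<Rightarrow> bool" where
  "regm n \<phi> \<longleftrightarrow> (\<forall>A\<in>carrier_mat n n. \<phi> A \<in> carrier_mat n n) \<and>
     (\<forall>i<n. \<forall>j<n. regf n (\<lambda>A. \<phi> A $$ (i, j)))"

lemma regm_id: "regm n (\<lambda>A. A)" by (auto simp: regm_def)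

lemma regm_const: "B \<in> carrier_mat n n \<Longrightarrow> regm n (\<lambda>A. B)" by (auto simp: regm_def)

lemma mult_entry:
  assumes "A \<in> carrier_mat n n" "B \<in> carrier_mat n n" "i < n" "j < n"
  shows "(A * B) $$ (i, j) = (\<Sum>k<n. A $$ (i, k) * B $$ (k, j))"
  using assms by (simp add: scalar_prod_def atLeast0LessThan)

lemma regm_mult:
  assumes "regm n \<phi>" "regm n \<psi>" shows "regm n (\<lambda>A. \<phi> A * \<psi> A)"
proof -
  have "regf n (\<lambda>A. (\<phi> A * \<psi> A) $$ (i, j))" if ij: "i < n" "j < n" for i j
  proof -
    have "regf n (\<lambda>A. \<Sum>k<n. \<phi> A $$ (i, k) * \<psi> A $$ (k, j))"
      by (intro regf_sum regf_mult) (use assms ij in \<open>auto simp: regm_def\<close>)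
    moreover have "(\<phi> A * \<psi> A) $$ (i, j) = (\<Sum>k<n. \<phi> A $$ (i, k) * \<psi> A $$ (k, j))"
      if "A \<in> carrier_mat n n" for A
      using assms that ij by (intro mult_entry) (auto simp: regm_def)
    ultimately show ?thesis by (rule regf_cong[rotated])
  qed
  then show ?thesis using assms by (auto simp: regm_def)
qed

lemma regm_transpose: "regm n transpose_mat"
proof -
  have "regf n (\<lambda>A. transpose_mat A $$ (i, j))" if "i < n" "j < n" for i j
    by (rule regf_cong[OF _ regf_entry[OF that(2,1)]]) (use that in auto)
  then show ?thesis by (auto simp: regm_def)
qed

lemma regf_det:
  assumes "\<And>A. A \<in> carrier_mat n n \<Longrightarrow> \<phi> A \<in> carrier_mat m m"
    and "\<And>i j. i < m \<Longrightarrow> j < m \<Longrightarrow> regf n (\<lambda>A. \<phi> A $$ (i, j))"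
  shows "regf n (\<lambda>A. det (\<phi> A))"
proof -
  have "regf n (\<lambda>A. \<Sum>p\<in>{p. p permutes {0..<m}}. signof p * (\<Prod>i = 0..<m. \<phi> A $$ (i, p i)))"
  proof (intro regf_sum regf_mult regf_const regf_prod assms(2))
    fix p i assume "p \<in> {p. p permutes {0..<m}}" "i \<in> {0..<m}"
    then show "i < m" "p i < m" using permutes_in_image[of p "{0..<m}" i] by auto
  qed
  moreover have "det (\<phi> A) = (\<Sum>p\<in>{p. p permutes {0..<m}}. signof p * (\<Prod>i = 0..<m. \<phi> A $$ (i, p i)))"
    if "A \<in> carrier_mat n n" for A by (rule det_def'[OF assms(1)[OF that]])
  ultimately show ?thesis by (rule regf_cong[rotated])
qed

lemma regm_adj: "regm n adj_mat"
proof -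
  have "regf n (\<lambda>A. adj_mat A $$ (i, j))" if ij: "i < n" "j < n" for i j
  proof -
    have "regf n (\<lambda>A. (- 1) ^ (j + i) * det (mat_delete A j i))"
    proof (intro regf_mult regf_const regf_det[where m = "n - 1"])
      fix k l assume kl: "k < n - 1" "l < n - 1"
      have "regf n (\<lambda>A. A $$ (if k < j then k else Suc k, if l < i then l else Suc l))"
        using kl by (intro regf_entry) auto
      moreover have "mat_delete A j i $$ (k, l) = A $$ (if k < j then k else Suc k, if l < i then l else Suc l)"
        if "A \<in> carrier_mat n n" for A using that kl by (auto simp: mat_delete_def)
      ultimately show "regf n (\<lambda>A. mat_delete A j i $$ (k, l))" by (rule regf_cong[rotated])
    qed (auto simp: mat_delete_def)
    moreover have "adj_mat A $$ (i, j) = (- 1) ^ (j + i) * det (mat_delete A j i)"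
      if "A \<in> carrier_mat n n" for A using that ij by (auto simp: adj_mat_def cofactor_def)
    ultimately show ?thesis by (rule regf_cong[rotated])
  qed
  then show ?thesis using adj_mat(1) by (auto simp: regm_def)
qed

lemma regf_act:
  assumes "\<And>j. j < n \<Longrightarrow> regf n (\<lambda>A. u A j)"
  shows "regf n (\<lambda>A. act n M (u A) i)"
proof (cases "i < n")
  case True
  have "regf n (\<lambda>A. \<Sum>j<n. M $$ (i, j) * u A j)"
    by (intro regf_sum regf_mult regf_const assms) auto
  then show ?thesis using True by (simp add: act_def)
qed (auto simp: act_def)

lemma regf_act_entry: "regf n (\<lambda>A. act n A v i)"
proof (cases "i < n")
  case True
  have "regf n (\<lambda>A. \<Sum>j<n. A $$ (i, j) * v j)"
    by (intro regf_sum regf_mult regf_const regf_entry) (use True in auto)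
  then show ?thesis using True by (simp add: act_def)
qed (auto simp: act_def)

lemma continuous_map_into_zariski:
  assumes "\<And>x. x \<in> topspace T \<Longrightarrow> \<phi> x \<in> carrier_mat n n"
    and "\<And>f. f \<in> mat_polyfun n \<Longrightarrow> openin T {x \<in> topspace T. f (\<phi> x) \<noteq> 0}"
  shows "continuous_map T (zariski n) \<phi>"
  unfolding zariski_def continuous_on_generated_topo_iff
proof (intro conjI allI impI)
  fix U assume "U \<in> {{A \<in> carrier_mat n n. f A \<noteq> 0} |f. f \<in> mat_polyfun n}"
  then obtain f where f: "f \<in> mat_polyfun n" "U = {A \<in> carrier_mat n n. f A \<noteq> 0}" by blast
  have "\<phi> -` U \<inter> topspace T = {x \<in> topspace T. f (\<phi> x) \<noteq> 0}" using assms(1) f(2) by auto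
  then show "openin T (\<phi> -` U \<inter> topspace T)" using assms(2)[OF f(1)] by simp
next
  have "\<phi> ` topspace T \<subseteq> topspace (zariski n)" using assms(1) by auto
  then show "\<phi> ` topspace T \<subseteq> \<Union> {{A \<in> carrier_mat n n. f A \<noteq> 0} |f. f \<in> mat_polyfun n}"
    unfolding zariski_def topology_generated_by_topspace .
qed

lemma continuous_map_regm:
  assumes "regm n \<phi>" shows "continuous_map (zariski n) (zariski n) \<phi>"
proof (rule continuous_map_into_zariski)
  fix f assume f: "f \<in> mat_polyfun n"
  then have "regf n (\<lambda>A. f (\<phi> A))"
    by induction (use assms in \<open>auto simp: regm_def\<close>)
  then have "closedin (zariski n) {A \<in> carrier_mat n n. \<forall>i\<in>{()}. f (\<phi> A) = 0}"
    by (intro closedin_zeros)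
  then have "openin (zariski n) (topspace (zariski n) - {A \<in> carrier_mat n n. f (\<phi> A) = 0})"
    by (intro openin_diff openin_topspace) simp
  moreover have "topspace (zariski n) - {A \<in> carrier_mat n n. f (\<phi> A) = 0}
      = {A \<in> topspace (zariski n). f (\<phi> A) \<noteq> 0}" by auto
  ultimately show "openin (zariski n) {A \<in> topspace (zariski n). f (\<phi> A) \<noteq> 0}" by simp
qed (use assms in \<open>auto simp: regm_def\<close>)

text \<open>Every use of connectedness has this form: a quantity with finitely many possible values,
  each attained on a closed set, is constant.\<close>

lemma connected_in_one:
  assumes H: "connectedin X H" and C: "finite C" "\<And>c. c \<in> C \<Longrightarrow> closedin X (F c)"
    and cover: "\<And>h. h \<in> H \<Longrightarrow> \<exists>c\<in>C. h \<in> F c"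
    and disj: "\<And>h c d. h \<in> H \<Longrightarrow> h \<in> F c \<Longrightarrow> h \<in> F d \<Longrightarrow> c = d"
    and c0: "c0 \<in> C" "h0 \<in> H" "h0 \<in> F c0" and h: "h \<in> H"
  shows "h \<in> F c0"
proof (rule ccontr)
  assume *: "h \<notin> F c0"
  let ?E = "\<Union>c\<in>C - {c0}. F c"
  have "closedin X ?E" using C by (intro closedin_Union) auto
  moreover have "H \<subseteq> F c0 \<union> ?E" using cover by fast
  moreover have "F c0 \<inter> ?E \<inter> H = {}" using disj by blast
  moreover have "F c0 \<inter> H \<noteq> {}" using c0 by blast
  moreover have "?E \<inter> H \<noteq> {}" using cover[OF h] h * by blast
  ultimately show False using H C(2)[OF c0(1)] unfolding connectedin_closedin by blast
qed

lemma connectedin_from_point: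
  assumes "\<And>g. g \<in> U \<Longrightarrow> \<exists>C. connectedin X C \<and> C \<subseteq> U \<and> a \<in> C \<and> g \<in> C"
  shows "connectedin X U"
proof -
  let ?\<C> = "{C. connectedin X C \<and> C \<subseteq> U \<and> a \<in> C}"
  have "connectedin X (\<Union> ?\<C>)" by (rule connectedin_Union) auto
  moreover have "\<Union> ?\<C> = U"
  proof
    show "U \<subseteq> \<Union> ?\<C>" using assms by blast
  qed auto
  ultimately show ?thesis by simp
qed

text \<open>A matrix that brings \<open>A0\<close> into normal form turns it into a coordinate subspace.\<close>

lemma subspace_equations:
  assumes "subsp A0" "A0 \<subseteq> V n"
  obtains M R where "\<And>x. x \<in> V n \<Longrightarrow> x \<in> A0 \<longleftrightarrow> (\<forall>i\<in>{..<n} - R. act n M x i = 0)"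
proof -
  obtain g R \<pi> where g: "g \<in> moves (\<lambda>_. 0) (\<lambda>_. 0) {..<n}" "R \<subseteq> {..<n}" "pairing (\<lambda>_. 0) (\<lambda>_. 0) R \<pi>"
      "g ` A0 = NF R \<pi>"
    using normal_form[OF finite_lessThan width2_chain assms, where p = "\<lambda>_. 0"] by blast
  then have eq: "g ` A0 = coord R" using pairing_chain by auto
  obtain M M' where M: "\<And>x. x \<in> V n \<Longrightarrow> act n M x = g x" using moves_matrix[OF g(1)] by blast
  have "x \<in> A0 \<longleftrightarrow> (\<forall>i\<in>{..<n} - R. act n M x i = 0)" if x: "x \<in> V n" for x
  proof -
    have "inj g" using moves_inj_surj[OF g(1)] by (simp add: bij_def)
    then have "x \<in> A0 \<longleftrightarrow> g x \<in> coord R" unfolding eq[symmetric] by (simp add: inj_image_mem_iff)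
    also have "\<dots> \<longleftrightarrow> (\<forall>i\<in>{..<n} - R. act n M x i = 0)"
      unfolding M[OF x, symmetric] using act_V[of n M x] by (auto simp: coord_def)
    finally show ?thesis .
  qed
  then show thesis using that by blast
qed

lemma closedin_in_subspace:
  assumes A0: "subsp A0" "A0 \<subseteq> V n"
    and u: "\<And>A. u A \<in> V n" "\<And>j. j < n \<Longrightarrow> regf n (\<lambda>A. u A j)"
  shows "closedin (zariski n) {A \<in> carrier_mat n n. u A \<in> A0}"
proof -
  obtain M R where M: "\<And>x. x \<in> V n \<Longrightarrow> x \<in> A0 \<longleftrightarrow> (\<forall>i\<in>{..<n} - R. act n M x i = 0)"
    using subspace_equations[OF A0] by metis
  have "closedin (zariski n) {A \<in> carrier_mat n n. \<forall>i\<in>{..<n} - R. act n M (u A) i = 0}"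
    by (intro closedin_zeros regf_act u(2))
  then show ?thesis using M[OF u(1)] by simp
qed

section \<open>Connected solvable groups have invariant flags\<close>

text \<open>A group of matrices whose inversion is polynomial in the entries, as for the special linear
  group (the adjugate) and for isometry groups (the adjoint). Commutators are then continuous for
  the Zariski topology.\<close>

locale regular_group =
  fixes n :: nat and X :: "complex mat set" and \<iota> :: "complex mat \<Rightarrow> complex mat"
  assumes X_carrier: "X \<subseteq> carrier_mat n n"
    and X_group: "group (mat_group n X)"
    and X_inv: "\<And>A. A \<in> X \<Longrightarrow> inv\<^bsub>mat_group n X\<^esub> A = \<iota> A"
    and reg_inv: "regm n \<iota>"
begin

abbreviation G where "G \<equiv> mat_group n X"

lemma G_simps [simp]: "carrier G = X" "monoid.mult G = (*)" "monoid.one G = 1\<^sub>m n"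
  by (simp_all add: mat_group_def)

sublocale group G by (rule X_group)

lemma inv_props:
  assumes "A \<in> X"
  shows "\<iota> A \<in> X" "A * \<iota> A = 1\<^sub>m n" "\<iota> A * A = 1\<^sub>m n" "inv2 n A (\<iota> A)"
proof -
  show 1: "\<iota> A \<in> X" "A * \<iota> A = 1\<^sub>m n" "\<iota> A * A = 1\<^sub>m n"
    using inv_closed[of A] r_inv[of A] l_inv[of A] X_inv[OF assms] assms by auto
  then show "inv2 n A (\<iota> A)" using assms X_carrier by (auto simp: inv2_def)
qed

lemma subgroup_props:
  assumes "subgroup H G"
  shows "H \<subseteq> X" "1\<^sub>m n \<in> H" "A \<in> H \<Longrightarrow> B \<in> H \<Longrightarrow> A * B \<in> H" "A \<in> H \<Longrightarrow> \<iota> A \<in> H"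
  using subgroup.subset[OF assms] subgroup.one_closed[OF assms] subgroup.m_closed[OF assms, of A B]
    subgroup.m_inv_closed[OF assms, of A] X_inv by auto

lemma derived_setE:
  assumes "h \<in> derived_set G H" "H \<subseteq> X"
  obtains x y where "x \<in> H" "y \<in> H" "h = x * y * \<iota> x * \<iota> y"
proof -
  obtain x y where "x \<in> H" "y \<in> H" "h = x * y * inv\<^bsub>G\<^esub> x * inv\<^bsub>G\<^esub> y" using assms(1) by auto
  moreover have "inv\<^bsub>G\<^esub> x = \<iota> x" "inv\<^bsub>G\<^esub> y = \<iota> y" using X_inv assms(2) calculation(1,2) by auto
  ultimately show thesis using that[of x y] by (simp only:)
qed

lemma derived_setI:
  assumes "x \<in> H" "y \<in> H" "H \<subseteq> X"
  shows "x * y * \<iota> x * \<iota> y \<in> derived_set G H"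
proof -
  have "x * y * inv\<^bsub>G\<^esub> x * inv\<^bsub>G\<^esub> y \<in> derived_set G H" using assms(1,2) by auto
  moreover have "inv\<^bsub>G\<^esub> x = \<iota> x" "inv\<^bsub>G\<^esub> y = \<iota> y" using X_inv assms by auto
  ultimately show ?thesis by (simp only:)
qed

text \<open>The commutators of a fixed \<open>x\<close> with all of \<open>H\<close> form a connected set that contains 1;
  translates of such sets and of their inverses link any product of commutators to 1.\<close>

lemma derived_connected:
  assumes H: "subgroup H G" "connectedin (zariski n) H"
  shows "connectedin (zariski n) (derived G H)"
proof -
  note HX = subgroup_props[OF H(1)]
  have HC: "H \<subseteq> carrier_mat n n" using HX(1) X_carrier by blast
  have dsub: "subgroup (derived G H) G" using derived_is_subgroup HX(1) by simp
  note D = subgroup_props[OF dsub]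
  have conn: "connectedin (zariski n) (\<phi> ` C)" if "regm n \<phi>" "connectedin (zariski n) C" for \<phi> C
    by (rule connectedin_continuous_map_image[OF continuous_map_regm[OF that(1)] that(2)])
  have \<iota>1: "\<iota> (1\<^sub>m n) = 1\<^sub>m n" using X_inv[of "1\<^sub>m n"] inv_one HX(1,2) by auto
  have comm: "\<exists>C. connectedin (zariski n) C \<and> C \<subseteq> derived G H \<and> 1\<^sub>m n \<in> C \<and> h \<in> C"
    if h: "h \<in> derived_set G H" for h
  proof -
    obtain x y where xy: "x \<in> H" "y \<in> H" "h = x * y * \<iota> x * \<iota> y" using derived_setE[OF h HX(1)] by blast
    let ?f = "\<lambda>A. x * A * \<iota> x * \<iota> A"
    have xC: "x \<in> carrier_mat n n" "\<iota> x \<in> carrier_mat n n" using xy HC HX(4) by auto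
    have "regm n ?f" using xC by (intro regm_mult regm_const regm_id reg_inv)
    then have "connectedin (zariski n) (?f ` H)" using conn H(2) by blast
    moreover have "?f ` H \<subseteq> derived G H"
    proof
      fix z assume "z \<in> ?f ` H"
      then obtain A where "A \<in> H" "z = ?f A" by blast
      then have "z \<in> derived_set G H" using derived_setI[OF xy(1) _ HX(1)] by (simp only:)
      then show "z \<in> derived G H" unfolding derived_def by (rule generate.incl)
    qed
    moreover have "1\<^sub>m n \<in> ?f ` H"
    proof -
      have "x \<in> X" using xy HX by auto
      then have "?f (1\<^sub>m n) = 1\<^sub>m n" using xC inv_props(2)[of x] \<iota>1 by simp
      then show ?thesis by (intro image_eqI[OF _ HX(2)]) simp
    qed
    ultimately show ?thesis using xy by blast
  qed
  have "\<exists>C. connectedin (zariski n) C \<and> C \<subseteq> derived G H \<and> 1\<^sub>m n \<in> C \<and> d \<in> C"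
    if "d \<in> generate G (derived_set G H)" for d
    using that
  proof (induction rule: generate.induct)
    case one
    show ?case using D(2) by (intro exI[of _ "{1\<^sub>m n}"]) auto
  next
    case (incl h)
    show ?case by (rule comm[OF incl])
  next
    case (inv h)
    obtain C where C: "connectedin (zariski n) C" "C \<subseteq> derived G H" "1\<^sub>m n \<in> C" "h \<in> C"
      using comm[OF inv] by blast
    have "connectedin (zariski n) (\<iota> ` C)" by (rule conn[OF reg_inv C(1)])
    moreover have "\<iota> ` C \<subseteq> derived G H" using C(2) D(4) by blast
    moreover have "1\<^sub>m n \<in> \<iota> ` C" using \<iota>1 C(3) by (metis image_eqI)
    moreover have "inv\<^bsub>G\<^esub> h \<in> \<iota> ` C" using X_inv[of h] C(2,4) D(1) by auto
    ultimately show ?case by blast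
  next
    case (eng h1 h2)
    then obtain C1 C2 where C: "connectedin (zariski n) C1" "C1 \<subseteq> derived G H" "1\<^sub>m n \<in> C1" "h1 \<in> C1"
      "connectedin (zariski n) C2" "C2 \<subseteq> derived G H" "1\<^sub>m n \<in> C2" "h2 \<in> C2" by blast
    have h1: "h1 \<in> carrier_mat n n" using C(2,4) D(1) X_carrier by blast
    let ?C = "(\<lambda>A. h1 * A) ` C2"
    have h1C: "h1 \<in> ?C" using C(7) h1 by (intro image_eqI[of _ _ "1\<^sub>m n"]) auto
    have "regm n (\<lambda>A. h1 * A)" using h1 by (intro regm_mult regm_const regm_id)
    then have "connectedin (zariski n) (C1 \<union> ?C)"
      using conn C h1C by (intro connectedin_Un) auto
    moreover have "?C \<subseteq> derived G H" using D(3) C by blast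
    moreover have "h1 \<otimes>\<^bsub>G\<^esub> h2 \<in> ?C" using C by auto
    ultimately show ?case using C by (intro exI[of _ "C1 \<union> ?C"]) auto
  qed
  then show ?thesis
    by (intro connectedin_from_point[where a = "1\<^sub>m n"]) (simp add: derived_def[of G H])
qed

end

definition stable :: "nat \<Rightarrow> complex mat set \<Rightarrow> (nat \<Rightarrow> complex) set \<Rightarrow> bool" where
  "stable n H C \<longleftrightarrow> (\<forall>g\<in>H. \<forall>x\<in>C. act n g x \<in> C)"

lemma scalar_mod_unique:
  assumes A: "subsp A" and x: "(\<lambda>i. x i - c * u i) \<in> A" "(\<lambda>i. x i - d * u i) \<in> A" and u: "u \<notin> A"
  shows "c = d"
proof (rule ccontr)
  assume "c \<noteq> d"
  have "(\<lambda>i. (x i - c * u i) - (x i - d * u i)) \<in> A" by (rule subsp_diff[OF A x])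
  then have "(\<lambda>i. (1 / (d - c)) * ((x i - c * u i) - (x i - d * u i))) \<in> A" by (rule subsp_scale[OF A])
  moreover have "(\<lambda>i. (1 / (d - c)) * ((x i - c * u i) - (x i - d * u i))) = u"
    using \<open>c \<noteq> d\<close> by (auto simp: field_simps)
  ultimately show False using u by simp
qed

context regular_group begin

text \<open>The Lie-Kolchin theorem relative to an invariant subspace \<open>A0\<close>: the connected solvable group
  \<open>H\<close> has an eigenvector in \<open>C / A0\<close>. Replace \<open>C\<close> by a minimal invariant space \<open>D\<close>. By induction
  the derived group has an eigenvector \<open>v0\<close> in \<open>D / A0\<close>, with eigenvalues \<open>\<chi>\<close>. For \<open>g \<in> H\<close> the
  vector \<open>g v0\<close> is an eigenvector as well, and since \<open>H\<close> is connected its eigenvalues are those of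
  \<open>v0\<close>. So the vectors of weight \<open>\<chi>\<close> form an invariant space, and by minimality the derived group
  acts on \<open>D / A0\<close> by the scalars \<open>\<chi>\<close>. If now \<open>x \<in> H\<close> has an eigenvector \<open>v1\<close> with eigenvalue \<open>a\<close>,
  then \<open>x y v1 = \<chi>(x y x\<^sup>-\<^sup>1 y\<^sup>-\<^sup>1) a y v1\<close> for \<open>y \<in> H\<close>; again the
  eigenvalue cannot depend on \<open>y\<close>. Hence the eigenspace of \<open>x\<close> is invariant, equals \<open>D\<close> by
  minimality, and every vector of \<open>D\<close> outside \<open>A0\<close> is a common eigenvector.\<close>

lemma lie_kolchin:
  assumes "subgroup H G" "connectedin (zariski n) H" "(derived G ^^ k) H = {1\<^sub>m n}"
    and "subsp A0" "subsp C" "A0 \<subseteq> C" "A0 \<noteq> C" "C \<subseteq> V n" "stable n H A0" "stable n H C"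
  shows "\<exists>v\<in>C - A0. \<forall>g\<in>H. \<exists>c. (\<lambda>i. act n g v i - c * v i) \<in> A0"
  using assms
proof (induction k arbitrary: H C)
  case 0
  obtain v where v: "v \<in> C - A0" using "0.prems" by blast
  then have "(\<lambda>i. act n (1\<^sub>m n) v i - 1 * v i) \<in> A0"
    using subsp_zero[OF "0.prems"(4)] "0.prems"(8) by (auto simp: act_one)
  moreover have "H = {1\<^sub>m n}" using "0.prems"(3) by simp
  ultimately show ?case using v by blast
next
  case (Suc k)
  note H = Suc.prems(1,2) and A0 = Suc.prems(4)
  note HX = subgroup_props[OF H(1)]
  have HC: "H \<subseteq> carrier_mat n n" using HX(1) X_carrier by blast
  have AV: "A0 \<subseteq> V n" using Suc.prems by blast
  have A0st: "\<And>g x. g \<in> H \<Longrightarrow> x \<in> A0 \<Longrightarrow> act n g x \<in> A0" using Suc.prems(9) by (auto simp: stable_def)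
  let ?P = "\<lambda>D. subsp D \<and> A0 \<subseteq> D \<and> A0 \<noteq> D \<and> D \<subseteq> C \<and> stable n H D"
  have "?P C" using Suc.prems by auto
  then obtain D where D: "?P D" and Dmin: "\<And>E. ?P E \<Longrightarrow> dm D \<le> dm E"
    using ex_has_least_nat[of ?P C dm] by blast
  have DV: "D \<subseteq> V n" using D Suc.prems by blast
  have sD: "subsp D" and Dst: "\<And>g x. g \<in> H \<Longrightarrow> x \<in> D \<Longrightarrow> act n g x \<in> D" using D by (auto simp: stable_def)
  have whole: "E = D" if "subsp E" "A0 \<subseteq> E" "v \<in> E" "v \<notin> A0" "E \<subseteq> D" "stable n H E" for E v
    by (rule subsp_eqI[OF that(1) sD that(5) DV Dmin]) (use that D in auto)
  let ?H = "derived G H"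
  have H': "subgroup ?H G" using derived_is_subgroup HX(1) by simp
  note HX' = subgroup_props[OF H']
  have sub: "?H \<subseteq> H" using derived_incl[OF subset_refl H(1)] .
  have conn: "connectedin (zariski n) ?H" by (rule derived_connected[OF H])
  have "(derived G ^^ k) ?H = {1\<^sub>m n}" using Suc.prems(3) by (simp add: funpow_swap1)
  moreover have "stable n ?H A0" "stable n ?H D" using sub Suc.prems(9) D by (auto simp: stable_def)
  ultimately obtain v0 where v0: "v0 \<in> D" "v0 \<notin> A0" and "\<forall>h\<in>?H. \<exists>c. (\<lambda>i. act n h v0 i - c * v0 i) \<in> A0"
    using Suc.IH[OF H' conn _ A0 sD _ _ DV] D by blast
  then obtain \<chi> where \<chi>: "\<And>h. h \<in> ?H \<Longrightarrow> (\<lambda>i. act n h v0 i - \<chi> h * v0 i) \<in> A0" by metis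
  have invH: "act n (\<iota> g) (act n g x) = x" "act n g (act n (\<iota> g) x) = x" if "g \<in> H" "x \<in> V n" for g x
    using inv2D(6,7)[OF inv_props(4)] that HX(1) by blast+
  have notA: "act n g v \<notin> A0" if "g \<in> H" "v \<in> D" "v \<notin> A0" for g v
  proof
    assume "act n g v \<in> A0"
    then have "act n (\<iota> g) (act n g v) \<in> A0" using A0st HX(4) that(1) by blast
    then show False using invH(1)[OF that(1)] that DV by auto
  qed
  have multH: "act n (g * h) x = act n g (act n h x)" if "g \<in> H" "h \<in> H" for g h x
    using act_mult that HC by blast
  note unique = scalar_mod_unique[OF A0]
  \<comment> \<open>Here \<open>h'\<close> is the conjugate \<open>g\<^sup>-\<^sup>1 h g\<close>, written as a commutator times \<open>h\<close>.\<close>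
  have conj: "\<exists>h'\<in>?H. \<forall>u\<in>V n. act n g (act n h' u) = act n h (act n g u)" if g: "g \<in> H" and h: "h \<in> ?H" for g h
  proof -
    have hH: "h \<in> H" using h sub by blast
    let ?c = "\<iota> g * h * \<iota> (\<iota> g) * \<iota> h"
    have ii: "\<iota> (\<iota> g) = g" using g HX X_inv inv_inv by (metis G_simps(1) subsetD)
    have ig: "\<iota> g \<in> H" "\<iota> h \<in> H" using HX(4) g hH by auto
    have "?c \<in> ?H" unfolding derived_def
      by (intro generate.incl derived_setI[OF ig(1) hH HX(1)])
    then have cc: "?c * h \<in> ?H" using HX'(3) h by blast
    have c: "\<iota> g * h \<in> H" "\<iota> g * h * g \<in> H" "?c \<in> H" using HX(3) ig g hH ii by auto
    have "act n g (act n (?c * h) u) = act n h (act n g u)" if "u \<in> V n" for u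
    proof -
      have "act n (?c * h) u = act n (\<iota> g) (act n h (act n g (act n (\<iota> h) (act n h u))))"
        using multH c ig g hH ii by simp
      then show ?thesis using invH g hH that by auto
    qed
    then show ?thesis using cc by blast
  qed
  have push: "(\<lambda>i. act n g (act n h u) i - c * act n g u i) \<in> A0"
    if "g \<in> H" "(\<lambda>i. act n h u i - c * u i) \<in> A0" for g h u c
    using A0st[OF that] act_comb[of n g 1 "act n h u" "- c" u] by simp
  \<comment> \<open>An eigenvalue of \<open>h\<close> on the vectors \<open>g v\<close> cannot depend on \<open>g\<close>: it has finitely many possible
    values, each attained on a closed set, and \<open>H\<close> is connected.\<close>
  have const: "(\<lambda>i. act n h (act n g v) i - c * act n g v i) \<in> A0"
    if h: "h \<in> H" and v: "v \<in> D" "v \<notin> A0" and c: "(\<lambda>i. act n h v i - c * v i) \<in> A0"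
      and ev: "\<And>g. g \<in> H \<Longrightarrow> \<exists>c. (\<lambda>i. act n h (act n g v) i - c * act n g v i) \<in> A0" and g: "g \<in> H" for h v c g
  proof -
    obtain M where M: "annih n h M" using annih_exists by blast
    let ?F = "\<lambda>c. {A \<in> carrier_mat n n. (\<lambda>i. act n h (act n A v) i - c * act n A v i) \<in> A0}"
    have closed: "closedin (zariski n) (?F c)" for c
    proof (rule closedin_in_subspace[OF A0 AV])
      fix A show "(\<lambda>i. act n h (act n A v) i - c * act n A v i) \<in> V n"
        by (rule subsp_axpy[OF subsp_coord]) auto
    qed (intro regf_diff regf_mult regf_const regf_act regf_act_entry)
    have eig: "c \<in># M" if "g' \<in> H" "g' \<in> ?F c" for g' c
      using eigenvalues_mod[OF M _ notA[OF that(1) v] A0 A0st[OF h], of c] that(2) by auto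
    have cover: "\<exists>c\<in>set_mset M. g' \<in> ?F c" if g': "g' \<in> H" for g'
      using ev[OF g'] eig[OF g'] g' HC by blast
    have one: "1\<^sub>m n \<in> ?F c" using c v DV by (auto simp: act_one)
    have "g \<in> ?F c"
    proof (rule connected_in_one[OF H(2), where C = "set_mset M" and F = ?F])
      show "c \<in> set_mset M" using eig[OF HX(2) one] .
      show "\<And>h' c d. h' \<in> H \<Longrightarrow> h' \<in> ?F c \<Longrightarrow> h' \<in> ?F d \<Longrightarrow> c = d"
        using unique notA v by blast
    qed (rule finite_set_mset closed cover HX(2) one g; assumption?)+
    then show ?thesis by simp
  qed
  have weight: "(\<lambda>i. act n h (act n g v0) i - \<chi> h * act n g v0 i) \<in> A0" if g: "g \<in> H" and h: "h \<in> ?H" for g h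
  proof (rule const[OF _ v0 \<chi>[OF h] _ g])
    show "h \<in> H" using h sub by blast
    fix g' assume g': "g' \<in> H"
    obtain h' where h': "h' \<in> ?H" "act n g' (act n h' v0) = act n h (act n g' v0)"
      using conj[OF g' h] v0 DV by blast
    show "\<exists>c. (\<lambda>i. act n h (act n g' v0) i - c * act n g' v0 i) \<in> A0"
      using push[OF g' \<chi>[OF h'(1)]] unfolding h'(2) by blast
  qed
  have all_weight: "(\<lambda>i. act n h v i - \<chi> h * v i) \<in> A0" if v: "v \<in> D" and h: "h \<in> ?H" for v h
  proof -
    let ?W = "{v \<in> D. \<forall>h\<in>?H. (\<lambda>i. act n h v i - \<chi> h * v i) \<in> A0}"
    have "?W = D"
    proof (rule whole[of _ v0])
      show "subsp ?W" unfolding subsp_def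
      proof (intro conjI ballI allI)
        show "(\<lambda>_. 0) \<in> ?W" using subsp_zero[OF sD] subsp_zero[OF A0] by (simp add: act_zero)
        fix x y c d assume x: "x \<in> ?W" and y: "y \<in> ?W"
        have "(\<lambda>i. act n h (\<lambda>i. c * x i + d * y i) i - \<chi> h * (c * x i + d * y i)) \<in> A0" if "h \<in> ?H" for h
        proof -
          have "(\<lambda>i. c * (act n h x i - \<chi> h * x i) + d * (act n h y i - \<chi> h * y i)) \<in> A0"
            using x y that by (intro subsp_comb[OF A0]) auto
          then show ?thesis by (simp add: act_comb algebra_simps)
        qed
        then show "(\<lambda>i. c * x i + d * y i) \<in> ?W" using x y subsp_comb[OF sD] by auto
      qed
      show "A0 \<subseteq> ?W"
      proof
        fix x assume x: "x \<in> A0"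
        then have "(\<lambda>i. act n h x i - \<chi> h * x i) \<in> A0" if "h \<in> ?H" for h
          using subsp_axpy[OF A0 A0st] that sub by blast
        then show "x \<in> ?W" using x D by auto
      qed
      show "v0 \<in> ?W" "v0 \<notin> A0" "?W \<subseteq> D" using v0 \<chi> by auto
      show "stable n H ?W" unfolding stable_def
      proof (intro ballI)
        fix g v assume g: "g \<in> H" and v: "v \<in> ?W"
        have "(\<lambda>i. act n h (act n g v) i - \<chi> h * act n g v i) \<in> A0" if h: "h \<in> ?H" for h
        proof -
          obtain h' where h': "h' \<in> ?H" "\<And>u. u \<in> V n \<Longrightarrow> act n g (act n h' u) = act n h (act n g u)"
            using conj[OF g h] by blast
          have eq: "\<chi> h' = \<chi> h"
            by (rule unique[OF push[OF g \<chi>[OF h'(1)]] _ notA[OF g v0]])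
               (use weight[OF g h] h'(2)[of v0] v0 DV in auto)
          have "(\<lambda>i. act n h' v i - \<chi> h' * v i) \<in> A0" using v h'(1) by blast
          from push[OF g this] show ?thesis unfolding eq using h'(2)[of v] v DV by auto
        qed
        then show "act n g v \<in> ?W" using Dst g v by auto
      qed
    qed
    then show ?thesis using v h by blast
  qed
  have scalar: "\<exists>a. \<forall>v\<in>D. (\<lambda>i. act n x v i - a * v i) \<in> A0" if x: "x \<in> H" for x
  proof -
    obtain a v1 where v1: "v1 \<in> D" "v1 \<notin> A0" "(\<lambda>i. act n x v1 i - a * v1 i) \<in> A0"
      using eigenvector_mod[OF v0(1,2) DV sD Dst[OF x] A0] by blast
    have a0: "a \<noteq> 0" using v1 notA[OF x v1(1,2)] by auto
    have xy: "(\<lambda>i. act n x (act n y v) i - \<chi> (x * y * \<iota> x * \<iota> y) * act n y (act n x v) i) \<in> A0"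
      if y: "y \<in> H" and v: "v \<in> D" for y v
    proof -
      have i: "\<iota> x \<in> H" "\<iota> y \<in> H" using HX(4) x y by auto
      have c: "x * y \<in> H" "x * y * \<iota> x \<in> H" using HX(3) x y i by auto
      have "x * y * \<iota> x * \<iota> y \<in> ?H" unfolding derived_def
        by (intro generate.incl derived_setI[OF x y HX(1)])
      moreover have "act n y (act n x v) \<in> D" using Dst x y v by blast
      moreover have "act n (x * y * \<iota> x * \<iota> y) (act n y (act n x v)) = act n x (act n y v)"
        using multH c i x y invH v DV by (simp add: subset_iff)
      ultimately show ?thesis using all_weight by metis
    qed
    have tot: "(\<lambda>i. act n x (act n y v) i - (\<chi> (x * y * \<iota> x * \<iota> y) * a) * act n y v i) \<in> A0"
      if "(\<lambda>i. act n x v i - a * v i) \<in> A0" "y \<in> H" "v \<in> D" for y v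
      using subsp_comb[OF A0 xy[OF that(2,3)] push[OF that(2,1)], of 1 "\<chi> (x * y * \<iota> x * \<iota> y)"]
      by (simp add: algebra_simps)
    have comm: "(\<lambda>i. act n x (act n y v1) i - a * act n y v1 i) \<in> A0" if y: "y \<in> H" for y
      by (rule const[OF x v1(1,2,3) _ y]) (use tot[OF v1(3) _ v1(1)] in blast)
    have \<chi>1: "\<chi> (x * y * \<iota> x * \<iota> y) = 1" if y: "y \<in> H" for y
    proof -
      have "\<chi> (x * y * \<iota> x * \<iota> y) * a = a"
        by (rule unique[OF tot[OF v1(3) y v1(1)] comm[OF y] notA[OF y v1(1,2)]])
      then show ?thesis using a0 by simp
    qed
    let ?E = "{v \<in> D. (\<lambda>i. act n x v i - a * v i) \<in> A0}"
    have "?E = D"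
    proof (rule whole[of _ v1])
      show "subsp ?E" unfolding subsp_def
      proof (intro conjI ballI allI)
        show "(\<lambda>_. 0) \<in> ?E" using subsp_zero[OF sD] subsp_zero[OF A0] by (simp add: act_zero)
        fix u w c d assume u: "u \<in> ?E" and w: "w \<in> ?E"
        have "(\<lambda>i. c * (act n x u i - a * u i) + d * (act n x w i - a * w i)) \<in> A0"
          using u w by (intro subsp_comb[OF A0]) auto
        then have "(\<lambda>i. act n x (\<lambda>i. c * u i + d * w i) i - a * (c * u i + d * w i)) \<in> A0"
          by (simp add: act_comb algebra_simps)
        then show "(\<lambda>i. c * u i + d * w i) \<in> ?E" using u w subsp_comb[OF sD] by auto
      qed
      show "A0 \<subseteq> ?E" using subsp_axpy[OF A0 A0st[OF x]] D by auto
      show "v1 \<in> ?E" "v1 \<notin> A0" "?E \<subseteq> D" using v1 by auto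
      show "stable n H ?E" unfolding stable_def
        using tot \<chi>1 Dst by auto
    qed
    then show ?thesis by blast
  qed
  then show ?case using v0 D by blast
qed

end

section \<open>Flags and triangular matrices\<close>

lemma act_image_ins: "act n A ` ins X v = ins (act n A ` X) (act n A v)"
proof -
  have "act n A (\<lambda>i. a i + c * v i) = (\<lambda>i. act n A a i + c * act n A v i)" for a c
    using act_comb[of n A 1 a c v] by simp
  note lin = this
  show ?thesis
  proof (intro equalityI subsetI)
    fix y assume "y \<in> act n A ` ins X v"
    then obtain a c where a: "a \<in> X" "y = act n A (\<lambda>i. a i + c * v i)" by (auto simp: ins_def)
    show "y \<in> ins (act n A ` X) (act n A v)"
      by (rule insI[OF imageI[OF a(1)]]) (simp only: a(2) lin)
  next
    fix y assume "y \<in> ins (act n A ` X) (act n A v)"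
    then obtain a c where a: "a \<in> X" "y = (\<lambda>i. act n A a i + c * act n A v i)" by (auto simp: ins_def)
    then have "y = act n A (\<lambda>i. a i + c * v i)" by (simp only: lin)
    then show "y \<in> act n A ` ins X v" using insI[OF a(1) refl] by blast
  qed
qed

lemma dm_act_step:
  assumes "subsp A0" "subsp X" "A0 \<subseteq> X" "X \<subseteq> V n"
  shows "dm (act n T ` X) + dm A0 \<le> dm (act n T ` A0) + dm X"
  using assms
proof (induction "dm X - dm A0" arbitrary: A0 rule: less_induct)
  case less
  show ?case
  proof (cases "A0 = X")
    case False
    then obtain v where v: "v \<in> X" "v \<notin> A0" using less.prems by blast
    have AV: "A0 \<subseteq> V n" and vV: "v \<in> V n" using less.prems v by auto
    have d: "dm (ins A0 v) = Suc (dm A0)" using dm_ins[OF less.prems(1) AV vV v(2)] .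
    have sub: "ins A0 v \<subseteq> X" using ins_least less.prems v by blast
    then have "Suc (dm A0) \<le> dm X" using dm_mono[OF sub less.prems(4)] d by simp
    then have "dm (act n T ` X) + dm (ins A0 v) \<le> dm (act n T ` ins A0 v) + dm X"
      by (intro less.hyps) (use d sub less.prems subsp_ins in auto)
    moreover have "dm (act n T ` ins A0 v) \<le> Suc (dm (act n T ` A0))"
      unfolding act_image_ins by (rule dm_ins_le[OF subsp_act_image[OF less.prems(1)]]) auto
    ultimately show ?thesis using d by linarith
  qed simp
qed

lemma dm_act_le:
  assumes X: "subsp X" "X \<subseteq> V n" shows "dm (act n T ` X) \<le> dm X"
proof -
  have "subsp {\<lambda>_. 0::complex}" by (auto simp: subsp_def)
  from dm_act_step[OF this X(1) _ X(2), of T] subsp_zero[OF X(1)]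
  show ?thesis by (simp add: act_zero dm_zero)
qed

lemma inv2_image_cancel:
  assumes "inv2 n T T'" "X \<subseteq> V n" shows "act n T' ` (act n T ` X) = X"
proof -
  have "(\<lambda>x. act n T' (act n T x)) ` X = (\<lambda>x. x) ` X"
    by (rule image_cong) (use inv2D(7)[OF assms(1)] assms(2) in auto)
  then show ?thesis by (simp add: image_image)
qed

lemma dm_act_inv2:
  assumes "inv2 n T T'" "subsp X" "X \<subseteq> V n" shows "dm (act n T ` X) = dm X"
proof (rule antisym)
  have "dm (act n T' ` (act n T ` X)) \<le> dm (act n T ` X)"
    by (rule dm_act_le[OF subsp_act_image[OF assms(2)]]) auto
  then show "dm X \<le> dm (act n T ` X)" by (simp add: inv2_image_cancel[OF assms(1,3)])
qed (rule dm_act_le[OF assms(2,3)])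

lemma invariant_image_eq:
  assumes "inv2 n T T'" "subsp X" "X \<subseteq> V n" "act n T ` X \<subseteq> X"
  shows "act n T ` X = X" "act n T' ` X = X"
proof -
  show 1: "act n T ` X = X"
    by (rule subsp_eqI[OF subsp_act_image[OF assms(2)] assms(2) assms(4) assms(3)])
       (simp add: dm_act_inv2[OF assms(1-3)])
  then show "act n T' ` X = X" using inv2_image_cancel[OF assms(1,3)] by simp
qed

lemma coord_Suc: "coord {..<Suc j} = ins (coord {..<j}) (unit j)"
proof
  show "coord {..<Suc j} \<subseteq> ins (coord {..<j}) (unit j)"
  proof
    fix x assume x: "x \<in> coord {..<Suc j}"
    show "x \<in> ins (coord {..<j}) (unit j)"
      by (rule insI[of "x(j := 0)" _ _ "x j"]) (use x in \<open>auto simp: coord_def unit_def fun_eq_iff\<close>)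
  qed
  show "ins (coord {..<j}) (unit j) \<subseteq> coord {..<Suc j}"
    by (rule ins_least[OF subsp_coord]) (auto simp: coord_def unit_def)
qed

definition full_flag :: "nat \<Rightarrow> (nat \<Rightarrow> (nat \<Rightarrow> complex) set) \<Rightarrow> bool" where
  "full_flag n F \<longleftrightarrow> (\<forall>j\<le>n. subsp (F j) \<and> F j \<subseteq> V n \<and> dm (F j) = j) \<and> (\<forall>j<n. F j \<subseteq> F (Suc j))"

lemma full_flagD:
  assumes "full_flag n F"
  shows "j \<le> n \<Longrightarrow> subsp (F j)" "j \<le> n \<Longrightarrow> F j \<subseteq> V n" "j \<le> n \<Longrightarrow> dm (F j) = j" "j < n \<Longrightarrow> F j \<subseteq> F (Suc j)"
    "F n = V n" "F 0 = {\<lambda>_. 0}" "i \<le> j \<Longrightarrow> j \<le> n \<Longrightarrow> F i \<subseteq> F j"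
proof -
  show F: "\<And>j. j \<le> n \<Longrightarrow> subsp (F j)" "\<And>j. j \<le> n \<Longrightarrow> F j \<subseteq> V n" "\<And>j. j \<le> n \<Longrightarrow> dm (F j) = j"
    "\<And>j. j < n \<Longrightarrow> F j \<subseteq> F (Suc j)" using assms by (auto simp: full_flag_def)
  show "F n = V n"
    by (rule subsp_eqI[OF F(1) subsp_coord F(2)]) (auto simp: F(3) dm_coord)
  have "subsp {\<lambda>_. 0::complex}" by (auto simp: subsp_def)
  from subsp_eqI[OF this F(1)[of 0] _ F(2)[of 0]] F(3)[of 0] subsp_zero[OF F(1)[of 0]]
  show "F 0 = {\<lambda>_. 0}" by simp
  show "i \<le> j \<Longrightarrow> j \<le> n \<Longrightarrow> F i \<subseteq> F j"
  proof (induction j)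
    case (Suc j)
    then show ?case using F(4)[of j] by (cases "i = Suc j") auto
  qed simp
qed

text \<open>The columns of \<open>f\<close> are vectors of \<open>F (j + 1)\<close> outside \<open>F j\<close>.\<close>

lemma flag_basis:
  assumes "full_flag n F"
  obtains f f' where "inv2 n f f'" "\<And>j. j \<le> n \<Longrightarrow> act n f ` coord {..<j} = F j"
proof -
  note F = full_flagD[OF assms]
  have "\<exists>e. e \<in> F (Suc j) \<and> e \<notin> F j" if "j < n" for j
  proof (rule ccontr)
    assume "\<not> ?thesis"
    then have "F j = F (Suc j)" using F(4)[OF that] by blast
    then show False using F(3)[of j] F(3)[of "Suc j"] that by simp
  qed
  then obtain e where e: "\<And>j. j < n \<Longrightarrow> e j \<in> F (Suc j)" "\<And>j. j < n \<Longrightarrow> e j \<notin> F j" by metis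
  have eV: "e j \<in> V n" if "j < n" for j using e(1)[OF that] F(2)[of "Suc j"] that by auto
  define f where "f = mat n n (\<lambda>(i, j). e j i)"
  have fu: "act n f (unit j) = e j" if "j < n" for j
    using that eV[OF that] by (auto simp: act_unit f_def coord_def)
  have im: "act n f ` coord {..<j} = F j" if "j \<le> n" for j
    using that
  proof (induction j)
    case 0
    have "coord {} = {\<lambda>_. 0}" by (auto simp: coord_def)
    then show ?case by (simp add: act_zero F(6))
  next
    case (Suc j)
    then have j: "j < n" by simp
    have "act n f ` coord {..<Suc j} = ins (F j) (e j)"
      unfolding coord_Suc act_image_ins fu[OF j] using Suc by simp
    also have "\<dots> = F (Suc j)"
    proof (rule subsp_eqI[where n = n, OF subsp_ins])
      show "ins (F j) (e j) \<subseteq> F (Suc j)" by (rule ins_least) (use F e j in auto)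
      show "dm (F (Suc j)) \<le> dm (ins (F j) (e j))"
        using dm_ins[of "F j" n "e j"] F e j eV by simp
    qed (use F j in auto)
    finally show ?case .
  qed
  have fC: "f \<in> carrier_mat n n" by (simp add: f_def)
  have surj: "act n f ` V n = V n" using im[of n] F(5) by simp
  have "\<exists>x. x \<in> V n \<and> act n f x = unit j" if "j < n" for j
    using surj unit_V[OF that] by (metis imageE)
  then obtain x where x: "\<And>j. j < n \<Longrightarrow> x j \<in> V n" "\<And>j. j < n \<Longrightarrow> act n f (x j) = unit j" by metis
  define f' where "f' = mat n n (\<lambda>(i, j). x j i)"
  have f'C: "f' \<in> carrier_mat n n" by (simp add: f'_def)
  have f'u: "act n f' (unit j) = x j" if "j < n" for j
    using that x(1)[OF that] by (auto simp: act_unit f'_def coord_def)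
  have "f * f' = 1\<^sub>m n"
  proof (rule eq_matI)
    fix i j assume ij: "i < dim_row (1\<^sub>m n)" "j < dim_col (1\<^sub>m n)"
    have "act n (f * f') (unit j) = unit j" using ij by (simp add: act_mult[OF fC f'C] f'u x)
    moreover have "act n (f * f') (unit j) i = (f * f') $$ (i, j)" using ij by (simp add: act_unit)
    ultimately show "(f * f') $$ (i, j) = 1\<^sub>m n $$ (i, j)" using ij by (simp add: unit_def)
  qed (use fC f'C in auto)
  then have "inv2 n f f'" using fC f'C mat_mult_left_right_inverse[OF fC f'C] by (simp add: inv2_def)
  then show thesis using that im by blast
qed

definition upper :: "nat \<Rightarrow> complex mat \<Rightarrow> bool" where
  "upper n t \<longleftrightarrow> (\<forall>i<n. \<forall>j<i. t $$ (i, j) = 0)"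

lemma upper_iff: "upper n t \<longleftrightarrow> (\<forall>j\<le>n. act n t ` coord {..<j} \<subseteq> coord {..<j})"
proof -
  have "upper n t \<longleftrightarrow> (\<forall>k\<le>n. \<forall>i j. k \<le> i \<and> i < n \<and> j < k \<longrightarrow> t $$ (i, j) = 0)"
  proof
    assume "upper n t"
    then show "\<forall>k\<le>n. \<forall>i j. k \<le> i \<and> i < n \<and> j < k \<longrightarrow> t $$ (i, j) = 0" by (auto simp: upper_def)
  next
    assume *: "\<forall>k\<le>n. \<forall>i j. k \<le> i \<and> i < n \<and> j < k \<longrightarrow> t $$ (i, j) = 0"
    show "upper n t" unfolding upper_def
    proof (intro allI impI)
      fix i j assume "i < n" "j < i"
      then show "t $$ (i, j) = 0" using *[rule_format, of i i j] by simp
    qed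
  qed
  then show ?thesis by (simp add: coord_stable_iff)
qed

lemma upper_conj_iff:
  assumes f: "inv2 n f f'" and g: "g \<in> carrier_mat n n"
  shows "upper n (f' * g * f) \<longleftrightarrow> (\<forall>j\<le>n. act n g ` (act n f ` coord {..<j}) \<subseteq> act n f ` coord {..<j})"
proof -
  note C = inv2D(1,2)[OF f]
  have a: "act n (f' * g * f) x = act n f' (act n g (act n f x))" for x
    using C g by (simp add: act_mult)
  have "act n (f' * g * f) ` coord {..<j} \<subseteq> coord {..<j}
      \<longleftrightarrow> act n g ` (act n f ` coord {..<j}) \<subseteq> act n f ` coord {..<j}" if "j \<le> n" for j
  proof -
    let ?E = "coord {..<j}"
    have EV: "?E \<subseteq> V n" using that by (auto simp: coord_def)
    have im: "act n (f' * g * f) ` ?E = act n f' ` (act n g ` (act n f ` ?E))" by (simp add: image_image a)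
    have 1: "act n f ` (act n f' ` Y) = Y" if "Y \<subseteq> V n" for Y
      by (rule inv2_image_cancel[OF inv2D(5)[OF f] that])
    have 2: "act n f' ` (act n f ` ?E) = ?E" by (rule inv2_image_cancel[OF f EV])
    have gV: "act n g ` (act n f ` ?E) \<subseteq> V n" by auto
    show ?thesis unfolding im using 1[OF gV] 2 by (metis image_mono)
  qed
  then show ?thesis by (simp add: upper_iff)
qed

section \<open>Solvability of flag stabilizers\<close>

definition fstab :: "nat \<Rightarrow> complex mat set \<Rightarrow> (nat \<Rightarrow> (nat \<Rightarrow> complex) set) \<Rightarrow> complex mat set" where
  "fstab n X F = {g \<in> X. \<forall>j\<le>n. act n g ` F j \<subseteq> F j}"

context regular_group begin

lemma derived_power_consistent:
  assumes U: "subgroup U G"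
  shows "(derived (G\<lparr>carrier := U\<rparr>) ^^ k) U = (derived G ^^ k) U \<and> (derived G ^^ k) U \<subseteq> U"
proof (induction k)
  case (Suc k)
  have "derived (G\<lparr>carrier := U\<rparr>) ((derived G ^^ k) U) = derived G ((derived G ^^ k) U)"
    using derived_consistent[OF _ U] Suc by blast
  moreover have "derived G ((derived G ^^ k) U) \<subseteq> U" using derived_incl[OF _ U] Suc by blast
  ultimately show ?case using Suc by simp
qed simp

lemma solvable_iff_derived:
  assumes U: "subgroup U G"
  shows "solvable (G\<lparr>carrier := U\<rparr>) \<longleftrightarrow> (\<exists>k. (derived G ^^ k) U = {1\<^sub>m n})"
proof -
  interpret U: group "G\<lparr>carrier := U\<rparr>" using subgroup_imp_group[OF U] .
  show ?thesis using U.solvable_iff_trivial_derived_seq derived_power_consistent[OF U] by simp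
qed

lemma iota_act: "g \<in> X \<Longrightarrow> x \<in> V n \<Longrightarrow> act n (\<iota> g) (act n g x) = x"
  "g \<in> X \<Longrightarrow> x \<in> V n \<Longrightarrow> act n g (act n (\<iota> g) x) = x"
  using inv2D(6,7)[OF inv_props(4)] by auto

lemma subgroupI':
  assumes "U \<subseteq> X" "1\<^sub>m n \<in> U" "\<And>g h. g \<in> U \<Longrightarrow> h \<in> U \<Longrightarrow> g * h \<in> U" "\<And>g. g \<in> U \<Longrightarrow> \<iota> g \<in> U"
  shows "subgroup U G"
proof (rule subgroupI)
  show "U \<subseteq> carrier G" "U \<noteq> {}" using assms by auto
  show "\<And>a. a \<in> U \<Longrightarrow> inv\<^bsub>G\<^esub> a \<in> U" using X_inv assms(1,4) by (simp add: subset_iff)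
  show "\<And>a b. a \<in> U \<Longrightarrow> b \<in> U \<Longrightarrow> a \<otimes>\<^bsub>G\<^esub> b \<in> U" using assms(3) by simp
qed

lemma act_prod: "g \<in> X \<Longrightarrow> h \<in> X \<Longrightarrow> act n (g * h) x = act n g (act n h x)"
  using act_mult X_carrier by blast

lemma one_X: "1\<^sub>m n \<in> X" using one_closed by simp

lemma mult_X: "g \<in> X \<Longrightarrow> h \<in> X \<Longrightarrow> g * h \<in> X" using m_closed by simp

lemma fstab_image:
  assumes F: "full_flag n F" and g: "g \<in> fstab n X F" and j: "j \<le> n"
  shows "act n g ` F j = F j" "act n (\<iota> g) ` F j = F j"
  using invariant_image_eq[OF inv_props(4) full_flagD(1,2)[OF F j], of g] g j by (auto simp: fstab_def)

lemma fstab_mem: "g \<in> fstab n X F \<Longrightarrow> j \<le> n \<Longrightarrow> x \<in> F j \<Longrightarrow> act n g x \<in> F j"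
  by (auto simp: fstab_def)

lemma fstab_subgroup:
  assumes F: "full_flag n F" shows "subgroup (fstab n X F) G"
proof (rule subgroupI')
  show "1\<^sub>m n \<in> fstab n X F"
    using one_X full_flagD(2)[OF F] act_one unfolding fstab_def by (auto simp: subset_iff)
  show "g * h \<in> fstab n X F" if "g \<in> fstab n X F" "h \<in> fstab n X F" for g h
    using that mult_X unfolding fstab_def by (auto simp: act_prod) blast
  show "\<iota> g \<in> fstab n X F" if "g \<in> fstab n X F" for g
    using fstab_image(2)[OF F that] that inv_props(1) by (auto simp: fstab_def)
qed (auto simp: fstab_def)

text \<open>The elements that differ from the identity by a map lowering the flag by \<open>k\<close> steps; for
  \<open>k = 1\<close> these are the unipotent ones. The truncated subtraction makes \<open>F (j - k)\<close> the zero space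
  for \<open>k \<ge> j\<close>.\<close>

definition funip :: "(nat \<Rightarrow> (nat \<Rightarrow> complex) set) \<Rightarrow> nat \<Rightarrow> complex mat set" where
  "funip F k = {g \<in> fstab n X F. \<forall>j\<le>n. \<forall>x\<in>F j. (\<lambda>i. act n g x i - x i) \<in> F (j - k)}"

lemma funip_subgroup:
  assumes F: "full_flag n F" shows "subgroup (funip F k) G"
proof -
  note FD = full_flagD[OF F]
  note S = subgroup_props[OF fstab_subgroup[OF F]]
  have sF: "\<And>j. j \<le> n \<Longrightarrow> subsp (F (j - k))" using FD(1) by auto
  show ?thesis
  proof (rule subgroupI')
    show "funip F k \<subseteq> X" using S(1) by (auto simp: funip_def)
    have "(\<lambda>i. act n (1\<^sub>m n) x i - x i) \<in> F (j - k)" if "j \<le> n" "x \<in> F j" for j x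
      using subsp_zero[OF sF[OF that(1)]] act_one[of x n] FD(2)[OF that(1)] that(2) by auto
    then show "1\<^sub>m n \<in> funip F k" using S(2) by (auto simp: funip_def)
    show "g * h \<in> funip F k" if g: "g \<in> funip F k" and h: "h \<in> funip F k" for g h
    proof -
      have gh: "g \<in> fstab n X F" "h \<in> fstab n X F" using g h by (auto simp: funip_def)
      have "(\<lambda>i. act n (g * h) x i - x i) \<in> F (j - k)" if j: "j \<le> n" "x \<in> F j" for j x
      proof -
        have hx: "act n h x \<in> F j" using fstab_mem[OF gh(2)] j by blast
        have "(\<lambda>i. (act n g (act n h x) i - act n h x i) + (act n h x i - x i)) \<in> F (j - k)"
          using subsp_add[OF sF[OF j(1)]] g h hx j unfolding funip_def by blast
        then show ?thesis using act_prod gh S(1) by (simp add: subset_iff)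
      qed
      then show ?thesis using S(3) gh by (auto simp: funip_def)
    qed
    show "\<iota> g \<in> funip F k" if g: "g \<in> funip F k" for g
    proof -
      have gf: "g \<in> fstab n X F" "\<iota> g \<in> fstab n X F" using g S(4) by (auto simp: funip_def)
      have "(\<lambda>i. act n (\<iota> g) x i - x i) \<in> F (j - k)" if j: "j \<le> n" "x \<in> F j" for j x
      proof -
        let ?y = "act n (\<iota> g) x"
        have y: "?y \<in> F j" using fstab_mem[OF gf(2)] j by blast
        have "act n g ?y = x" using iota_act(2)[of g x] gf S(1) FD(2)[OF j(1)] j(2) by blast
        then have "(\<lambda>i. x i - ?y i) \<in> F (j - k)" using g y j(1) unfolding funip_def by fastforce
        from subsp_scale[OF sF[OF j(1)] this, of "-1"] show ?thesis by simp
      qed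
      then show ?thesis using gf by (auto simp: funip_def)
    qed
  qed
qed

text \<open>By
  \<open>g h g\<^sup>-\<^sup>1 h\<^sup>-\<^sup>1 - 1 = (g h - h g) g\<^sup>-\<^sup>1 h\<^sup>-\<^sup>1\<close>.\<close>

lemma commutator_funip:
  assumes F: "full_flag n F"
    and g: "g \<in> fstab n X F" and h: "h \<in> fstab n X F"
    and diff: "\<And>j x. j \<le> n \<Longrightarrow> x \<in> F j \<Longrightarrow> (\<lambda>i. act n g (act n h x) i - act n h (act n g x) i) \<in> F (j - k)"
  shows "g * h * \<iota> g * \<iota> h \<in> funip F k"
proof -
  note FD = full_flagD[OF F]
  note S = subgroup_props[OF fstab_subgroup[OF F]]
  have i: "\<iota> g \<in> fstab n X F" "\<iota> h \<in> fstab n X F" using S(4) g h by auto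
  have c: "g * h \<in> fstab n X F" "g * h * \<iota> g \<in> fstab n X F" "g * h * \<iota> g * \<iota> h \<in> fstab n X F"
    using S(3) g h i by auto
  have "(\<lambda>l. act n (g * h * \<iota> g * \<iota> h) x l - x l) \<in> F (j - k)" if j: "j \<le> n" "x \<in> F j" for j x
  proof -
    let ?y = "act n (\<iota> g) (act n (\<iota> h) x)"
    have hx: "act n (\<iota> h) x \<in> F j" using fstab_mem[OF i(2) j] .
    have y: "?y \<in> F j" using fstab_mem[OF i(1) j(1) hx] .
    have x: "x \<in> V n" "act n (\<iota> h) x \<in> V n" using FD(2)[OF j(1)] j hx by auto
    have "act n (g * h * \<iota> g * \<iota> h) x = act n g (act n h ?y)"
      using act_prod c i g h S(1) by (simp add: subset_iff)
    moreover have "act n h (act n g ?y) = x" using iota_act(2) g h S(1) x by (simp add: subset_iff)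
    ultimately show ?thesis using diff[OF j(1) y] by simp
  qed
  then show ?thesis using c by (auto simp: funip_def)
qed

text \<open>Elements of the stabilizer act by scalars on the lines \<open>F j / F (j - 1)\<close>, so \<open>g h - h g\<close>
  lowers the flag. If \<open>g - 1\<close> and \<open>h - 1\<close> lower it by \<open>l\<close> steps, then
  \<open>g h - h g = (g - 1) (h - 1) - (h - 1) (g - 1)\<close> lowers it by \<open>2 l\<close>, which is at least \<open>l + 1\<close>
  for \<open>l \<ge> 1\<close>.\<close>

lemma fstab_solvable:
  assumes F: "full_flag n F"
  shows "solvable (G\<lparr>carrier := fstab n X F\<rparr>)"
proof -
  note FD = full_flagD[OF F]
  let ?U = "fstab n X F"
  note S = subgroup_props[OF fstab_subgroup[OF F]]
  have step0: "derived G ?U \<subseteq> funip F 1" unfolding derived_def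
  proof (rule generate_subgroup_incl[OF _ funip_subgroup[OF F]], rule subsetI)
    fix c assume c: "c \<in> derived_set G ?U"
    obtain g h where gh: "g \<in> ?U" "h \<in> ?U" "c = g * h * \<iota> g * \<iota> h" by (rule derived_setE[OF c S(1)])
    have "(\<lambda>i. act n g (act n h x) i - act n h (act n g x) i) \<in> F (j - 1)" if j: "j \<le> n" "x \<in> F j" for j x
    proof (cases "j = 0")
      case True
      then show ?thesis using j FD(6) by (simp add: act_zero)
    next
      case False
      let ?A = "F (j - 1)"
      have sA: "subsp ?A" "?A \<subseteq> V n" "?A \<subseteq> F j" "j - 1 \<le> n" using FD(1,2) FD(7)[of "j - 1" j] j by auto
      have "?A \<noteq> F j" using FD(3)[OF sA(4)] FD(3)[OF j(1)] False by auto
      then obtain e where e: "e \<in> F j" "e \<notin> ?A" using sA by blast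
      have ins: "F j = ins ?A e"
        by (rule sym, rule subsp_eqI[where n = n, OF subsp_ins[OF sA(1)] FD(1)[OF j(1)]])
           (use ins_least[OF FD(1)[OF j(1)] sA(3) e(1)] FD(2,3)[OF j(1)] FD(3)[of "j - 1"]
              dm_ins[OF sA(1,2) _ e(2)] e j False in auto)
      have scal: "\<exists>c. \<forall>x\<in>F j. (\<lambda>i. act n g x i - c * x i) \<in> ?A" if g: "g \<in> ?U" for g
      proof -
        have "act n g e \<in> F j" using fstab_mem[OF g j(1) e(1)] .
        then obtain a c where ac: "a \<in> ?A" "act n g e = (\<lambda>i. a i + c * e i)" unfolding ins by (auto simp: ins_def)
        have "(\<lambda>i. act n g x i - c * x i) \<in> ?A" if "x \<in> F j" for x
        proof -
          obtain b t where b: "b \<in> ?A" "x = (\<lambda>i. b i + t * e i)" using \<open>x \<in> F j\<close> unfolding ins by (auto simp: ins_def)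
          have gb: "act n g b \<in> ?A" using fstab_mem[OF g sA(4) b(1)] .
          have "act n g x = (\<lambda>i. act n g b i + t * act n g e i)"
            using act_comb[of n g 1 b t e] by (simp add: b(2))
          then have "(\<lambda>i. act n g x i - c * x i) = (\<lambda>i. 1 * (1 * act n g b i + (- c) * b i) + t * a i)"
            by (auto simp: b(2) ac(2) algebra_simps)
          then show ?thesis using subsp_comb[OF sA(1) subsp_comb[OF sA(1) gb b(1)] ac(1)] by metis
        qed
        then show ?thesis by blast
      qed
      obtain c where c: "\<And>x. x \<in> F j \<Longrightarrow> (\<lambda>i. act n g x i - c * x i) \<in> ?A" using scal[OF gh(1)] by blast
      obtain d where d: "\<And>x. x \<in> F j \<Longrightarrow> (\<lambda>i. act n h x i - d * x i) \<in> ?A" using scal[OF gh(2)] by blast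
      have hx: "act n h x \<in> F j" "act n g x \<in> F j" using fstab_mem gh j by auto
      let ?p = "\<lambda>i. act n g (act n h x) i - c * act n h x i" and ?q = "\<lambda>i. act n h x i - d * x i"
        and ?r = "\<lambda>i. act n h (act n g x) i - d * act n g x i" and ?s = "\<lambda>i. act n g x i - c * x i"
      have "(\<lambda>i. 1 * (1 * ?p i + c * ?q i) + (- 1) * (1 * ?r i + d * ?s i)) \<in> ?A"
        by (intro subsp_comb[OF sA(1)] c d hx j(2))
      then show ?thesis by (simp add: algebra_simps)
    qed
    then show "c \<in> funip F 1" unfolding gh(3) by (intro commutator_funip[OF F gh(1,2)])
  qed
  have step: "derived G (funip F (Suc k)) \<subseteq> funip F (Suc (Suc k))" for k unfolding derived_def
  proof (rule generate_subgroup_incl[OF _ funip_subgroup[OF F]], rule subsetI)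
    note T = subgroup_props[OF funip_subgroup[OF F, of "Suc k"]]
    fix c assume c: "c \<in> derived_set G (funip F (Suc k))"
    obtain g h where gh: "g \<in> funip F (Suc k)" "h \<in> funip F (Suc k)" "c = g * h * \<iota> g * \<iota> h"
      by (rule derived_setE[OF c T(1)])
    have ghU: "g \<in> ?U" "h \<in> ?U" using gh by (auto simp: funip_def)
    have low: "(\<lambda>i. act n x u i - u i) \<in> F (j - Suc k)" if "x = g \<or> x = h" "j \<le> n" "u \<in> F j" for x u j
      using that gh(1,2) by (auto simp: funip_def)
    have "(\<lambda>i. act n g (act n h x) i - act n h (act n g x) i) \<in> F (j - Suc (Suc k))" if j: "j \<le> n" "x \<in> F j" for j x
    proof -
      let ?u = "\<lambda>i. act n h x i - x i" and ?v = "\<lambda>i. act n g x i - x i"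
      let ?l = "j - Suc k - Suc k"
      have uv: "?u \<in> F (j - Suc k)" "?v \<in> F (j - Suc k)" using low j by blast+
      have l: "?l \<le> j - Suc (Suc k)" "j - Suc (Suc k) \<le> n" "?l \<le> n" using j by auto
      have "(\<lambda>i. act n g ?u i - ?u i) \<in> F ?l" "(\<lambda>i. act n h ?v i - ?v i) \<in> F ?l"
        using low[of g "j - Suc k" ?u] low[of h "j - Suc k" ?v] uv j by auto
      then have "(\<lambda>i. (act n g ?u i - ?u i) - (act n h ?v i - ?v i)) \<in> F ?l"
        by (rule subsp_diff[OF FD(1)[OF l(3)]])
      moreover have "(\<lambda>i. (act n g ?u i - ?u i) - (act n h ?v i - ?v i))
          = (\<lambda>i. act n g (act n h x) i - act n h (act n g x) i)" by (simp add: act_diff algebra_simps)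
      ultimately show ?thesis using FD(7)[OF l(1,2)] by auto
    qed
    then show "c \<in> funip F (Suc (Suc k))" unfolding gh(3) by (intro commutator_funip[OF F ghU])
  qed
  have all: "(derived G ^^ Suc k) ?U \<subseteq> funip F (Suc k)" for k
  proof (induction k)
    case 0 then show ?case using step0 by simp
  next
    case (Suc k)
    have "derived G ((derived G ^^ Suc k) ?U) \<subseteq> derived G (funip F (Suc k))" by (rule mono_derived[OF Suc])
    then show ?case using step by (simp, blast)
  qed
  have "funip F (Suc n) \<subseteq> {1\<^sub>m n}"
  proof
    fix g assume g: "g \<in> funip F (Suc n)"
    then have gX: "g \<in> X" using S(1) by (auto simp: funip_def)
    have "act n g x = act n (1\<^sub>m n) x" if "x \<in> V n" for x
    proof -
      have "(\<lambda>i. act n g x i - x i) \<in> F (n - Suc n)" using g that FD(5) unfolding funip_def by blast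
      then have "act n g x i - x i = 0" for i using FD(6) by (simp add: fun_eq_iff)
      then show ?thesis using that by (auto simp: act_one)
    qed
    then have "g = 1\<^sub>m n" by (intro act_eqI) (use gX X_carrier in auto)
    then show "g \<in> {1\<^sub>m n}" by simp
  qed
  then have "(derived G ^^ Suc n) ?U \<subseteq> {1\<^sub>m n}" using all by blast
  moreover have "1\<^sub>m n \<in> (derived G ^^ Suc n) ?U"
    using subgroup_props(2)[OF exp_of_derived_is_subgroup[OF fstab_subgroup[OF F]]] .
  ultimately show ?thesis using solvable_iff_derived[OF fstab_subgroup[OF F]] by blast
qed

end

text \<open>Preimages of Zariski open sets under a continuous path are open, because polynomials are
  continuous in the usual sense.\<close>

lemma connectedin_path:
  assumes C: "\<And>s. s \<in> {0..1::real} \<Longrightarrow> \<gamma> s \<in> carrier_mat n n"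
    and cont: "\<And>i j. i < n \<Longrightarrow> j < n \<Longrightarrow> continuous_on {0..1} (\<lambda>s. \<gamma> s $$ (i, j))"
  shows "connectedin (zariski n) (\<gamma> ` {0..1})"
proof (rule connectedin_continuous_map_image)
  show "continuous_map (top_of_set {0..1}) (zariski n) \<gamma>"
  proof (rule continuous_map_into_zariski)
    fix f assume "f \<in> mat_polyfun n"
    then have "continuous_on {0..1} (\<lambda>s. f (\<gamma> s))"
      by induction (auto intro: continuous_intros cont)
    from continuous_openin_preimage_gen[OF this, of "- {0}"]
    have "openin (top_of_set {0..1}) ({0..1} \<inter> (\<lambda>s. f (\<gamma> s)) -` (- {0}))" by (simp add: open_Compl)
    moreover have "{0..1} \<inter> (\<lambda>s. f (\<gamma> s)) -` (- {0}) = {x \<in> topspace (top_of_set {0..1}). f (\<gamma> x) \<noteq> 0}" by auto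
    ultimately show "openin (top_of_set {0..1}) {x \<in> topspace (top_of_set {0..1}). f (\<gamma> x) \<noteq> 0}" by simp
  qed (use C in auto)
  show "connectedin (top_of_set {0..1::real}) {0..1}" by simp
qed

section \<open>Isometry groups and the connectedness of their triangular subgroups\<close>

text \<open>The switch \<open>d\<close> demands determinant 1. The zero form is allowed; with determinant 1 it gives
  the special linear group, which is thereby treated together with the isometry groups of
  nondegenerate forms.\<close>

definition isom :: "nat \<Rightarrow> complex mat \<Rightarrow> bool \<Rightarrow> complex mat set" where
  "isom n S d = {g \<in> carrier_mat n n. transpose_mat g * S * g = S \<and> (d \<longrightarrow> det g = 1)}"

lemma gram_frm:
  assumes "A \<in> carrier_mat n n" "S \<in> carrier_mat n n"
  shows "frm n (transpose_mat A * S * A) x y = frm n S (act n A x) (act n A y)"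
proof -
  have "frm n (transpose_mat A * S * A) x y = frm n (transpose_mat A * S) x (act n A y)"
    by (rule frm_act_right[symmetric]) (use assms in auto)
  also have "\<dots> = frm n S (act n A x) (act n A y)"
    by (rule frm_act_left[symmetric]) (use assms in auto)
  finally show ?thesis .
qed

lemma gram_entry:
  fixes A S :: "complex mat"
  assumes "A \<in> carrier_mat n n" "S \<in> carrier_mat n n" "i < n" "j < n"
  shows "(transpose_mat A * S * A) $$ (i, j) = (\<Sum>k<n. \<Sum>l<n. A $$ (k, i) * S $$ (k, l) * A $$ (l, j))"
proof -
  have "(transpose_mat A * S * A) $$ (i, j) = frm n S (act n A (unit i)) (act n A (unit j))"
    using frm_unit_unit[OF assms(3,4), of "transpose_mat A * S * A"] gram_frm[OF assms(1,2)] by simp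
  then show ?thesis using assms by (simp add: frm_sum act_unit)
qed

lemma gram_eqI:
  assumes "A \<in> carrier_mat n n" "S \<in> carrier_mat n n" "B \<in> carrier_mat n n"
    and "\<And>x y. x \<in> V n \<Longrightarrow> y \<in> V n \<Longrightarrow> frm n S (act n A x) (act n A y) = frm n B x y"
  shows "transpose_mat A * S * A = B"
  by (rule frm_eqI) (use assms gram_frm in auto)

lemma isom_frm:
  assumes "g \<in> isom n S d" "S \<in> carrier_mat n n"
  shows "frm n S (act n g x) (act n g y) = frm n S x y"
  using gram_frm[of g n S x y] assms by (auto simp: isom_def)

lemma regular_groupI:
  assumes X: "X \<subseteq> carrier_mat n n" "1\<^sub>m n \<in> X" "\<And>A B. A \<in> X \<Longrightarrow> B \<in> X \<Longrightarrow> A * B \<in> X"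
    and i: "\<And>A. A \<in> X \<Longrightarrow> \<iota> A \<in> X \<and> \<iota> A * A = 1\<^sub>m n" and r: "regm n \<iota>"
  shows "regular_group n X \<iota>"
proof -
  have C: "A \<in> carrier_mat n n" if "A \<in> X" for A using X(1) that by blast
  have grp: "group (mat_group n X)"
  proof (rule groupI)
    show "\<And>x y z. x \<in> carrier (mat_group n X) \<Longrightarrow> y \<in> carrier (mat_group n X) \<Longrightarrow> z \<in> carrier (mat_group n X) \<Longrightarrow>
       x \<otimes>\<^bsub>mat_group n X\<^esub> y \<otimes>\<^bsub>mat_group n X\<^esub> z = x \<otimes>\<^bsub>mat_group n X\<^esub> (y \<otimes>\<^bsub>mat_group n X\<^esub> z)"
      using C by (simp add: mat_group_def assoc_mult_mat[of _ n n _ n _ n])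
    show "\<And>x. x \<in> carrier (mat_group n X) \<Longrightarrow> \<exists>y\<in>carrier (mat_group n X). y \<otimes>\<^bsub>mat_group n X\<^esub> x = \<one>\<^bsub>mat_group n X\<^esub>"
      using i by (auto simp: mat_group_def)
    show "\<And>x. x \<in> carrier (mat_group n X) \<Longrightarrow> \<one>\<^bsub>mat_group n X\<^esub> \<otimes>\<^bsub>mat_group n X\<^esub> x = x"
      using left_mult_one_mat[OF C] by (simp add: mat_group_def)
  qed (use X in \<open>auto simp: mat_group_def\<close>)
  have inv: "inv\<^bsub>mat_group n X\<^esub> A = \<iota> A" if "A \<in> X" for A
    by (rule group.inv_equality[OF grp]) (use i[OF that] that in \<open>auto simp: mat_group_def\<close>)
  show ?thesis by (intro regular_group.intro X(1) grp inv r)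
qed

lemma isom_one: "S \<in> carrier_mat n n \<Longrightarrow> 1\<^sub>m n \<in> isom n S d"
  by (simp add: isom_def)

lemma isom_mult:
  assumes S: "S \<in> carrier_mat n n" and "A \<in> isom n S d" "B \<in> isom n S d"
  shows "A * B \<in> isom n S d"
proof -
  have C: "A \<in> carrier_mat n n" "B \<in> carrier_mat n n" using assms by (auto simp: isom_def)
  have "transpose_mat (A * B) * S * (A * B) = S"
    by (rule gram_eqI) (use C S isom_frm[OF assms(2) S] isom_frm[OF assms(3) S] in \<open>auto simp: act_mult\<close>)
  then show ?thesis using assms C det_mult[OF C] by (auto simp: isom_def)
qed

lemma isom_inverse:
  assumes S: "S \<in> carrier_mat n n" and A: "A \<in> isom n S d" and i: "inv2 n A A'"
  shows "A' \<in> isom n S d"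
proof -
  note C = inv2D(1,2)[OF i]
  have "transpose_mat A' * S * A' = S"
  proof (rule gram_eqI[OF C(2) S S])
    fix x y assume "x \<in> V n" "y \<in> V n"
    then show "frm n S (act n A' x) (act n A' y) = frm n S x y"
      using isom_frm[OF A S, of "act n A' x" "act n A' y"] inv2D(6)[OF i] by simp
  qed
  moreover have "det A * det A' = 1" using det_mult[OF C] inv2D(3)[OF i] by simp
  ultimately show ?thesis using A C by (auto simp: isom_def)
qed

lemma regular_isom_form:
  assumes S: "inv2 n S S'"
  shows "regular_group n (isom n S d) (\<lambda>A. S' * (transpose_mat A * S))"
proof (rule regular_groupI)
  note C = inv2D(1,2)[OF S]
  fix A assume A: "A \<in> isom n S d"
  then have AC: "A \<in> carrier_mat n n" by (auto simp: isom_def)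
  let ?B = "S' * (transpose_mat A * S)"
  have BC: "?B \<in> carrier_mat n n" using C AC by auto
  have "?B * A = S' * (transpose_mat A * S * A)" using C AC by (simp add: assoc_mult_mat[of _ n n _ n _ n])
  then have BA: "?B * A = 1\<^sub>m n" using A inv2D(4)[OF S] by (simp add: isom_def)
  then have "inv2 n A ?B" using AC BC mat_mult_left_right_inverse[OF BC AC] by (simp add: inv2_def)
  then show "?B \<in> isom n S d \<and> ?B * A = 1\<^sub>m n" using isom_inverse[OF C(1) A] BA by blast
next
  note C = inv2D(1,2)[OF S]
  show "isom n S d \<subseteq> carrier_mat n n" by (auto simp: isom_def)
  show "1\<^sub>m n \<in> isom n S d" by (rule isom_one[OF C(1)])
  show "\<And>A B. A \<in> isom n S d \<Longrightarrow> B \<in> isom n S d \<Longrightarrow> A * B \<in> isom n S d" by (rule isom_mult[OF C(1)])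
  show "regm n (\<lambda>A. S' * (transpose_mat A * S))" by (intro regm_mult regm_const regm_transpose C)
qed

lemma regular_isom_SL: "regular_group n (isom n (0\<^sub>m n n) True) adj_mat"
proof (rule regular_groupI)
  fix A assume A: "A \<in> isom n (0\<^sub>m n n) True"
  then have AC: "A \<in> carrier_mat n n" "det A = 1" by (auto simp: isom_def)
  have "inv2 n A (adj_mat A)" using adj_mat[OF AC(1)] AC by (auto simp: inv2_def)
  then show "adj_mat A \<in> isom n (0\<^sub>m n n) True \<and> adj_mat A * A = 1\<^sub>m n"
    using isom_inverse[OF _ A] inv2D(4) by auto
next
  show "isom n (0\<^sub>m n n) True \<subseteq> carrier_mat n n" by (auto simp: isom_def)
  show "1\<^sub>m n \<in> isom n (0\<^sub>m n n) True" by (rule isom_one) simp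
  show "\<And>A B. A \<in> isom n (0\<^sub>m n n) True \<Longrightarrow> B \<in> isom n (0\<^sub>m n n) True \<Longrightarrow> A * B \<in> isom n (0\<^sub>m n n) True"
    by (rule isom_mult) simp
qed (rule regm_adj)

lemma mat_eq_iff_entries:
  fixes A B :: "complex mat"
  assumes "A \<in> carrier_mat n n" "B \<in> carrier_mat n n"
  shows "A = B \<longleftrightarrow> (\<forall>p\<in>{..<n} \<times> {..<n}. A $$ p - B $$ p = 0)"
  using assms by (auto intro!: eq_matI)

lemma isom_closed:
  assumes S: "S \<in> carrier_mat n n"
  shows "closedin (zariski n) (isom n S d)"
proof -
  have r: "regm n (\<lambda>A. transpose_mat A * S * A)"
    by (intro regm_mult regm_transpose regm_const regm_id S)
  have rp: "regf n (\<lambda>A. (transpose_mat A * S * A) $$ p - S $$ p)" if "p \<in> {..<n} \<times> {..<n}" for p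
    using r that by (cases p) (auto simp: regm_def intro!: regf_diff)
  let ?E = "{A \<in> carrier_mat n n. \<forall>p\<in>{..<n} \<times> {..<n}. (transpose_mat A * S * A) $$ p - S $$ p = 0}"
  have 1: "closedin (zariski n) ?E" by (rule closedin_zeros[OF rp])
  have "closedin (zariski n) {A \<in> carrier_mat n n. \<forall>i\<in>{()}. det A - 1 = 0}"
    by (intro closedin_zeros regf_diff regf_const regf_det[where m = n]) auto
  then have 2: "closedin (zariski n) (if d then {A \<in> carrier_mat n n. det A = 1} else carrier_mat n n)"
    using closedin_topspace[of "zariski n"] by simp
  have "isom n S d = ?E \<inter> (if d then {A \<in> carrier_mat n n. det A = 1} else carrier_mat n n)"
  proof (intro Set.set_eqI)
    fix A
    have "transpose_mat A * S * A = S \<longleftrightarrow> (\<forall>p\<in>{..<n} \<times> {..<n}. (transpose_mat A * S * A) $$ p - S $$ p = 0)"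
      if "A \<in> carrier_mat n n" by (rule mat_eq_iff_entries) (use S that in auto)
    then show "A \<in> isom n S d \<longleftrightarrow> A \<in> ?E \<inter> (if d then {A \<in> carrier_mat n n. det A = 1} else carrier_mat n n)"
      by (auto simp: isom_def)
  qed
  then show ?thesis using closedin_Int[OF 1 2] by simp
qed

lemma stabilizer_closed:
  assumes f: "inv2 n f f'" and X: "closedin (zariski n) X"
    and J: "\<And>i j. (i, j) \<in> J \<Longrightarrow> i < n \<and> j < n"
  shows "closedin (zariski n) {g \<in> X. \<forall>(i, j)\<in>J. (f' * g * f) $$ (i, j) = 0}"
proof -
  note C = inv2D(1,2)[OF f]
  have r: "regm n (\<lambda>A. f' * A * f)" by (intro regm_mult regm_const regm_id C)
  have "closedin (zariski n) {A \<in> carrier_mat n n. \<forall>p\<in>J. (f' * A * f) $$ p = 0}"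
    by (rule closedin_zeros) (use r J in \<open>auto simp: regm_def\<close>)
  from closedin_Int[OF X this] have "closedin (zariski n) (X \<inter> {A \<in> carrier_mat n n. \<forall>p\<in>J. (f' * A * f) $$ p = 0})" .
  moreover have "X \<subseteq> carrier_mat n n" using closedin_subset[OF X] by simp
  then have "X \<inter> {A \<in> carrier_mat n n. \<forall>p\<in>J. (f' * A * f) $$ p = 0} = {g \<in> X. \<forall>(i, j)\<in>J. (f' * g * f) $$ (i, j) = 0}"
    by auto
  ultimately show ?thesis by simp
qed

text \<open>Every diagonal isometry of \<open>D\<close> (of determinant 1 if \<open>d\<close>) is the exponential of a diagonal
  matrix all of whose multiples exponentiate to isometries of the same kind.\<close>

definition torus_connected :: "nat \<Rightarrow> complex mat \<Rightarrow> bool \<Rightarrow> bool" where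
  "torus_connected n D d \<longleftrightarrow> (\<forall>t :: nat \<Rightarrow> complex. (\<forall>i<n. t i \<noteq> 0) \<longrightarrow> (\<forall>i<n. \<forall>j<n. D $$ (i, j) \<noteq> 0 \<longrightarrow> t i * t j = 1) \<longrightarrow>
     (d \<longrightarrow> (\<Prod>i<n. t i) = 1) \<longrightarrow>
     (\<exists>l. (\<forall>i<n. exp (l i) = t i) \<and> (\<forall>i<n. \<forall>j<n. D $$ (i, j) \<noteq> 0 \<longrightarrow> l i + l j = 0) \<and> (d \<longrightarrow> (\<Sum>i<n. l i) = 0)))"

lemma det_upper:
  assumes "t \<in> carrier_mat n n" "upper n t" shows "det t = (\<Prod>i<n. t $$ (i, i))"
proof -
  have "upper_triangular t" using assms by (auto simp: upper_def upper_triangular_def)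
  from det_upper_triangular[OF this assms(1)] show ?thesis
    using assms(1) by (simp add: prod_list_diag_prod atLeast0LessThan)
qed

text \<open>For \<open>s \<noteq> 0\<close> the matrix \<open>m\<close> is the conjugate of \<open>t\<close> by
  \<open>diag(1, s\<^sup>-\<^sup>1, s\<^sup>-\<^sup>2, \<dots>)\<close>, which multiplies an antidiagonal form by a
  scalar. At \<open>s = 0\<close> only the diagonal of \<open>t\<close> is left.\<close>

lemma contract_upper:
  fixes s :: complex
  assumes t: "t \<in> carrier_mat n n" "upper n t" and D: "D \<in> carrier_mat n n" "transpose_mat t * D * t = D"
    and anti: "\<And>i j. i < n \<Longrightarrow> j < n \<Longrightarrow> D $$ (i, j) \<noteq> 0 \<Longrightarrow> i + j + 1 = n"
  defines "m \<equiv> mat n n (\<lambda>(i, j). if i \<le> j then s ^ (j - i) * t $$ (i, j) else 0)"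
  shows "upper n m" "transpose_mat m * D * m = D" "det m = det t"
proof -
  have mC: "m \<in> carrier_mat n n" by (simp add: m_def)
  show u: "upper n m" by (auto simp: upper_def m_def)
  show "det m = det t" using det_upper[OF t] det_upper[OF mC u] by (auto simp: m_def)
  show "transpose_mat m * D * m = D"
  proof (rule eq_matI)
    fix i j assume "i < dim_row D" "j < dim_col D"
    then have ij: "i < n" "j < n" using D by auto
    have "m $$ (k, i) * D $$ (k, l) * m $$ (l, j)
        = s ^ (i + j + 1 - n) * (t $$ (k, i) * D $$ (k, l) * t $$ (l, j))" if kl: "k < n" "l < n" for k l
    proof (cases "k \<le> i \<and> l \<le> j \<and> D $$ (k, l) \<noteq> 0")
      case True
      \<comment> \<open>The entries of \<open>D\<close> lie on the antidiagonal, so the exponent does not depend on \<open>k\<close> and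
        \<open>l\<close>.\<close>
      then have "(i - k) + (j - l) = i + j + 1 - n" using anti[OF kl] by auto
      then have "s ^ (i + j + 1 - n) = s ^ (i - k) * s ^ (j - l)" by (metis power_add)
      then show ?thesis using True kl ij by (simp add: m_def)
    next
      case False
      then have "D $$ (k, l) = 0 \<or> t $$ (k, i) = 0 \<and> m $$ (k, i) = 0 \<or> t $$ (l, j) = 0 \<and> m $$ (l, j) = 0"
        using t(2) kl ij by (auto simp: upper_def m_def)
      then show ?thesis by auto
    qed
    note eq = this
    have "(transpose_mat m * D * m) $$ (i, j) = s ^ (i + j + 1 - n) * (transpose_mat t * D * t) $$ (i, j)"
      unfolding gram_entry[OF mC D(1) ij] gram_entry[OF t(1) D(1) ij] sum_distrib_left
      by (intro sum.cong refl eq) auto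
    also have "\<dots> = D $$ (i, j)" using anti[OF ij] D(2) by (cases "D $$ (i, j) = 0") auto
    finally show "(transpose_mat m * D * m) $$ (i, j) = D $$ (i, j)" .
  qed (use mC D in auto)
qed

lemma diag_isometry:
  assumes D: "D \<in> carrier_mat n n"
  defines "m \<equiv> \<lambda>t. mat n n (\<lambda>(i, j). if i = j then t i else 0 :: complex)"
  shows "upper n (m t)" "det (m t) = (\<Prod>i<n. t i)" 
    "transpose_mat (m t) * D * m t = D \<longleftrightarrow> (\<forall>i<n. \<forall>j<n. D $$ (i, j) \<noteq> 0 \<longrightarrow> t i * t j = 1)"
proof -
  have mC: "m t \<in> carrier_mat n n" by (simp add: m_def)
  show u: "upper n (m t)" by (auto simp: upper_def m_def)
  show "det (m t) = (\<Prod>i<n. t i)" using det_upper[OF mC u] by (auto simp: m_def)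
  have e: "(transpose_mat (m t) * D * m t) $$ (i, j) = t i * t j * D $$ (i, j)" if ij: "i < n" "j < n" for i j
  proof -
    have "(\<Sum>l<n. m t $$ (k, i) * D $$ (k, l) * m t $$ (l, j)) = (if k = i then t i * D $$ (i, j) * t j else 0)" if "k < n" for k
    proof -
      have "(\<Sum>l<n. m t $$ (k, i) * D $$ (k, l) * m t $$ (l, j)) = (\<Sum>l<n. if l = j then m t $$ (k, i) * D $$ (k, j) * t j else 0)"
        using that ij by (intro sum.cong) (auto simp: m_def)
      then show ?thesis using that ij by (auto simp: m_def)
    qed
    then show ?thesis unfolding gram_entry[OF mC D ij] using ij by simp
  qed
  have "transpose_mat (m t) * D * m t = D \<longleftrightarrow> (\<forall>i<n. \<forall>j<n. t i * t j * D $$ (i, j) = D $$ (i, j))"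
  proof
    assume "transpose_mat (m t) * D * m t = D"
    then show "\<forall>i<n. \<forall>j<n. t i * t j * D $$ (i, j) = D $$ (i, j)" using e by metis
  next
    assume "\<forall>i<n. \<forall>j<n. t i * t j * D $$ (i, j) = D $$ (i, j)"
    then show "transpose_mat (m t) * D * m t = D" using D mC e by (intro eq_matI) auto
  qed
  then show "transpose_mat (m t) * D * m t = D \<longleftrightarrow> (\<forall>i<n. \<forall>j<n. D $$ (i, j) \<noteq> 0 \<longrightarrow> t i * t j = 1)" by auto
qed

lemma conj_isom:
  assumes S: "S \<in> carrier_mat n n" and f: "inv2 n f f'" and D: "D = transpose_mat f * S * f"
    and t: "t \<in> carrier_mat n n"
  shows "f * t * f' \<in> isom n S d \<longleftrightarrow> transpose_mat t * D * t = D \<and> (d \<longrightarrow> det t = 1)"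
    "f' * (f * t * f') * f = t" "f * t * f' \<in> carrier_mat n n"
proof -
  note C = inv2D(1,2)[OF f]
  have DC: "D \<in> carrier_mat n n" using D C S by auto
  show gC: "f * t * f' \<in> carrier_mat n n" using C t by auto
  have gact: "act n (f * t * f') x = act n f (act n t (act n f' x))" for x using C t by (simp add: act_mult)
  have Dfrm: "frm n D x y = frm n S (act n f x) (act n f y)" for x y using gram_frm[OF C(1) S] D by simp
  show undo: "f' * (f * t * f') * f = t"
    by (rule act_eqI) (use C t gC in \<open>auto simp: act_mult inv2D(7)[OF f]\<close>)
  have det: "det (f * t * f') = det t"
  proof -
    have "det f * det f' = 1" using det_mult[OF C] inv2D(3)[OF f] by simp
    then show ?thesis using C t by (simp add: det_mult[of _ n] algebra_simps)
  qed
  have "transpose_mat (f * t * f') * S * (f * t * f') = S \<longleftrightarrow> transpose_mat t * D * t = D"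
  proof
    assume *: "transpose_mat (f * t * f') * S * (f * t * f') = S"
    show "transpose_mat t * D * t = D"
    proof (rule gram_eqI[OF t DC DC])
      fix x y assume xy: "x \<in> V n" "y \<in> V n"
      have "frm n D (act n t x) (act n t y) = frm n S (act n (f * t * f') (act n f x)) (act n (f * t * f') (act n f y))"
        using xy by (simp add: Dfrm gact inv2D(7)[OF f])
      also have "\<dots> = frm n S (act n f x) (act n f y)" using gram_frm[OF gC S] * by metis
      finally show "frm n D (act n t x) (act n t y) = frm n D x y" by (simp add: Dfrm)
    qed
  next
    assume *: "transpose_mat t * D * t = D"
    show "transpose_mat (f * t * f') * S * (f * t * f') = S"
    proof (rule gram_eqI[OF gC S S])
      fix x y assume xy: "x \<in> V n" "y \<in> V n"
      have "frm n S (act n (f * t * f') x) (act n (f * t * f') y) = frm n D (act n t (act n f' x)) (act n t (act n f' y))"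
        by (simp add: Dfrm gact)
      also have "\<dots> = frm n D (act n f' x) (act n f' y)" using gram_frm[OF t DC] * by metis
      finally show "frm n S (act n (f * t * f') x) (act n (f * t * f') y) = frm n S x y"
        using xy by (simp add: Dfrm inv2D(6)[OF f])
    qed
  qed
  then show "f * t * f' \<in> isom n S d \<longleftrightarrow> transpose_mat t * D * t = D \<and> (d \<longrightarrow> det t = 1)"
    using gC det by (auto simp: isom_def)
qed

lemma inv2_det: "inv2 n A A' \<Longrightarrow> det A \<noteq> 0"
  using det_mult[of A n A'] inv2D(1-3)[of n A A'] by auto

text \<open>Two paths within the group join a triangular isometry to 1: the contraction to its diagonal,
  and the one-parameter group through the diagonal.\<close>

lemma triangular_isom_connected:
  assumes rg: "regular_group n (isom n S d) \<iota>"
    and S: "S \<in> carrier_mat n n" and f: "inv2 n f f'" and D: "D = transpose_mat f * S * f"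
    and anti: "\<And>i j. i < n \<Longrightarrow> j < n \<Longrightarrow> D $$ (i, j) \<noteq> 0 \<Longrightarrow> i + j + 1 = n"
    and torus: "torus_connected n D d"
  shows "connectedin (zariski n) {g \<in> isom n S d. upper n (f' * g * f)}" (is "connectedin _ ?U")
proof -
  note C = inv2D(1,2)[OF f]
  have DC: "D \<in> carrier_mat n n" using D C S by auto
  note cj = conj_isom[OF S f D]
  have path: "connectedin (zariski n) ((\<lambda>s. f * m s * f') ` {0..1})"
    if m: "\<And>s. m s \<in> carrier_mat n n" "\<And>i j. i < n \<Longrightarrow> j < n \<Longrightarrow> continuous_on {0..1} (\<lambda>s. m s $$ (i, j))"
    for m :: "real \<Rightarrow> complex mat"
  proof (rule connectedin_path)
    fix i j assume ij: "i < n" "j < n"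
    have "(f * m s * f') $$ (i, j) = (\<Sum>l<n. (\<Sum>k<n. f $$ (i, k) * m s $$ (k, l)) * f' $$ (l, j))" for s
      using mult_entry[of "f * m s" n f' i j] mult_entry[of f n "m s" i] C m(1)[of s] ij by simp
    moreover have "continuous_on {0..1} (\<lambda>s. \<Sum>l<n. (\<Sum>k<n. f $$ (i, k) * m s $$ (k, l)) * f' $$ (l, j))"
      by (intro continuous_intros m(2)) auto
    ultimately show "continuous_on {0..1} (\<lambda>s. (f * m s * f') $$ (i, j))" by simp
  qed (use C m(1) in auto)
  have mem: "f * t * f' \<in> ?U" if "t \<in> carrier_mat n n" "upper n t" "transpose_mat t * D * t = D" "d \<longrightarrow> det t = 1" for t
    using cj[OF that(1)] that by simp
  have "\<exists>C. connectedin (zariski n) C \<and> C \<subseteq> ?U \<and> 1\<^sub>m n \<in> C \<and> g \<in> C" if g: "g \<in> ?U" for g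
  proof -
    define t where "t = f' * g * f"
    have gC: "g \<in> carrier_mat n n" using g by (auto simp: isom_def)
    have tC: "t \<in> carrier_mat n n" using C gC by (auto simp: t_def)
    have ft: "f * t * f' = g"
      by (rule act_eqI) (use C gC tC in \<open>auto simp: act_mult inv2D(6)[OF f] t_def\<close>)
    have t: "upper n t" "transpose_mat t * D * t = D" "d \<longrightarrow> det t = 1"
      using g cj(1)[OF tC] unfolding ft by (auto simp: t_def)
    define m1 where "m1 s = mat n n (\<lambda>(i, j). if i \<le> j then complex_of_real s ^ (j - i) * t $$ (i, j) else 0)" for s
    note c1 = contract_upper[OF tC t(1) DC t(2) anti]
    have m1C: "m1 s \<in> carrier_mat n n" for s by (simp add: m1_def)
    have p1: "connectedin (zariski n) ((\<lambda>s. f * m1 s * f') ` {0..1})"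
    proof (rule path[OF m1C])
      fix i j assume "i < n" "j < n"
      then show "continuous_on {0..1} (\<lambda>s. m1 s $$ (i, j))"
        by (cases "i \<le> j") (auto simp: m1_def intro!: continuous_intros)
    qed
    have u1: "f * m1 s * f' \<in> ?U" for s
      by (rule mem[OF m1C]) (use c1[of "complex_of_real s"] t(3) in \<open>auto simp: m1_def\<close>)
    have e1: "m1 1 = t" using t(1) tC by (intro eq_matI) (auto simp: m1_def upper_def)
    let ?d = "\<lambda>i. t $$ (i, i)"
    let ?dm = "\<lambda>t. mat n n (\<lambda>(i, j). if i = j then t i else 0 :: complex)"
    have e0: "m1 0 = ?dm ?d" by (intro eq_matI) (auto simp: m1_def)
    have "transpose_mat (m1 0) * D * m1 0 = D"
      unfolding m1_def by (rule c1(2))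
    then have dd: "\<forall>i<n. \<forall>j<n. D $$ (i, j) \<noteq> 0 \<longrightarrow> ?d i * ?d j = 1"
      unfolding e0 diag_isometry(3)[OF DC] .
    have "inv2 n g (\<iota> g)" using regular_group.inv_props(4)[OF rg] g by blast
    then have "det t \<noteq> 0" unfolding t_def by (rule inv2_det[OF inv2_mult[OF inv2_mult[OF inv2D(5)[OF f]] f]])
    then have nz: "\<forall>i<n. ?d i \<noteq> 0" using det_upper[OF tC t(1)] by auto
    obtain l where l: "\<forall>i<n. exp (l i) = ?d i" "\<forall>i<n. \<forall>j<n. D $$ (i, j) \<noteq> 0 \<longrightarrow> l i + l j = 0" "d \<longrightarrow> (\<Sum>i<n. l i) = 0"
    proof -
      have "d \<longrightarrow> (\<Prod>i<n. ?d i) = 1" using t(3) det_upper[OF tC t(1)] by simp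
      from spec[OF torus[unfolded torus_connected_def], of ?d, THEN mp, OF nz, THEN mp, OF dd, THEN mp, OF this]
      show thesis by (elim exE conjE) (rule that; assumption)
    qed
    define m2 where "m2 s = ?dm (\<lambda>i. exp (complex_of_real s * l i))" for s
    have m2C: "m2 s \<in> carrier_mat n n" for s by (simp add: m2_def)
    have p2: "connectedin (zariski n) ((\<lambda>s. f * m2 s * f') ` {0..1})"
    proof (rule path[OF m2C])
      fix i j assume "i < n" "j < n"
      then show "continuous_on {0..1} (\<lambda>s. m2 s $$ (i, j))"
        by (cases "i = j") (auto simp: m2_def intro!: continuous_intros)
    qed
    have u2: "f * m2 s * f' \<in> ?U" for s
    proof (rule mem[OF m2C])
      have "exp (complex_of_real s * l i) * exp (complex_of_real s * l j) = 1" if "i < n" "j < n" "D $$ (i, j) \<noteq> 0" for i j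
        using l(2) that by (simp flip: exp_add distrib_left)
      then show "transpose_mat (m2 s) * D * m2 s = D" unfolding m2_def
        by (intro iffD2[OF diag_isometry(3)[OF DC]] allI impI)
      show "upper n (m2 s)" unfolding m2_def by (rule diag_isometry(1)[OF DC])
      show "d \<longrightarrow> det (m2 s) = 1" unfolding m2_def diag_isometry(2)[OF DC]
        using l(3) by (simp add: exp_sum[symmetric] sum_distrib_left[symmetric])
    qed
    have e2: "m2 1 = m1 0" unfolding e0 m2_def using l(1) by (intro eq_matI) auto
    have e3: "m2 0 = 1\<^sub>m n" by (intro eq_matI) (auto simp: m2_def)
    let ?C = "(\<lambda>s. f * m1 s * f') ` {0..1} \<union> (\<lambda>s. f * m2 s * f') ` {0..1}"
    have "f * m1 0 * f' \<in> (\<lambda>s. f * m1 s * f') ` {0..1}" by (rule image_eqI[of _ _ 0]) auto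
    moreover have "f * m1 0 * f' \<in> (\<lambda>s. f * m2 s * f') ` {0..1}"
      by (rule image_eqI[of _ _ 1]) (simp_all add: e2)
    ultimately have "connectedin (zariski n) ?C" by (intro connectedin_Un p1 p2) blast
    moreover have "?C \<subseteq> ?U"
    proof (intro Un_least subsetI)
      fix x assume "x \<in> (\<lambda>s. f * m1 s * f') ` {0..1}"
      then show "x \<in> ?U" by (elim imageE) (simp only: u1)
    next
      fix x assume "x \<in> (\<lambda>s. f * m2 s * f') ` {0..1}"
      then show "x \<in> ?U" by (elim imageE) (simp only: u2)
    qed
    moreover have "f * m2 0 * f' = 1\<^sub>m n" using e3 C inv2D(3)[OF f] by simp
    then have "1\<^sub>m n \<in> ?C" by (intro UnI2 image_eqI[of _ _ 0]) auto
    moreover have "g \<in> ?C" using ft e1 by (intro UnI1 image_eqI[of _ _ 1]) auto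
    ultimately show ?thesis by (intro exI[of _ ?C] conjI)
  qed
  then show ?thesis by (rule connectedin_from_point)
qed

lemma complex_log_exists: "z \<noteq> 0 \<Longrightarrow> \<exists>l. exp l = (z::complex)"
proof -
  assume "z \<noteq> 0"
  then have "exp (complex_of_real (ln (cmod z)) + \<i> * complex_of_real (Arg z)) = rcis (cmod z) (Arg z)"
    by (simp add: exp_add exp_of_real rcis_def cis_conv_exp)
  then show ?thesis using rcis_cmod_Arg by metis
qed

text \<open>Logarithms of all entries but the last are arbitrary, and the last one is chosen so that the
  sum vanishes.\<close>

lemma torus_connected_SL: "torus_connected n (0\<^sub>m n n) True"
  unfolding torus_connected_def
proof (intro allI impI)
  fix t :: "nat \<Rightarrow> complex"
  assume t: "\<forall>i<n. t i \<noteq> 0" "True \<longrightarrow> (\<Prod>i<n. t i) = 1"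
  have "\<forall>i. \<exists>l. i < n \<longrightarrow> exp l = t i" using complex_log_exists t(1) by blast
  then obtain L where L: "\<And>i. i < n \<Longrightarrow> exp (L i) = t i" by metis
  show "\<exists>l. (\<forall>i<n. exp (l i) = t i) \<and> (\<forall>i<n. \<forall>j<n. 0\<^sub>m n n $$ (i, j) \<noteq> (0::complex) \<longrightarrow> l i + l j = 0) \<and> (True \<longrightarrow> (\<Sum>i<n. l i) = 0)"
  proof (cases n)
    case (Suc k)
    let ?l = "L(k := - (\<Sum>i<k. L i))"
    have "(\<Sum>i<n. ?l i) = 0" by (simp add: Suc)
    moreover have "exp (?l k) = t k"
    proof -
      have "(\<Prod>i<k. t i) = exp (\<Sum>i<k. L i)" using L by (simp add: exp_sum Suc)
      then have "exp (\<Sum>i<k. L i) * t k = 1" using t(2) by (simp add: Suc)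
      then show ?thesis by (simp add: exp_minus field_simps)
    qed
    ultimately show ?thesis using L Suc by (intro exI[of _ ?l]) auto
  qed simp
qed

text \<open>Logarithms are chosen in the first half and negated in the second. In odd dimension the
  middle entry can only be joined to 1 if it is 1, which follows from determinant 1; this is why
  the full orthogonal group is excluded there.\<close>

lemma torus_connected_antidiag:
  assumes anti: "\<And>i j. i < n \<Longrightarrow> j < n \<Longrightarrow> D $$ (i, j) \<noteq> 0 \<Longrightarrow> i + j + 1 = n"
    and nz: "\<And>i. i < n \<Longrightarrow> D $$ (i, n - 1 - i) \<noteq> 0" and d: "d \<or> even n"
  shows "torus_connected n D d"
  unfolding torus_connected_def
proof (intro allI impI)
  fix t :: "nat \<Rightarrow> complex"
  assume t: "\<forall>i<n. t i \<noteq> 0" "\<forall>i<n. \<forall>j<n. D $$ (i, j) \<noteq> 0 \<longrightarrow> t i * t j = 1" "d \<longrightarrow> (\<Prod>i<n. t i) = 1"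
  have "\<forall>i. \<exists>l. i < n \<longrightarrow> exp l = t i" using complex_log_exists t(1) by blast
  then obtain L where L: "\<And>i. i < n \<Longrightarrow> exp (L i) = t i" by metis
  define l where "l i = (if i < n - 1 - i then L i else if n - 1 - i < i then - L (n - 1 - i) else 0)" for i
  have anti_l: "l (n - 1 - i) = - l i" if "i < n" for i using that by (auto simp: l_def)
  have tt: "t i * t (n - 1 - i) = 1" if "i < n" for i using t(2) nz[OF that] that by simp
  have e: "exp (l i) = t i" if "i < n" "n - 1 - i \<noteq> i" for i
    using that L[of i] L[of "n - 1 - i"] tt[of i] t(1) by (auto simp: l_def exp_minus field_simps)
  have "(\<Sum>i<n. l i) = (\<Sum>i<n. l (n - 1 - i))"
    by (rule sum.reindex_bij_witness[of _ "\<lambda>i. n - 1 - i" "\<lambda>i. n - 1 - i"]) auto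
  also have "\<dots> = (\<Sum>i<n. - l i)" by (intro sum.cong refl anti_l) auto
  also have "\<dots> = - (\<Sum>i<n. l i)" by (rule sum_negf)
  finally have s0: "(\<Sum>i<n. l i) = 0" by (simp add: eq_neg_iff_add_eq_0)
  have mid: "exp (l k) = t k" if k: "k < n" "n - 1 - k = k" for k
  proof -
    have "odd n" using k by presburger
    then have "(\<Prod>i<n. t i) = 1" using d t(3) by blast
    moreover have "(\<Prod>i<n. exp (l i)) = 1" using s0 by (simp flip: exp_sum)
    moreover have "(\<Prod>i\<in>{..<n} - {k}. exp (l i)) = (\<Prod>i\<in>{..<n} - {k}. t i)"
      by (intro prod.cong e) (use k in auto)
    moreover have "(\<Prod>i\<in>{..<n} - {k}. t i) \<noteq> 0" using t(1) by auto
    moreover have "(\<Prod>i<n. f i) = f k * (\<Prod>i\<in>{..<n} - {k}. f i)" for f :: "nat \<Rightarrow> complex"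
      using k by (intro prod.remove) auto
    ultimately show ?thesis by (metis mult_cancel_right)
  qed
  have "l i + l j = 0" if "i < n" "j < n" "D $$ (i, j) \<noteq> 0" for i j
  proof -
    have "j = n - 1 - i" using anti[OF that] by simp
    then show ?thesis using anti_l[OF that(1)] by simp
  qed
  then show "\<exists>l. (\<forall>i<n. exp (l i) = t i) \<and> (\<forall>i<n. \<forall>j<n. D $$ (i, j) \<noteq> 0 \<longrightarrow> l i + l j = 0) \<and> (d \<longrightarrow> (\<Sum>i<n. l i) = 0)"
    using e mid s0 by (intro exI[of _ l]) blast
qed

section \<open>Borel subgroups are stabilizers of flags\<close>

definition stable_chain :: "nat \<Rightarrow> complex mat set \<Rightarrow> nat \<Rightarrow> (nat \<Rightarrow> (nat \<Rightarrow> complex) set) \<Rightarrow> bool" where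
  "stable_chain n H m F \<longleftrightarrow> F 0 = {\<lambda>_. 0} \<and>
     (\<forall>j\<le>m. subsp (F j) \<and> F j \<subseteq> V n \<and> dm (F j) = j \<and> stable n H (F j)) \<and> (\<forall>j<m. F j \<subseteq> F (Suc j))"

lemma stable_ins:
  assumes A: "subsp A" "stable n H A" and v: "\<And>g. g \<in> H \<Longrightarrow> \<exists>c. (\<lambda>i. act n g v i - c * v i) \<in> A"
  shows "stable n H (ins A v)"
  unfolding stable_def
proof (intro ballI)
  fix g x assume g: "g \<in> H" and "x \<in> ins A v"
  then obtain a t where x: "a \<in> A" "x = (\<lambda>i. a i + t * v i)" by (auto simp: ins_def)
  obtain c where c: "(\<lambda>i. act n g v i - c * v i) \<in> A" using v[OF g] by blast
  have ga: "act n g a \<in> A" using A(2) g x(1) by (auto simp: stable_def)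
  have "act n g x = (\<lambda>i. act n g a i + t * act n g v i)"
    using act_comb[of n g 1 a t v] by (simp add: x(2))
  then show "act n g x \<in> ins A v"
    by (intro insI[OF subsp_comb[OF A(1) ga c, of 1 t], where c = "t * c"]) (auto simp: algebra_simps)
qed

lemma stable_chain_extend:
  assumes F: "stable_chain n H m F" and v: "v \<in> V n" "v \<notin> F m"
    "\<And>g. g \<in> H \<Longrightarrow> \<exists>c. (\<lambda>i. act n g v i - c * v i) \<in> F m"
  shows "stable_chain n H (Suc m) (F(Suc m := ins (F m) v))"
proof -
  have Fm: "subsp (F m)" "F m \<subseteq> V n" "dm (F m) = m" "stable n H (F m)" using F by (auto simp: stable_chain_def)
  show ?thesis
    using F subsp_ins[OF Fm(1), of v] ins_V[OF Fm(2) v(1)] dm_ins[OF Fm(1,2) v(1,2)] Fm(3)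
      stable_ins[OF Fm(1,4) v(3)] ins_sub[of "F m" v]
    unfolding stable_chain_def by (auto simp: le_Suc_eq less_Suc_eq)
qed

lemma (in regular_group) stable_full_flag:
  assumes H: "subgroup H G" "connectedin (zariski n) H" "(derived G ^^ k) H = {1\<^sub>m n}"
  shows "\<exists>F. full_flag n F \<and> (\<forall>j\<le>n. stable n H (F j))"
proof -
  have "\<exists>F. stable_chain n H m F" if "m \<le> n" for m
    using that
  proof (induction m)
    case 0
    show ?case
      by (intro exI[of _ "\<lambda>_. {\<lambda>_. 0}"]) (auto simp: stable_chain_def subsp_def dm_zero coord_def stable_def act_zero)
  next
    case (Suc m)
    then obtain F where F: "stable_chain n H m F" by auto
    then have Fm: "subsp (F m)" "F m \<subseteq> V n" "dm (F m) = m" "stable n H (F m)" by (auto simp: stable_chain_def)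
    have "F m \<noteq> V n" using Fm(3) dm_coord[of n] Suc.prems by auto
    moreover have "stable n H (V n)" by (auto simp: stable_def)
    ultimately obtain v where "v \<in> V n - F m" "\<forall>g\<in>H. \<exists>c. (\<lambda>i. act n g v i - c * v i) \<in> F m"
      using lie_kolchin[OF H Fm(1) subsp_coord Fm(2) _ subset_refl Fm(4)] by blast
    then show ?case using stable_chain_extend[OF F] by blast
  qed
  then obtain F where "stable_chain n H n F" by blast
  then show ?thesis by (intro exI[of _ F]) (auto simp: stable_chain_def full_flag_def)
qed

lemma perp_V_trivial:
  assumes "inv2 n S S'" shows "perp n S (V n) = {\<lambda>_. 0}"
proof
  show "perp n S (V n) \<subseteq> {\<lambda>_. 0}"
  proof
    fix y assume y: "y \<in> perp n S (V n)"
    have "act n S y = (\<lambda>_. 0)"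
    proof
      fix i show "act n S y i = 0"
        using y frm_unit_left[of i n S y] unit_V[of i n] by (cases "i < n") (auto simp: perp_def act_def)
    qed
    then have "act n S' (act n S y) = (\<lambda>_. 0)" by (simp add: act_zero)
    then show "y \<in> {\<lambda>_. 0}" using inv2D(7)[OF assms subsetD[OF perp_V y]] by simp
  qed
qed (auto simp: perp_def coord_def)

text \<open>Symmetric (\<open>\<epsilon> = 1\<close>) and alternating (\<open>\<epsilon> = - 1\<close>) nondegenerate forms at once.\<close>

locale eps_form =
  fixes n :: nat and S S' :: "complex mat" and \<epsilon> :: complex
  assumes S_inv: "inv2 n S S'" and eps: "\<epsilon> = 1 \<or> \<epsilon> = - 1"
    and form_sym: "frm n S x y = \<epsilon> * frm n S y x"
begin

lemma S_carrier: "S \<in> carrier_mat n n" using inv2D(1)[OF S_inv] .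

lemma eps_sq: "\<epsilon> * \<epsilon> = 1" using eps by auto

lemma dm_perp_eq: "subsp X \<Longrightarrow> X \<subseteq> V n \<Longrightarrow> dm (perp n S X) = n - dm X"
  using dm_perp[OF _ _ perp_V_trivial[OF S_inv]] by fastforce

lemma perp_perp:
  assumes X: "subsp X" "X \<subseteq> V n" shows "perp n S (perp n S X) = X"
proof (rule sym, rule subsp_eqI[OF X(1) subsp_perp _ perp_V])
  show "X \<subseteq> perp n S (perp n S X)"
  proof
    fix x assume x: "x \<in> X"
    have "frm n S y x = 0" if "y \<in> perp n S X" for y
      using that x form_sym[of y x] by (auto simp: perp_def)
    then show "x \<in> perp n S (perp n S X)" using x X(2) by (auto simp: perp_def)
  qed
  show "dm (perp n S (perp n S X)) \<le> dm X"
    unfolding dm_perp_eq[OF subsp_perp perp_V] dm_perp_eq[OF X] using dm_le[OF X(2)] by simp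
qed

end

locale form_group = eps_form + regular_group n "isom n S d" \<iota> for d \<iota>
begin

lemma frm_invariant: "g \<in> isom n S d \<Longrightarrow> frm n S (act n g x) (act n g y) = frm n S x y"
  by (rule isom_frm[OF _ S_carrier])

lemma stable_perp:
  assumes H: "subgroup H G" and A: "A \<subseteq> V n" "stable n H A"
  shows "stable n H (perp n S A)"
  unfolding stable_def
proof (intro ballI)
  fix g y assume g: "g \<in> H" and y: "y \<in> perp n S A"
  note HX = subgroup_props[OF H]
  have gX: "g \<in> isom n S d" using g HX(1) by blast
  have "frm n S x (act n g y) = 0" if x: "x \<in> A" for x
  proof -
    have "act n (\<iota> g) x \<in> A" using A(2) HX(4)[OF g] x by (auto simp: stable_def)
    moreover have "act n g (act n (\<iota> g) x) = x" using iota_act(2)[OF gX] x A(1) by blast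
    ultimately show ?thesis using frm_invariant[OF gX, of "act n (\<iota> g) x" y] y by (auto simp: perp_def)
  qed
  then show "act n g y \<in> perp n S A" by (auto simp: perp_def)
qed

text \<open>The eigenvalue of a vector that is not isotropic is 1 or -1 because the form is preserved;
  on a connected group it is 1, its value at the identity.\<close>

lemma eigen_trivial:
  assumes H: "subgroup H G" "connectedin (zariski n) H"
    and A: "subsp A" "A \<subseteq> V n" "A \<subseteq> perp n S A"
    and v: "v \<in> perp n S A" "v \<notin> A" "frm n S v v \<noteq> 0" "\<And>g. g \<in> H \<Longrightarrow> \<exists>c. (\<lambda>i. act n g v i - c * v i) \<in> A"
    and g: "g \<in> H"
  shows "(\<lambda>i. act n g v i - 1 * v i) \<in> A"
proof -
  note HX = subgroup_props[OF H(1)]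
  have vV: "v \<in> V n" using v(1) perp_V by blast
  let ?F = "\<lambda>c. {M \<in> carrier_mat n n. (\<lambda>i. act n M v i - c * v i) \<in> A}"
  have sq: "c = 1 \<or> c = - 1" if h: "h \<in> H" "(\<lambda>i. act n h v i - c * v i) \<in> A" for h c
  proof -
    let ?a = "\<lambda>i. act n h v i - c * v i"
    have av: "frm n S ?a v = 0" "frm n S ?a ?a = 0" using v(1) h(2) A(3) by (auto simp: perp_def)
    then have va: "frm n S v ?a = 0" using form_sym[of v ?a] by simp
    have hv: "act n h v = (\<lambda>i. c * v i + 1 * ?a i)" by auto
    have "frm n S v v = frm n S (act n h v) (act n h v)" using frm_invariant h(1) HX(1) by (simp add: subset_iff)
    also have "\<dots> = c * c * frm n S v v"
      by (subst (1 2) hv) (simp only: frm_comb_left frm_comb_right av va, simp)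
    finally have "c * c = 1" using v(3) by simp
    then show ?thesis by (simp add: square_eq_1_iff)
  qed
  have "g \<in> ?F 1"
  proof (rule connected_in_one[OF H(2), where C = "{1, - 1}" and F = ?F])
    fix c show "closedin (zariski n) (?F c)"
    proof (rule closedin_in_subspace[OF A(1,2)])
      fix M show "(\<lambda>i. act n M v i - c * v i) \<in> V n" by (rule subsp_axpy[OF subsp_coord _ vV]) auto
    qed (intro regf_diff regf_const regf_act_entry)
  next
    fix h assume h: "h \<in> H"
    then obtain c where "(\<lambda>i. act n h v i - c * v i) \<in> A" using v(4) by blast
    moreover have "h \<in> carrier_mat n n" using h HX(1) by (auto simp: isom_def)
    ultimately show "\<exists>c\<in>{1, - 1}. h \<in> ?F c" using sq[OF h] by (intro bexI[of _ c]) auto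
  next
    fix h c e assume h: "h \<in> H" "h \<in> ?F c" "h \<in> ?F e"
    show "c = e" by (rule scalar_mod_unique[OF A(1) _ _ v(2)]) (use h in auto)
  next
    show "1\<^sub>m n \<in> ?F 1" using subsp_zero[OF A(1)] vV by (simp add: act_one)
  qed (use HX(2) g in auto)
  then show ?thesis by simp
qed

text \<open>Take an invariant isotropic chain of maximal length \<open>k\<close> with top \<open>A\<close>. If \<open>n \<ge> 2 k + 2\<close>,
  there are eigenvectors \<open>v\<close> in \<open>A\<^sup>\<bottom> / A\<close> and \<open>v'\<close> in \<open>(A + v)\<^sup>\<bottom> / A\<close>. By maximality
  neither is isotropic, so both are fixed modulo \<open>A\<close>, and so is their isotropic combination
  \<open>v + c v'\<close>, which extends the chain after all. Hence \<open>n \<le> 2 k + 1\<close>, and the chain together with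
  the orthogonal spaces of its members is a complete flag.\<close>

lemma self_dual_stable_flag:
  assumes H: "subgroup H G" "connectedin (zariski n) H" "(derived G ^^ k0) H = {1\<^sub>m n}"
  shows "\<exists>F. full_flag n F \<and> (\<forall>j\<le>n. stable n H (F j)) \<and> (\<forall>j\<le>n. F (n - j) = perp n S (F j))"
proof -
  let ?P = "\<lambda>k. \<exists>F. stable_chain n H k F \<and> F k \<subseteq> perp n S (F k)"
  have "stable_chain n H 0 (\<lambda>_. {\<lambda>_. 0})"
    by (auto simp: stable_chain_def subsp_def dm_zero coord_def stable_def act_zero)
  then have P0: "?P 0" by (intro exI[of _ "\<lambda>_. {\<lambda>_. 0}"]) (auto simp: perp_zero coord_def)
  have "k \<le> n" if P: "?P k" for k
  proof -
    obtain F where "stable_chain n H k F" using P by blast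
    then have "F k \<subseteq> V n" "dm (F k) = k" by (auto simp: stable_chain_def)
    then show ?thesis using dm_le by metis
  qed
  then obtain k where "?P k" and kmax: "\<And>j. ?P j \<Longrightarrow> j \<le> k"
    using Nat.ex_has_greatest_nat[of ?P 0 n, OF P0] by blast
  then obtain F where F: "stable_chain n H k F" and iso: "F k \<subseteq> perp n S (F k)" by blast
  have Fm: "subsp (F k)" "F k \<subseteq> V n" "dm (F k) = k" "stable n H (F k)" using F by (auto simp: stable_chain_def)
  let ?A = "F k" and ?C = "perp n S (F k)"
  have dC: "dm ?C = n - k" using dm_perp_eq[OF Fm(1,2)] Fm(3) by simp
  have no_ext: False if v: "v \<in> ?C" "v \<notin> ?A" "frm n S v v = 0" "\<And>g. g \<in> H \<Longrightarrow> \<exists>c. (\<lambda>i. act n g v i - c * v i) \<in> ?A" for v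
  proof -
    have vV: "v \<in> V n" using v(1) perp_V by blast
    let ?F = "F(Suc k := ins ?A v)"
    have "ins ?A v \<subseteq> perp n S (ins ?A v)"
    proof
      fix x assume x: "x \<in> ins ?A v"
      have "frm n S y x = 0" if y: "y \<in> ins ?A v" for y
      proof -
        obtain a s b t where ab: "a \<in> ?A" "b \<in> ?A" "x = (\<lambda>i. 1 * a i + s * v i)" "y = (\<lambda>i. 1 * b i + t * v i)"
          using x y by (auto simp: ins_def)
        have "frm n S b a = 0" "frm n S b v = 0" "frm n S a v = 0"
          using ab iso v(1) by (auto simp: perp_def)
        moreover have "frm n S v a = 0" using form_sym[of v a] calculation by simp
        ultimately show ?thesis unfolding ab(3,4) frm_comb_left frm_comb_right using v(3) by simp
      qed
      then show "x \<in> perp n S (ins ?A v)" using x ins_V[OF Fm(2) vV] by (auto simp: perp_def)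
    qed
    then have "?P (Suc k)" using stable_chain_extend[OF F vV v(2,4)] by (intro exI[of _ ?F]) auto
    then show False using kmax[of "Suc k"] by simp
  qed
  have kn: "n \<le> 2 * k + 1"
  proof (rule ccontr)
    assume "\<not> ?thesis"
    then have big: "2 * k + 2 \<le> n" by simp
    have "?A \<noteq> ?C" using dC Fm(3) big by auto
    then obtain v where v: "v \<in> ?C" "v \<notin> ?A" "\<And>g. g \<in> H \<Longrightarrow> \<exists>c. (\<lambda>i. act n g v i - c * v i) \<in> ?A"
      using lie_kolchin[OF H Fm(1) subsp_perp iso _ perp_V Fm(4) stable_perp[OF H(1) Fm(2,4)]] by blast
    have vV: "v \<in> V n" using v(1) perp_V by blast
    have q: "frm n S v v \<noteq> 0" using no_ext v by blast
    let ?B = "ins ?A v" and ?C' = "perp n S (ins ?A v)"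
    have B: "subsp ?B" "?B \<subseteq> V n" "stable n H ?B"
      using subsp_ins[OF Fm(1)] ins_V[OF Fm(2) vV] stable_ins[OF Fm(1,4) v(3)] by auto
    have C': "?C' = {y \<in> ?C. frm n S v y = 0}" by (rule perp_ins[OF Fm(1)])
    have "frm n S v a = 0" if "a \<in> ?A" for a using form_sym[of v a] v(1) that by (auto simp: perp_def)
    then have AC': "?A \<subseteq> ?C'" using iso C' by blast
    have "dm ?C' = n - Suc k" using dm_perp_eq[OF B(1,2)] dm_ins[OF Fm(1,2) vV v(2)] Fm(3) by simp
    then have "?A \<noteq> ?C'" using Fm(3) big by auto
    then obtain v' where v': "v' \<in> ?C'" "v' \<notin> ?A" "\<And>g. g \<in> H \<Longrightarrow> \<exists>c. (\<lambda>i. act n g v' i - c * v' i) \<in> ?A"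
      using lie_kolchin[OF H Fm(1) subsp_perp AC' _ perp_V Fm(4) stable_perp[OF H(1) B(2,3)]] by blast
    have v'C: "v' \<in> ?C" "frm n S v v' = 0" using v'(1) C' by auto
    have q': "frm n S v' v' \<noteq> 0" using no_ext v' v'C by blast
    have vv': "frm n S v' v = 0" using form_sym[of v' v] v'C by simp
    let ?c = "csqrt (- frm n S v v / frm n S v' v')"
    let ?w = "\<lambda>i. 1 * v i + ?c * v' i"
    have cc: "?c * ?c = - frm n S v v / frm n S v' v'" by (metis power2_csqrt power2_eq_square)
    have "frm n S ?w ?w = frm n S v v + (?c * ?c) * frm n S v' v'"
      unfolding frm_comb_left frm_comb_right using v'C vv' by simp
    then have w0: "frm n S ?w ?w = 0" unfolding cc using q' by simp
    have wC: "?w \<in> ?C" by (rule subsp_comb[OF subsp_perp v(1) v'C(1)])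
    have "frm n S ?w v = frm n S v v" unfolding frm_comb_left using vv' by simp
    then have wA: "?w \<notin> ?A" using q v(1) by (auto simp: perp_def)
    show False
    proof (rule no_ext[OF wC wA w0])
      fix g assume g: "g \<in> H"
      have 1: "(\<lambda>i. act n g v i - 1 * v i) \<in> ?A" by (rule eigen_trivial[OF H(1,2) Fm(1,2) iso v(1,2) q v(3) g])
      have 2: "(\<lambda>i. act n g v' i - 1 * v' i) \<in> ?A" by (rule eigen_trivial[OF H(1,2) Fm(1,2) iso v'C(1) v'(2) q' v'(3) g])
      have "(\<lambda>i. act n g ?w i - 1 * ?w i) \<in> ?A"
        using subsp_comb[OF Fm(1) 1 2, of 1 ?c] unfolding act_comb by (simp add: algebra_simps)
      then show "\<exists>c. (\<lambda>i. act n g ?w i - c * ?w i) \<in> ?A" by blast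
    qed
  qed
  have k_le: "2 * k \<le> n"
    using dm_mono[OF iso perp_V] dC Fm(3) dm_le[OF Fm(2)] by simp
  have Fj: "subsp (F j)" "F j \<subseteq> V n" "dm (F j) = j" "stable n H (F j)" if "j \<le> k" for j
    using F that by (auto simp: stable_chain_def)
  have Finc: "F i \<subseteq> F j" if "i \<le> j" "j \<le> k" for i j
    using that
  proof (induction j)
    case (Suc j)
    have "F j \<subseteq> F (Suc j)" using F Suc.prems by (simp add: stable_chain_def)
    then show ?case using Suc by (cases "i = Suc j") auto
  qed simp
  define E where "E j = (if j \<le> k then F j else perp n S (F (n - j)))" for j
  have E: "subsp (E j)" "E j \<subseteq> V n" "dm (E j) = j" "stable n H (E j)" if j: "j \<le> n" for j
  proof -
    have "n - j \<le> k" if "\<not> j \<le> k" using kn that by linarith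
    then show "subsp (E j)" "E j \<subseteq> V n" "dm (E j) = j" "stable n H (E j)"
      using Fj[of j] Fj[of "n - j"] subsp_perp perp_V dm_perp_eq[of "F (n - j)"] stable_perp[OF H(1), of "F (n - j)"] j
      by (auto simp: E_def)
  qed
  have inc: "E j \<subseteq> E (Suc j)" if j: "j < n" for j
  proof -
    consider "Suc j \<le> k" | "j = k" | "k < j" by linarith
    then show ?thesis
    proof cases
      case 1 then show ?thesis using Finc[of j "Suc j"] by (simp add: E_def)
    next
      case 2
      have "F (n - Suc k) \<subseteq> F k" by (rule Finc) (use kn in linarith, simp)
      then have "perp n S (F k) \<subseteq> perp n S (F (n - Suc k))" by (rule perp_mono)
      then show ?thesis using 2 iso by (auto simp: E_def)
    next
      case 3
      have "F (n - Suc j) \<subseteq> F (n - j)" by (rule Finc) (use kn 3 in linarith)+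
      then show ?thesis using 3 perp_mono by (auto simp: E_def)
    qed
  qed
  have dual: "E (n - j) = perp n S (E j)" if j: "j \<le> n" for j
  proof (cases "j \<le> k")
    case True
    show ?thesis
    proof (cases "n - j \<le> k")
      case True': True
      then have eq: "j = k" "n = 2 * k" using True k_le j by auto
      have "F k = perp n S (F k)"
        by (rule subsp_eqI[OF Fm(1) subsp_perp iso perp_V]) (use dC Fm(3) eq in auto)
      then show ?thesis using eq by (simp add: E_def)
    next
      case False
      then show ?thesis using True j by (simp add: E_def)
    qed
  next
    case False
    then have "n - j \<le> k" using kn by linarith
    then show ?thesis using False perp_perp[OF Fj(1,2)[of "n - j"]] by (simp add: E_def)
  qed
  show ?thesis using E inc dual by (intro exI[of _ E]) (auto simp: full_flag_def)
qed

end

lemma inv2_transpose: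
  assumes "inv2 n A A'" shows "inv2 n (transpose_mat A) (transpose_mat A')"
proof -
  note A = inv2D[OF assms]
  have "transpose_mat A * transpose_mat A' = 1\<^sub>m n"
    using transpose_mult[OF A(2,1)] A(4) by simp
  moreover have "transpose_mat A' * transpose_mat A = 1\<^sub>m n"
    using transpose_mult[OF A(1,2)] A(3) by simp
  ultimately show ?thesis using A(1,2) by (simp add: inv2_def)
qed

lemma frm_sym_entries:
  assumes "\<And>i j. i < n \<Longrightarrow> j < n \<Longrightarrow> S $$ (i, j) = \<epsilon> * S $$ (j, i)"
  shows "frm n S x y = \<epsilon> * frm n S y x"
proof -
  have "frm n S x y = (\<Sum>i<n. \<Sum>j<n. \<epsilon> * (y j * S $$ (j, i) * x i))"
    unfolding frm_sum
  proof (intro sum.cong refl)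
    fix i j assume "i \<in> {..<n}" "j \<in> {..<n}"
    then have "S $$ (i, j) = \<epsilon> * S $$ (j, i)" using assms by blast
    then show "x i * S $$ (i, j) * y j = \<epsilon> * (y j * S $$ (j, i) * x i)" by (simp only: mult_ac)
  qed
  also have "\<dots> = (\<Sum>j<n. \<Sum>i<n. \<epsilon> * (y j * S $$ (j, i) * x i))" by (rule sum.swap)
  also have "\<dots> = \<epsilon> * frm n S y x" unfolding frm_sum by (simp add: sum_distrib_left)
  finally show ?thesis .
qed

context eps_form begin

text \<open>In a basis of the self-dual flag the Gram matrix \<open>M\<close> vanishes above the antidiagonal. It is
  \<open>D y\<close> with \<open>D\<close> its antidiagonal part and \<open>y\<close> upper triangular and self-adjoint for \<open>D\<close>; a square
  root \<open>r\<close> of \<open>y\<close> that is a polynomial in \<open>y\<close> is triangular and satisfies \<open>M = r\<^sup>T D r\<close>. The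
  base change \<open>r\<^sup>-\<^sup>1\<close> therefore preserves the flag and makes the Gram matrix
  antidiagonal.\<close>

lemma adapted_basis:
  assumes F: "full_flag n F" and dual: "\<And>j. j \<le> n \<Longrightarrow> F (n - j) = perp n S (F j)"
  obtains f f' where "inv2 n f f'" "\<And>j. j \<le> n \<Longrightarrow> act n f ` coord {..<j} = F j"
    "\<And>i j. i < n \<Longrightarrow> j < n \<Longrightarrow> (transpose_mat f * S * f) $$ (i, j) \<noteq> 0 \<Longrightarrow> i + j + 1 = n"
    "\<And>i. i < n \<Longrightarrow> (transpose_mat f * S * f) $$ (i, n - 1 - i) \<noteq> 0"
proof -
  note FD = full_flagD[OF F]
  obtain e e' where e: "inv2 n e e'" and eF: "\<And>j. j \<le> n \<Longrightarrow> act n e ` coord {..<j} = F j"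
    using flag_basis[OF F] by blast
  note eC = inv2D(1,2)[OF e]
  define M where "M = transpose_mat e * S * e"
  have MC: "M \<in> carrier_mat n n" using eC S_carrier by (simp add: M_def)
  have Mfrm: "frm n M x y = frm n S (act n e x) (act n e y)" for x y
    unfolding M_def by (rule gram_frm[OF eC(1) S_carrier])
  have Msym: "frm n M x y = \<epsilon> * frm n M y x" for x y unfolding Mfrm by (rule form_sym)
  let ?e = "\<lambda>j. act n e (unit j)"
  have Me: "M $$ (i, j) = frm n S (?e i) (?e j)" if "i < n" "j < n" for i j
    using frm_unit_unit[OF that, of M] by (simp add: Mfrm)
  have Mij: "M $$ (i, j) = \<epsilon> * M $$ (j, i)" if "i < n" "j < n" for i j
    using Me[OF that] Me[OF that(2,1)] form_sym by metis
  have ein: "?e j \<in> F (Suc j)" if "j < n" for j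
  proof -
    have "unit j \<in> coord {..<Suc j}" by (auto simp: unit_def coord_def)
    from imageI[OF this, of "act n e"] show ?thesis using eF[of "Suc j"] that by simp
  qed
  have Mlow: "M $$ (i, j) = 0" if "i + j + 2 \<le> n" for i j
  proof -
    have ij: "i < n" "j < n" "Suc i \<le> n" "Suc j \<le> n - Suc i" "n - Suc i \<le> n" using that by auto
    have "?e j \<in> perp n S (F (Suc i))" using ein[OF ij(2)] FD(7)[OF ij(4,5)] dual[OF ij(3)] by blast
    then show ?thesis using Me[OF ij(1,2)] ein[OF ij(1)] by (auto simp: perp_def)
  qed
  have FSuc: "F (Suc j) = ins (F j) (?e j)" if "j < n" for j
    using eF[of j] eF[of "Suc j"] that by (simp add: coord_Suc act_image_ins)
  have Mnz: "M $$ (i, n - 1 - i) \<noteq> 0" if i: "i < n" for i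
  proof
    assume 0: "M $$ (i, n - 1 - i) = 0"
    let ?k = "n - Suc i"
    have k: "?k < n" "Suc ?k = n - i" "n - ?k = Suc i" using i by auto
    have "?e i \<in> perp n S (F ?k)" using ein[OF i] dual[of ?k] k by simp
    moreover have "frm n S (?e ?k) (?e i) = 0"
      using Me[OF k(1) i] Mij[OF k(1) i] 0 by simp
    ultimately have "?e i \<in> perp n S (F (n - i))"
      using FSuc[OF k(1)] perp_ins[OF FD(1)[of ?k], of n S "?e ?k"] k by auto
    then have "?e i \<in> F i" using dual[of "n - i"] i by simp
    then obtain x where x: "x \<in> coord {..<i}" "act n e x = ?e i" using eF[of i] i by (metis imageE less_imp_le)
    have "x \<in> V n" using x(1) i by (auto simp: coord_def)
    then have "x = unit i" using inv2D(7)[OF e] x(2) unit_V[OF i] by metis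
    then show False using x(1) by (auto simp: coord_def unit_def)
  qed
  define D where "D = mat n n (\<lambda>(i, j). if i + j + 1 = n then M $$ (i, j) else 0)"
  define D' where "D' = mat n n (\<lambda>(i, j). if i + j + 1 = n then 1 / M $$ (j, i) else 0)"
  have DC: "D \<in> carrier_mat n n" "D' \<in> carrier_mat n n" by (auto simp: D_def D'_def)
  have prod1: "(A * B) $$ (i, j) = A $$ (i, n - Suc i) * B $$ (n - Suc i, j)"
    if "A \<in> carrier_mat n n" "B \<in> carrier_mat n n" "i < n" "j < n" and
      A: "\<And>k. k < n \<Longrightarrow> k \<noteq> n - Suc i \<Longrightarrow> A $$ (i, k) = 0" for A B :: "complex mat" and i j
  proof -
    have "(A * B) $$ (i, j) = (\<Sum>k<n. A $$ (i, k) * B $$ (k, j))" by (rule mult_entry[OF that(1-4)])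
    also have "\<dots> = (\<Sum>k<n. if k = n - Suc i then A $$ (i, k) * B $$ (k, j) else 0)"
      by (intro sum.cong refl) (use A in auto)
    finally show ?thesis using that(3) by simp
  qed
  have "D * D' = 1\<^sub>m n"
  proof (rule eq_matI)
    fix i j assume "i < dim_row (1\<^sub>m n)" "j < dim_col (1\<^sub>m n)"
    then have ij: "i < n" "j < n" by auto
    have "(D * D') $$ (i, j) = D $$ (i, n - Suc i) * D' $$ (n - Suc i, j)"
      by (rule prod1[OF DC ij]) (use ij in \<open>auto simp: D_def\<close>)
    also have "\<dots> = (if i = j then 1 else 0)"
    proof -
      have "n - Suc i + j + 1 = n \<longleftrightarrow> i = j" using ij by arith
      then show ?thesis using ij Mnz[of i] by (auto simp: D_def D'_def)
    qed
    finally show "(D * D') $$ (i, j) = 1\<^sub>m n $$ (i, j)" using ij by simp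
  qed (use DC in auto)
  then have D: "inv2 n D D'" using DC mat_mult_left_right_inverse[OF DC] by (simp add: inv2_def)
  have Minv: "inv2 n M (e' * (S' * transpose_mat e'))"
    using inv2_mult[OF inv2_mult[OF inv2_transpose[OF e] S_inv] e] by (simp add: M_def)
  define y where "y = D' * M"
  obtain y' where y: "inv2 n y y'" using inv2_mult[OF inv2D(5)[OF D] Minv] by (auto simp: y_def)
  note yC = inv2D(1,2)[OF y]
  have Dy: "D * y = M"
    using inv2D(3)[OF D] MC DC assoc_mult_mat[of D n n D' n M n] by (simp add: y_def)
  have yup: "upper n y" unfolding upper_def
  proof (intro allI impI)
    fix i j assume ij: "i < n" "j < i"
    have "y $$ (i, j) = D' $$ (i, n - Suc i) * M $$ (n - Suc i, j)"
      unfolding y_def by (rule prod1[OF DC(2) MC]) (use ij in \<open>auto simp: D'_def\<close>)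
    also have "M $$ (n - Suc i, j) = 0" by (rule Mlow) (use ij in auto)
    finally show "y $$ (i, j) = 0" by simp
  qed
  have Dsym: "frm n D u v = \<epsilon> * frm n D v u" for u v
  proof (rule frm_sym_entries)
    fix i j assume ij: "i < n" "j < n"
    show "D $$ (i, j) = \<epsilon> * D $$ (j, i)"
    proof (cases "i + j + 1 = n")
      case True
      then have "D $$ (i, j) = M $$ (i, j)" "D $$ (j, i) = M $$ (j, i)" using ij by (auto simp: D_def)
      then show ?thesis using Mij[OF ij] by (simp only:)
    qed (use ij in \<open>auto simp: D_def\<close>)
  qed
  have DyM: "frm n D u (act n y v) = frm n M u v" for u v
    using frm_act_right[OF yC(1) DC(1)] Dy by simp
  have yadj: "frm n D (act n y u) v = frm n D u (act n y v)" for u v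
  proof -
    have "frm n D (act n y u) v = \<epsilon> * frm n D v (act n y u)" by (rule Dsym)
    also have "\<dots> = \<epsilon> * (\<epsilon> * frm n M u v)" unfolding DyM by (simp only: Msym[of v u])
    also have "\<dots> = (\<epsilon> * \<epsilon>) * frm n M u v" by simp
    finally show ?thesis by (simp add: eps_sq DyM)
  qed
  obtain p where p: "\<And>x. x \<in> V n \<Longrightarrow> pev n y p (pev n y p x) = act n y x"
    using operator_sqrt[OF y] by blast
  define r where "r = mat n n (\<lambda>(i, j). pev n y p (unit j) i)"
  have rC: "r \<in> carrier_mat n n" by (simp add: r_def)
  have ract: "act n r x = pev n y p x" if "x \<in> V n" for x
    unfolding r_def by (rule act_mat_of[OF pev_comb pev_V that])
  have rr: "r * r = y" by (rule act_eqI) (use rC yC in \<open>auto simp: act_mult ract p pev_V\<close>)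
  have "r * (r * y') = 1\<^sub>m n" using rr inv2D(3)[OF y] assoc_mult_mat[OF rC rC yC(2)] by simp
  then have r: "inv2 n r (r * y')"
    using rC yC mat_mult_left_right_inverse[of r n "r * y'"] by (simp add: inv2_def)
  have yst: "x \<in> coord {..<j} \<Longrightarrow> act n y x \<in> coord {..<j}" if "j \<le> n" for j x
    using yup that unfolding upper_iff by blast
  have rim: "act n (r * y') ` coord {..<j} = coord {..<j}" if j: "j \<le> n" for j
  proof (rule invariant_image_eq(2)[OF r subsp_coord])
    show sub: "coord {..<j} \<subseteq> V n" using j by (auto simp: coord_def)
    show "act n r ` coord {..<j} \<subseteq> coord {..<j}"
    proof
      fix z assume "z \<in> act n r ` coord {..<j}"
      then obtain x where x: "x \<in> coord {..<j}" "z = act n r x" by blast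
      then have "z = pev n y p x" using ract sub by blast
      then show "z \<in> coord {..<j}" using pev_invariant[OF subsp_coord yst[OF j] x(1)] by simp
    qed
  qed
  let ?f = "e * (r * y')"
  have f: "inv2 n ?f (r * e')" by (rule inv2_mult[OF e inv2D(5)[OF r]])
  note r'C = inv2D(2)[OF r]
  have gram: "transpose_mat ?f * S * ?f = D"
  proof (rule gram_eqI[OF inv2D(1)[OF f] S_carrier DC(1)])
    fix u v assume uv: "u \<in> V n" "v \<in> V n"
    let ?a = "act n (r * y') u" and ?b = "act n (r * y') v"
    have "frm n S (act n ?f u) (act n ?f v) = frm n M ?a ?b"
      by (simp only: Mfrm act_mult[OF eC(1) r'C])
    also have "\<dots> = frm n D ?a (pev n y p (pev n y p ?b))" by (simp only: DyM p[OF act_V])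
    also have "\<dots> = frm n D (act n r ?a) (act n r ?b)"
      by (simp only: pev_self_adjoint[OF yadj, symmetric] ract[OF act_V])
    also have "\<dots> = frm n D u v" by (simp only: inv2D(6)[OF r uv(1)] inv2D(6)[OF r uv(2)])
    finally show "frm n S (act n ?f u) (act n ?f v) = frm n D u v" .
  qed
  show thesis
  proof (rule that[OF f])
    show "act n ?f ` coord {..<j} = F j" if "j \<le> n" for j
    proof -
      have "act n ?f ` coord {..<j} = act n e ` (act n (r * y') ` coord {..<j})"
        unfolding image_image by (rule image_cong) (simp_all only: act_mult[OF eC(1) r'C])
      then show ?thesis using rim[OF that] eF[OF that] by simp
    qed
    show "i + j + 1 = n" if "i < n" "j < n" "(transpose_mat ?f * S * ?f) $$ (i, j) \<noteq> 0" for i j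
      using that unfolding gram by (auto simp: D_def split: if_splits)
    show "(transpose_mat ?f * S * ?f) $$ (i, n - 1 - i) \<noteq> 0" if "i < n" for i
      unfolding gram using Mnz[OF that] that by (auto simp: D_def)
  qed
qed

end

text \<open>In the basis \<open>f\<close> the stabilizer consists of the triangular isometries of an antidiagonal or
  zero Gram matrix.\<close>

lemma fstab_closed_conn_solvable:
  assumes rg: "regular_group n (isom n S d) \<iota>" and S: "S \<in> carrier_mat n n"
    and F: "full_flag n F" and f: "inv2 n f f'" and fF: "\<And>j. j \<le> n \<Longrightarrow> act n f ` coord {..<j} = F j"
    and anti: "\<And>i j. i < n \<Longrightarrow> j < n \<Longrightarrow> (transpose_mat f * S * f) $$ (i, j) \<noteq> 0 \<Longrightarrow> i + j + 1 = n"
    and torus: "torus_connected n (transpose_mat f * S * f) d"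
  shows "closed_conn_solvable n (mat_group n (isom n S d)) (fstab n (isom n S d) F)"
proof -
  interpret regular_group n "isom n S d" \<iota> by (rule rg)
  have eq: "fstab n (isom n S d) F = {g \<in> isom n S d. upper n (f' * g * f)}"
    using upper_conj_iff[OF f] fF X_carrier by (auto simp: fstab_def)
  have "closedin (zariski n) {g \<in> isom n S d. \<forall>(i, j)\<in>{(i, j). i < n \<and> j < i}. (f' * g * f) $$ (i, j) = 0}"
    by (rule stabilizer_closed[OF f isom_closed[OF S]]) auto
  moreover have "{g \<in> isom n S d. \<forall>(i, j)\<in>{(i, j). i < n \<and> j < i}. (f' * g * f) $$ (i, j) = 0}
      = fstab n (isom n S d) F" unfolding eq upper_def by auto
  moreover have "connectedin (zariski n) (fstab n (isom n S d) F)"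
    unfolding eq by (rule triangular_isom_connected[OF rg S f refl anti torus])
  ultimately show ?thesis
    unfolding closed_conn_solvable_def using fstab_subgroup[OF F] fstab_solvable[OF F] by simp
qed

lemma (in regular_group) borel_eqI:
  assumes B: "borel_subgroup n G B" and F: "full_flag n F" and st: "\<And>j. j \<le> n \<Longrightarrow> stable n B (F j)"
    and ccs: "closed_conn_solvable n G (fstab n X F)"
  shows "B = fstab n X F"
proof -
  have "B \<subseteq> X" using B subgroup_props(1) by (auto simp: borel_subgroup_def closed_conn_solvable_def)
  then have "B \<subseteq> fstab n X F" using st by (auto simp: fstab_def stable_def)
  then show ?thesis using B ccs by (auto simp: borel_subgroup_def)
qed

lemma (in regular_group) borel_props:
  assumes "borel_subgroup n G B"
  obtains k where "subgroup B G" "connectedin (zariski n) B" "(derived G ^^ k) B = {1\<^sub>m n}"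
proof -
  have B: "subgroup B G" "connectedin (zariski n) B" "solvable (G\<lparr>carrier := B\<rparr>)"
    using assms by (auto simp: borel_subgroup_def closed_conn_solvable_def)
  then show thesis using that solvable_iff_derived[OF B(1)] by blast
qed

theorem borel_SL_flag:
  assumes B: "borel_subgroup n (mat_group n (isom n (0\<^sub>m n n) True)) B"
  obtains F where "full_flag n F" "B = fstab n (isom n (0\<^sub>m n n) True) F"
proof -
  interpret regular_group n "isom n (0\<^sub>m n n) True" adj_mat by (rule regular_isom_SL)
  obtain k where k: "subgroup B G" "connectedin (zariski n) B" "(derived G ^^ k) B = {1\<^sub>m n}"
    using borel_props[OF B] by blast
  obtain F where F: "full_flag n F" "\<forall>j\<le>n. stable n B (F j)" using stable_full_flag[OF k] by blast
  obtain f f' where f: "inv2 n f f'" "\<And>j. j \<le> n \<Longrightarrow> act n f ` coord {..<j} = F j"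
    using flag_basis[OF F(1)] by blast
  have z: "transpose_mat f * 0\<^sub>m n n * f = 0\<^sub>m n n"
    using inv2D(1)[OF f(1)] by simp
  have "closed_conn_solvable n G (fstab n (isom n (0\<^sub>m n n) True) F)"
    by (rule fstab_closed_conn_solvable[OF regular_isom_SL _ F(1) f]) (auto simp: z torus_connected_SL)
  from borel_eqI[OF B F(1) _ this] F that show thesis by blast
qed

theorem (in form_group) borel_form_flag:
  assumes B: "borel_subgroup n G B" and d: "d \<or> even n"
  obtains F f f' where "full_flag n F" "B = fstab n (isom n S d) F"
    "\<And>j. j \<le> n \<Longrightarrow> F (n - j) = perp n S (F j)"
    "inv2 n f f'" "\<And>j. j \<le> n \<Longrightarrow> act n f ` coord {..<j} = F j"
proof -
  obtain k where k: "subgroup B G" "connectedin (zariski n) B" "(derived G ^^ k) B = {1\<^sub>m n}"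
    using borel_props[OF B] by blast
  obtain F where F: "full_flag n F" "\<forall>j\<le>n. stable n B (F j)" "\<forall>j\<le>n. F (n - j) = perp n S (F j)"
    using self_dual_stable_flag[OF k] by blast
  obtain f f' where f: "inv2 n f f'" "\<And>j. j \<le> n \<Longrightarrow> act n f ` coord {..<j} = F j"
      "\<And>i j. i < n \<Longrightarrow> j < n \<Longrightarrow> (transpose_mat f * S * f) $$ (i, j) \<noteq> 0 \<Longrightarrow> i + j + 1 = n"
      "\<And>i. i < n \<Longrightarrow> (transpose_mat f * S * f) $$ (i, n - 1 - i) \<noteq> 0"
    using adapted_basis[OF F(1)] F(3) by blast
  have "closed_conn_solvable n G (fstab n (isom n S d) F)"
    by (rule fstab_closed_conn_solvable[OF regular_group_axioms S_carrier F(1) f(1,2,3) torus_connected_antidiag[OF f(3,4) d]])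
  from borel_eqI[OF B F(1) _ this] F f that show thesis by blast
qed

section \<open>Maximal parabolic subgroups of the special linear group\<close>

abbreviation elem :: "nat \<Rightarrow> nat \<Rightarrow> nat \<Rightarrow> complex \<Rightarrow> complex mat" where
  "elem n i j s \<equiv> addrow_mat n s i j"

lemma mult_square: "A \<in> carrier_mat n n \<Longrightarrow> B \<in> carrier_mat n n \<Longrightarrow> A * B \<in> carrier_mat n n"
  by (rule mult_carrier_mat)

lemma act_elem:
  assumes "i < n" "j < n" "x \<in> V n" shows "act n (elem n i j s) x = addc i j s x"
proof
  fix a
  show "act n (elem n i j s) x a = addc i j s x a"
  proof (cases "a < n")
    case True
    have "act n (elem n i j s) x a = (\<Sum>b<n. (if a = b then x b else 0) + (if i = a \<and> j = b then s * x b else 0))"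
    proof -
      have "elem n i j s $$ (a, b) * x b = (if a = b then x b else 0) + (if i = a \<and> j = b then s * x b else 0)"
        if "b < n" for b
        using that True by (cases "i = a \<and> j = b"; cases "a = b") (auto simp: algebra_simps)
      then show ?thesis unfolding act_def using True by (auto intro!: sum.cong)
    qed
    also have "\<dots> = (\<Sum>b<n. if a = b then x b else 0) + (\<Sum>b<n. if i = a \<and> j = b then s * x b else 0)"
      by (rule sum.distrib)
    also have "(\<Sum>b<n. if a = b then x b else 0) = x a" using True by simp
    also have "(\<Sum>b<n. if i = a \<and> j = b then s * x b else 0) = (if i = a then s * x j else 0)"
      using assms by (cases "i = a") auto
    finally show ?thesis by (auto simp: addc_def)
  next
    case False
    then show ?thesis using assms by (auto simp: act_def addc_def coord_def)
  qed
qed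

lemma addc_V: "i < n \<Longrightarrow> x \<in> V n \<Longrightarrow> addc i j s x \<in> V n"
  by (auto simp: addc_def coord_def)

text \<open>A group that contains the upper triangular matrices of determinant 1; every parabolic
  subgroup of the special linear group is conjugate to one.\<close>

locale overgroup =
  fixes n :: nat and T :: "complex mat set"
  assumes T_mult: "\<And>t u. t \<in> T \<Longrightarrow> u \<in> T \<Longrightarrow> t * u \<in> T"
    and T_inv: "\<And>t. t \<in> T \<Longrightarrow> \<exists>t'\<in>T. inv2 n t t'"
    and T_upper: "\<And>t. t \<in> carrier_mat n n \<Longrightarrow> upper n t \<Longrightarrow> det t = 1 \<Longrightarrow> t \<in> T"
begin

definition contains_root :: "nat \<Rightarrow> nat \<Rightarrow> bool" where
  "contains_root i j \<longleftrightarrow> (\<forall>s. elem n i j s \<in> T)"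

lemma one_T: "1\<^sub>m n \<in> T" by (rule T_upper) (auto simp: upper_def)

lemma upper_root: "i < j \<Longrightarrow> contains_root i j"
  unfolding contains_root_def by (auto intro!: T_upper simp: upper_def det_addrow_mat)

text \<open>The elementary matrix at \<open>(k, j)\<close> is a commutator of those at \<open>(k, i)\<close> and \<open>(i, j)\<close>.\<close>

lemma contains_root_trans:
  assumes "contains_root k i" "contains_root i j" "k \<noteq> i" "i \<noteq> j" "k \<noteq> j" "k < n" "i < n" "j < n"
  shows "contains_root k j"
  unfolding contains_root_def
proof
  fix s
  let ?m = "elem n k i 1 * (elem n i j s * (elem n k i (- 1) * elem n i j (- s)))"
  have "?m \<in> T" using assms(1,2) by (auto simp: contains_root_def intro!: T_mult)
  moreover have "?m = elem n k j s"
  proof (rule act_eqI)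
    fix x assume x: "x \<in> V n"
    have "act n ?m x = addc k i 1 (addc i j s (addc k i (- 1) (addc i j (- s) x)))"
      using assms(6-8) x by (simp add: act_mult mult_square act_elem addc_V)
    also have "\<dots> = addc k j s x" using assms(3-5) by (auto simp: addc_def fun_eq_iff algebra_simps)
    finally show "act n ?m x = act n (elem n k j s) x" using assms x by (simp add: act_elem)
  qed auto
  ultimately show "elem n k j s \<in> T" by simp
qed

text \<open>If \<open>g\<close> moves the coordinate subspace of dimension \<open>k\<close>, some upper triangular transvection
  has a conjugate \<open>v \<mapsto> v + t \<psi>(v) x\<close> by \<open>g\<close> for which \<open>x\<close> lies outside that subspace and the
  functional \<open>\<psi>\<close> does not vanish on it. Conjugation by the triangular matrix \<open>c\<close>, which carries
  \<open>e\<^sub>i\<close> to a multiple of \<open>x\<close> and turns \<open>\<psi>\<close> into a multiple of the coordinate \<open>j0\<close>, makes it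
  elementary at \<open>(i, j0)\<close> with \<open>j0 < k \<le> i\<close>. Commutators with upper triangular elementary matrices
  move it to \<open>(k, k - 1)\<close>.\<close>

lemma lower_root:
  assumes k: "0 < k" "k < n" and g: "g \<in> T" "\<not> act n g ` coord {..<k} \<subseteq> coord {..<k}"
  shows "contains_root k (k - 1)"
proof -
  obtain g' where g': "g' \<in> T" "inv2 n g g'" using T_inv[OF g(1)] by blast
  note gC = inv2D(1,2)[OF g'(2)]
  have kV: "coord {..<k} \<subseteq> V n" using k by (auto simp: coord_def)
  have entry: "\<exists>i j. k \<le> i \<and> i < n \<and> j < k \<and> u $$ (i, j) \<noteq> 0"
    if "\<not> act n u ` coord {..<k} \<subseteq> coord {..<k}" for u
    using that k coord_stable_iff[of k n u] by auto
  obtain i0 j where ij: "k \<le> i0" "i0 < n" "j < k" "g $$ (i0, j) \<noteq> 0" using entry[OF g(2)] by blast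
  have "\<not> act n g' ` coord {..<k} \<subseteq> coord {..<k}"
    using invariant_image_eq(2)[OF inv2D(5)[OF g'(2)] subsp_coord kV] g(2) by auto
  then obtain l j1 where l: "k \<le> l" "l < n" "j1 < k" "g' $$ (l, j1) \<noteq> 0" using entry by blast
  define x where "x = act n g (unit j)"
  define \<psi> where "\<psi> p = g' $$ (l, p)" for p
  have xV: "x \<in> V n" by (simp add: x_def)
  have \<psi>: "act n g' v l = (\<Sum>p<n. \<psi> p * v p)" for v using l by (simp add: act_def \<psi>_def)
  have "act n g' x l = unit j l" unfolding x_def using inv2D(7)[OF g'(2) unit_V] ij k by simp
  then have \<psi>x: "(\<Sum>p<n. \<psi> p * x p) = 0" using \<psi> l ij by (simp add: unit_def)
  have xi0: "x i0 \<noteq> 0" using ij k by (simp add: x_def act_unit)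
  then have "x \<noteq> (\<lambda>_. 0)" by auto
  then obtain i where i: "i < n" "lead i x" using lead_exists[OF xV] by blast
  have xi: "x i \<noteq> 0" "\<And>a. i < a \<Longrightarrow> x a = 0" using i(2) by (auto simp: lead_def)
  have ik: "k \<le> i" using xi(2)[of i0] xi0 ij(1) by (cases "i < i0") auto
  define j0 where "j0 = (LEAST p. \<psi> p \<noteq> 0)"
  have ex: "\<psi> j1 \<noteq> 0" using l by (simp add: \<psi>_def)
  then have \<psi>j: "\<psi> j0 \<noteq> 0" unfolding j0_def by (rule LeastI)
  have \<psi>lt: "\<psi> p = 0" if "p < j0" for p using not_less_Least that unfolding j0_def by blast
  have j0: "j0 < k" using Least_le[of "\<lambda>p. \<psi> p \<noteq> 0", OF ex] l(3) by (simp add: j0_def)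
  define c where "c = mat n n (\<lambda>(a, p). if p = i then x a / x i
      else (if a = p then 1 else 0) - (if a = j0 \<and> j0 < p then \<psi> p / \<psi> j0 else 0))"
  have cC: "c \<in> carrier_mat n n" by (simp add: c_def)
  have cup: "upper n c" using xi(2) by (auto simp: upper_def c_def)
  have "c $$ (a, a) = 1" if "a < n" for a using that xi(1) by (auto simp: c_def)
  then have "det c = 1" using det_upper[OF cC cup] by simp
  then have cT: "c \<in> T" by (rule T_upper[OF cC cup])
  then obtain c' where c': "c' \<in> T" "inv2 n c c'" using T_inv by blast
  have cei: "act n c (unit i) = (\<lambda>a. x a / x i)"
    using i(1) xV by (auto simp: act_unit c_def coord_def)
  have \<psi>c: "(\<Sum>a<n. \<psi> a * c $$ (a, p)) = (if p = j0 then \<psi> j0 else 0)" if p: "p < n" for p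
  proof (cases "p = i")
    case True
    have "(\<Sum>a<n. \<psi> a * c $$ (a, p)) = (\<Sum>a<n. \<psi> a * x a) / x i"
      unfolding sum_divide_distrib using True p by (intro sum.cong) (auto simp: c_def)
    then show ?thesis using \<psi>x True ik j0 by simp
  next
    case False
    have "(\<Sum>a<n. \<psi> a * c $$ (a, p))
        = (\<Sum>a<n. (if a = p then \<psi> a else 0) - (if a = j0 then (if j0 < p then \<psi> p else 0) else 0))"
      using False p \<psi>j by (intro sum.cong) (auto simp: c_def)
    also have "\<dots> = \<psi> p - (if j0 < p then \<psi> p else 0)"
      using p j0 k by (simp add: sum_subtractf)
    also have "\<dots> = (if p = j0 then \<psi> j0 else 0)" using \<psi>lt[of p] by auto
    finally show ?thesis .
  qed
  have \<psi>cv: "act n g' (act n c v) l = \<psi> j0 * v j0" for v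
  proof -
    have "act n g' (act n c v) l = (\<Sum>a<n. \<Sum>p<n. \<psi> a * c $$ (a, p) * v p)"
      unfolding \<psi> by (auto simp: act_def sum_distrib_left mult.assoc intro!: sum.cong)
    also have "\<dots> = (\<Sum>p<n. \<Sum>a<n. \<psi> a * c $$ (a, p) * v p)" by (rule sum.swap)
    also have "\<dots> = (\<Sum>p<n. (if p = j0 then \<psi> j0 else 0) * v p)"
      by (intro sum.cong refl) (simp flip: sum_distrib_right add: \<psi>c)
    also have "\<dots> = (\<Sum>p<n. if p = j0 then \<psi> j0 * v p else 0)" by (intro sum.cong) auto
    also have "\<dots> = \<psi> j0 * v j0" using j0 k by simp
    finally show ?thesis .
  qed
  have root: "contains_root i j0" unfolding contains_root_def
  proof
    fix s
    define t where "t = s / (\<psi> j0 * x i)"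
    let ?m = "c' * (g * (elem n j l t * (g' * c)))"
    have jl: "j < n" "j < l" using ij l k by auto
    have "elem n j l t \<in> T" using upper_root[OF jl(2)] by (simp add: contains_root_def)
    then have "?m \<in> T" using c'(1) cT g(1) g'(1) by (intro T_mult)
    moreover have "?m = elem n i j0 s"
    proof (rule act_eqI)
      note C = gC cC inv2D(2)[OF c'(2)]
      fix v assume v: "v \<in> V n"
      have "act n (g * (elem n j l t * (g' * c))) v = act n g (addc j l t (act n g' (act n c v)))"
        using C l jl by (simp add: act_mult mult_square act_elem)
      also have "addc j l t (act n g' (act n c v)) = (\<lambda>a. 1 * act n g' (act n c v) a + (t * (\<psi> j0 * v j0)) * unit j a)"
        by (auto simp: addc_def unit_def \<psi>cv)
      also have "act n g \<dots> = (\<lambda>a. act n c v a + (t * (\<psi> j0 * v j0)) * x a)"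
        unfolding act_comb x_def using inv2D(6)[OF g'(2)] by simp
      also have "\<dots> = act n c (\<lambda>a. 1 * v a + (s * v j0) * unit i a)"
        unfolding act_comb cei t_def using \<psi>j xi(1) by (auto simp: fun_eq_iff)
      also have "(\<lambda>a. 1 * v a + (s * v j0) * unit i a) = addc i j0 s v" by (auto simp: addc_def unit_def)
      finally have "act n (g * (elem n j l t * (g' * c))) v = act n c (addc i j0 s v)" .
      then have "act n ?m v = act n c' (act n c (addc i j0 s v))"
        using C by (simp add: act_mult mult_square)
      also have "\<dots> = addc i j0 s v" by (rule inv2D(7)[OF c'(2) addc_V[OF i(1) v]])
      finally show "act n ?m v = act n (elem n i j0 s) v" using i(1) j0 k v by (simp add: act_elem)
    qed (use inv2D(2)[OF c'(2)] gC cC in auto)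
    ultimately show "elem n i j0 s \<in> T" by simp
  qed
  have "contains_root k j0"
  proof (cases "k = i")
    case False
    then show ?thesis using contains_root_trans[OF upper_root[of k i] root] ik i j0 k by auto
  qed (use root in simp)
  then show ?thesis
  proof (cases "j0 = k - 1")
    case False
    then have "j0 < k - 1" using j0 by simp
    then show ?thesis
      using contains_root_trans[OF \<open>contains_root k j0\<close> upper_root[of j0 "k - 1"]] k by auto
  qed simp
qed

lemma all_roots:
  assumes "\<And>k. 0 < k \<Longrightarrow> k < n \<Longrightarrow> contains_root k (k - 1)" "i < n" "j < n" "i \<noteq> j"
  shows "contains_root i j"
proof (cases "i < j")
  case False
  have "contains_root i j" if "j < i" "i < n" for i
    using that
  proof (induction "i - j" arbitrary: i rule: less_induct)
    case less
    show ?case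
    proof (cases "i = Suc j")
      case False
      then have "contains_root (i - 1) j" using less by (intro less.hyps) auto
      then show ?thesis using contains_root_trans[OF assms(1)[of i]] less.prems False by auto
    qed (use assms(1)[of i] less.prems in auto)
  qed
  then show ?thesis using False assms by auto
qed (rule upper_root)

text \<open>Gaussian elimination by elementary row operations: \<open>c\<close> counts the columns that are already
  unit vectors. A nonzero entry below the diagonal is used to make the diagonal entry 1, and then
  the column is cleared. If there is no such entry, one is created, except in the last column,
  where the determinant gives the diagonal entry.\<close>

lemma SL_generated:
  assumes roots: "\<And>i j. i < n \<Longrightarrow> j < n \<Longrightarrow> i \<noteq> j \<Longrightarrow> contains_root i j"
    and g: "g \<in> carrier_mat n n" "det g = 1"
  shows "g \<in> T"
proof -
  have step: "g \<in> T" if E: "elem n i j s * g \<in> T" and ij: "i < n" "j < n" "i \<noteq> j" and gC: "g \<in> carrier_mat n n" for g i j s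
  proof -
    have "elem n i j (- s) \<in> T" using roots[OF ij] by (simp add: contains_root_def)
    from T_mult[OF this E] have "elem n i j (- s) * (elem n i j s * g) \<in> T" .
    moreover have "elem n i j (- s) * (elem n i j s * g) = g"
    proof (rule act_eqI)
      fix x assume "x \<in> V n"
      then show "act n (elem n i j (- s) * (elem n i j s * g)) x = act n g x"
        using ij gC by (simp add: act_mult mult_square act_elem addc_V) (auto simp: addc_def fun_eq_iff)
    qed (use gC in auto)
    ultimately show ?thesis by simp
  qed
  have detE: "det (elem n i j s * g) = 1 \<and> elem n i j s * g \<in> carrier_mat n n"
    if "i \<noteq> j" "g \<in> carrier_mat n n" "det g = 1" for i j s g
    using that by (simp add: det_mult[of _ n] det_addrow_mat mult_square)
  have "\<forall>g. g \<in> carrier_mat n n \<and> det g = 1 \<and> (\<forall>b<c. act n g (unit b) = unit b) \<longrightarrow> g \<in> T" if "c \<le> n" for c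
    using that
  proof (induction "n - c" arbitrary: c)
    case 0
    show ?case
    proof (intro allI impI, elim conjE)
      fix g assume g: "g \<in> carrier_mat n n" "\<forall>b<c. act n g (unit b) = unit b"
      have "g = 1\<^sub>m n"
      proof (rule eq_matI)
        fix a b assume ab: "a < dim_row (1\<^sub>m n)" "b < dim_col (1\<^sub>m n)"
        then have "act n g (unit b) = unit b" using g(2) 0 by auto
        then have "act n g (unit b) a = unit b a" by simp
        then have "g $$ (a, b) = unit b a" using ab by (simp add: act_unit)
        then show "g $$ (a, b) = 1\<^sub>m n $$ (a, b)" using ab by (simp add: unit_def)
      qed (use g in auto)
      then show "g \<in> T" using one_T by simp
    qed
  next
    case (Suc d)
    then have c: "c < n" by simp
    have IH: "g \<in> T" if "g \<in> carrier_mat n n" "det g = 1" "\<forall>b<Suc c. act n g (unit b) = unit b" for g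
      using Suc(1)[of "Suc c"] Suc(2) c that by auto
    have cols: "\<forall>b<c. act n (elem n i j s * g) (unit b) = unit b"
      if "i < n" "j < n" "c \<le> j" "g \<in> carrier_mat n n" "\<forall>b<c. act n g (unit b) = unit b" for i j s g
    proof (intro allI impI)
      fix b assume b: "b < c"
      then have "act n (elem n i j s * g) (unit b) = addc i j s (unit b)"
        using that c by (simp add: act_mult mult_square act_elem unit_V)
      also have "\<dots> = unit b" using that(3) b by (auto simp: addc_def unit_def fun_eq_iff)
      finally show "act n (elem n i j s * g) (unit b) = unit b" .
    qed
    have colc: "act n (elem n i j s * g) (unit c) = addc i j s (act n g (unit c))"
      if "i < n" "j < n" "g \<in> carrier_mat n n" for i j s g
      using that by (simp add: act_mult mult_square act_elem)
    have clear: "g \<in> T" if "g \<in> carrier_mat n n" "det g = 1" "\<forall>b<c. act n g (unit b) = unit b"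
      "act n g (unit c) c = 1" "\<forall>a<n. m \<le> a \<and> a \<noteq> c \<longrightarrow> act n g (unit c) a = 0" "m \<le> n" for m g
      using that
    proof (induction m arbitrary: g)
      case 0
      have "act n g (unit c) a = unit c a" for a
        using "0.prems"(4,5) by (cases "a < n") (auto simp: unit_def act_def)
      then have "act n g (unit c) = unit c" by blast
      then show ?case using "0.prems" by (intro IH) (auto simp: less_Suc_eq)
    next
      case (Suc m)
      show ?case
      proof (cases "m = c")
        case True
        then show ?thesis using Suc.prems by (intro Suc.IH) (auto simp: le_eq_less_or_eq Suc_le_eq)
      next
        case False
        let ?g = "elem n m c (- act n g (unit c) m) * g"
        have m: "m < n" using Suc.prems by simp
        have col: "act n ?g (unit c) = addc m c (- act n g (unit c) m) (act n g (unit c))"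
          by (rule colc[OF m c Suc.prems(1)])
        have "?g \<in> T"
        proof (rule Suc.IH)
          show "?g \<in> carrier_mat n n" "det ?g = 1" using detE[OF False Suc.prems(1,2)] by auto
          show "\<forall>b<c. act n ?g (unit b) = unit b" by (rule cols[OF m c le_refl Suc.prems(1,3)])
          show "act n ?g (unit c) c = 1" unfolding col using False Suc.prems(4) by (simp add: addc_def)
          show "\<forall>a<n. m \<le> a \<and> a \<noteq> c \<longrightarrow> act n ?g (unit c) a = 0"
            unfolding col using Suc.prems(4,5) by (auto simp: addc_def le_eq_less_or_eq Suc_le_eq)
        qed (use m in simp)
        then show ?thesis by (rule step[OF _ m c False Suc.prems(1)])
      qed
    qed
    have pivot: "g \<in> T" if g: "g \<in> carrier_mat n n" "det g = 1" "\<forall>b<c. act n g (unit b) = unit b"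
      and a: "c < a" "a < n" "act n g (unit c) a \<noteq> 0" for g a
    proof -
      let ?y = "act n g (unit c)"
      let ?s = "(1 - ?y c) / ?y a"
      let ?g = "elem n c a ?s * g"
      have ca: "c \<noteq> a" using a by simp
      have "?g \<in> T"
      proof (rule clear[where m = n])
        show "?g \<in> carrier_mat n n" "det ?g = 1" using detE[OF ca g(1,2)] by auto
        show "\<forall>b<c. act n ?g (unit b) = unit b" by (rule cols[OF c a(2) _ g(1,3)]) (use a in simp)
        show "act n ?g (unit c) c = 1" unfolding colc[OF c a(2) g(1)] using a by (simp add: addc_def)
      qed auto
      then show ?thesis by (rule step[OF _ c a(2) ca g(1)])
    qed
    show ?case
    proof (intro allI impI, elim conjE)
      fix g assume g: "g \<in> carrier_mat n n" "det g = 1" "\<forall>b<c. act n g (unit b) = unit b"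
      let ?y = "act n g (unit c)"
      show "g \<in> T"
      proof (cases "\<exists>a. c < a \<and> a < n \<and> ?y a \<noteq> 0")
        case True
        then show ?thesis using pivot[OF g] by blast
      next
        case False
        have ent: "g $$ (a, b) = (if a = b then 1 else 0)" if "b < c" "a < n" for a b
        proof -
          have "act n g (unit b) a = unit b a" using g(3) that by simp
          then have "g $$ (a, b) = unit b a" using that c by (simp add: act_unit)
          then show ?thesis by (simp add: unit_def)
        qed
        have yc: "?y c \<noteq> 0"
        proof
          assume 0: "?y c = 0"
          let ?v = "\<lambda>a. unit c a - ?y a"
          have y0: "?y a = 0" if "c \<le> a" for a
            using that 0 False by (cases "a = c"; cases "a < n") (auto simp: act_def)
          have "act n g ?y = ?y"
          proof
            fix a
            show "act n g ?y a = ?y a"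
            proof (cases "a < n")
              case True
              have "act n g ?y a = (\<Sum>b<n. g $$ (a, b) * ?y b)" using True by (simp add: act_def)
              also have "\<dots> = (\<Sum>b<n. if b = a then ?y b else 0)"
              proof (intro sum.cong refl)
                fix b assume "b \<in> {..<n}"
                show "g $$ (a, b) * ?y b = (if b = a then ?y b else 0)"
                  using ent[of b a] True y0[of b] by (cases "b < c") auto
              qed
              finally show ?thesis using True by simp
            qed (simp add: act_def)
          qed
          then have "act n g ?v = (\<lambda>_. 0)" by (simp add: act_diff)
          moreover obtain g' where "inv2 n g g'"
          proof -
            have "inv2 n g (adj_mat g)" using adj_mat[OF g(1)] g by (auto simp: inv2_def)
            then show thesis using that by blast
          qed
          ultimately have "?v = (\<lambda>_. 0)"
            using inv2D(7)[of n g g' ?v] subsp_diff[OF subsp_coord unit_V[OF c] act_V] by (simp add: act_zero)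
          from fun_cong[OF this, of c] show False using 0 by (simp add: unit_def)
        qed
        show ?thesis
        proof (cases "Suc c < n")
          case True
          let ?g = "elem n (Suc c) c 1 * g"
          have "?g \<in> T"
          proof (rule pivot[where a = "Suc c"])
            show "?g \<in> carrier_mat n n" "det ?g = 1" using detE[OF _ g(1,2), of "Suc c" c] by auto
            show "\<forall>b<c. act n ?g (unit b) = unit b" by (rule cols[OF True c le_refl g(1,3)])
            show "act n ?g (unit c) (Suc c) \<noteq> 0"
              unfolding colc[OF True c g(1)] using False True yc by (simp add: addc_def)
          qed (use True in auto)
          then show ?thesis by (rule step[OF _ True c _ g(1)]) simp
        next
          case last: False
          then have cn: "n = Suc c" using c by simp
          have "upper n g" unfolding upper_def using ent cn by auto
          then have "det g = (\<Prod>b<n. g $$ (b, b))" by (rule det_upper[OF g(1)])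
          also have "\<dots> = g $$ (c, c)" unfolding cn using ent cn by simp
          finally have "?y c = 1" using g(2) c by (simp add: act_unit)
          then show ?thesis by (intro clear[of g n] g) auto
        qed
      qed
    qed
  qed
  from this[of 0] show ?thesis using g by simp
qed

text \<open>A group that moves every coordinate subspace contains all elementary matrices directly below
  the diagonal, hence all elementary matrices, and these generate the special linear group.\<close>

theorem overgroup_dichotomy:
  "(\<exists>k. 0 < k \<and> k < n \<and> (\<forall>t\<in>T. act n t ` coord {..<k} \<subseteq> coord {..<k})) \<or>
   (\<forall>g\<in>carrier_mat n n. det g = 1 \<longrightarrow> g \<in> T)"
  using lower_root all_roots SL_generated by metis

end

lemma SL_isom: "SL n = mat_group n (isom n (0\<^sub>m n n) True)"
proof -
  have "{g \<in> carrier_mat n n. det g = (1::complex)} = isom n (0\<^sub>m n n) True"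
    by (auto simp: isom_def)
  then show ?thesis by (simp add: SL_def)
qed

text \<open>In a basis of the flag of a Borel subgroup of \<open>P\<close>, the group \<open>P\<close> becomes an overgroup \<open>T\<close> of
  the upper triangular matrices. It is a proper subgroup, so it preserves some \<open>F k\<close>. The
  stabilizer of \<open>F k\<close> is a proper parabolic subgroup too, and it equals \<open>P\<close> by maximality.\<close>

theorem maximal_parabolic_contains_stabilizer:
  assumes P: "maximal_parabolic n (SL n) P"
  obtains W where "subsp W" "W \<subseteq> V n" "\<And>g. g \<in> carrier (SL n) \<Longrightarrow> act n g ` W \<subseteq> W \<Longrightarrow> g \<in> P"
proof -
  let ?X = "isom n (0\<^sub>m n n) True"
  interpret regular_group n ?X adj_mat by (rule regular_isom_SL)
  have par: "parabolic n G P" "P \<noteq> ?X" and max: "\<And>P'. parabolic n G P' \<Longrightarrow> P' \<noteq> ?X \<Longrightarrow> P \<subseteq> P' \<Longrightarrow> P' = P"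
    using P by (auto simp: maximal_parabolic_def SL_isom)
  obtain B where B: "borel_subgroup n G B" "B \<subseteq> P" and Psub: "subgroup P G"
    using par(1) by (auto simp: parabolic_def)
  obtain F where F: "full_flag n F" "B = fstab n ?X F" using borel_SL_flag[OF B(1)] by blast
  obtain f f' where f: "inv2 n f f'" "\<And>j. j \<le> n \<Longrightarrow> act n f ` coord {..<j} = F j"
    using flag_basis[OF F(1)] by blast
  note C = inv2D(1,2)[OF f(1)]
  have z: "transpose_mat t * 0\<^sub>m n n * t = 0\<^sub>m n n" if "t \<in> carrier_mat n n" for t :: "complex mat"
    using that by simp
  have cj: "f * t * f' \<in> ?X \<longleftrightarrow> det t = 1" "f' * (f * t * f') * f = t" if "t \<in> carrier_mat n n" for t
    using conj_isom(1)[where S = "0\<^sub>m n n" and d = True, OF _ f(1) refl that]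
      conj_isom(2)[where S = "0\<^sub>m n n", OF _ f(1) refl that] z[OF C(1)] z[OF that] by auto
  have FC: "act n (f * t * f') ` F j \<subseteq> F j \<longleftrightarrow> act n t ` coord {..<j} \<subseteq> coord {..<j}"
    if t: "t \<in> carrier_mat n n" and j: "j \<le> n" for t j
  proof -
    have jV: "coord {..<j} \<subseteq> V n" using j by (auto simp: coord_def)
    have "act n (f * t * f') ` F j = act n f ` (act n t ` (act n f' ` (act n f ` coord {..<j})))"
      using C t by (simp add: f(2)[OF j, symmetric] image_image act_mult)
    also have "\<dots> = act n f ` (act n t ` coord {..<j})"
      by (simp only: inv2_image_cancel[OF f(1) jV])
    finally have e: "act n (f * t * f') ` F j = act n f ` (act n t ` coord {..<j})" .
    have tV: "act n t ` coord {..<j} \<subseteq> V n" by auto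
    show ?thesis unfolding e unfolding f(2)[OF j, symmetric]
      using inv2_image_cancel[OF f(1) jV] inv2_image_cancel[OF f(1) tV] by (metis image_mono)
  qed
  define T where "T = {t \<in> carrier_mat n n. f * t * f' \<in> P}"
  have conj_mult: "f * (t * u) * f' = (f * t * f') * (f * u * f')"
    if "t \<in> carrier_mat n n" "u \<in> carrier_mat n n" for t u
    by (rule act_eqI) (use that C in \<open>auto simp: act_mult inv2D(7)[OF f(1)]\<close>)
  have undo: "f * (f' * g * f) * f' = g" if "g \<in> carrier_mat n n" for g
    by (rule act_eqI) (use that C in \<open>auto simp: act_mult inv2D(6)[OF f(1)]\<close>)
  interpret T: overgroup n T
  proof
    show "t * u \<in> T" if "t \<in> T" "u \<in> T" for t u
      using that subgroup_props(3)[OF Psub] conj_mult by (auto simp: T_def)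
    show "\<exists>t'\<in>T. inv2 n t t'" if "t \<in> T" for t
    proof -
      have t: "t \<in> carrier_mat n n" "f * t * f' \<in> P" using that by (auto simp: T_def)
      let ?g = "f * t * f'"
      let ?t' = "f' * adj_mat ?g * f"
      have g: "inv2 n ?g (adj_mat ?g)" by (rule inv_props(4)[OF subsetD[OF subgroup_props(1)[OF Psub] t(2)]])
      have "inv2 n (f' * ?g * f) (f' * (adj_mat ?g * f))"
        by (rule inv2_mult[OF inv2_mult[OF inv2D(5)[OF f(1)] g] f(1)])
      moreover have "f' * (adj_mat ?g * f) = ?t'"
        by (rule assoc_mult_mat[symmetric, OF C(2) inv2D(2)[OF g] C(1)])
      ultimately have i: "inv2 n t ?t'" using cj(2)[OF t(1)] by simp
      have "f * ?t' * f' = adj_mat ?g" by (rule undo[OF inv2D(2)[OF g]])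
      then have "?t' \<in> T" using inv2D(2)[OF i] subgroup_props(4)[OF Psub t(2)] by (simp add: T_def)
      then show ?thesis using i by blast
    qed
    show "t \<in> T" if t: "t \<in> carrier_mat n n" "upper n t" "det t = 1" for t
    proof -
      have "\<forall>j\<le>n. act n t ` coord {..<j} \<subseteq> coord {..<j}" using t upper_iff by blast
      then have "f * t * f' \<in> B" unfolding F(2) fstab_def using FC t cj(1) by auto
      then show ?thesis using B(2) t(1) by (auto simp: T_def)
    qed
  qed
  have "\<not> (\<forall>g\<in>carrier_mat n n. det g = 1 \<longrightarrow> g \<in> T)"
  proof
    assume all: "\<forall>g\<in>carrier_mat n n. det g = 1 \<longrightarrow> g \<in> T"
    have "g \<in> P" if g: "g \<in> ?X" for g
    proof -
      have gC: "g \<in> carrier_mat n n" using g X_carrier by blast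
      let ?t = "f' * g * f"
      have t: "?t \<in> carrier_mat n n" using C gC by auto
      have "det ?t = 1" using cj(1)[OF t] undo[OF gC] g by simp
      then have "?t \<in> T" using all t by blast
      then show ?thesis using undo[OF gC] by (simp add: T_def)
    qed
    then show False using par(2) subgroup_props(1)[OF Psub] by blast
  qed
  then obtain k where k: "0 < k" "k < n" "\<forall>t\<in>T. act n t ` coord {..<k} \<subseteq> coord {..<k}"
    using T.overgroup_dichotomy by blast
  note FD = full_flagD[OF F(1)]
  have Fk: "subsp (F k)" "F k \<subseteq> V n" using FD(1,2) k by auto
  let ?P = "{g \<in> ?X. act n g ` F k \<subseteq> F k}"
  have "P \<subseteq> ?P"
  proof
    fix g assume g: "g \<in> P"
    then have gX: "g \<in> ?X" "g \<in> carrier_mat n n" using subgroup_props(1)[OF Psub] X_carrier by auto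
    let ?t = "f' * g * f"
    have t: "?t \<in> carrier_mat n n" using C gX by auto
    have "?t \<in> T" using g t undo[OF gX(2)] by (simp add: T_def)
    then have "act n g ` F k \<subseteq> F k" using FC[OF t, of k] undo[OF gX(2)] k by auto
    then show "g \<in> ?P" using gX by blast
  qed
  moreover have "parabolic n G ?P"
    unfolding parabolic_def
  proof (intro conjI exI[of _ B])
    show "subgroup ?P G"
    proof (rule subgroupI')
      show "1\<^sub>m n \<in> ?P" using one_X Fk(2) act_one by (auto simp: subset_iff)
      show "g * h \<in> ?P" if "g \<in> ?P" "h \<in> ?P" for g h
        using that mult_X by (auto simp: act_prod) blast
      show "adj_mat g \<in> ?P" if "g \<in> ?P" for g
        using that invariant_image_eq(2)[OF inv_props(4) Fk] inv_props(1) by auto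
    qed auto
    have "closedin (zariski n) {g \<in> ?X. \<forall>(i, j)\<in>{(i, j). k \<le> i \<and> i < n \<and> j < k}. (f' * g * f) $$ (i, j) = 0}"
      by (rule stabilizer_closed[OF f(1) isom_closed]) (use k in auto)
    moreover have "{g \<in> ?X. \<forall>(i, j)\<in>{(i, j). k \<le> i \<and> i < n \<and> j < k}. (f' * g * f) $$ (i, j) = 0} = ?P"
    proof -
      have "(\<forall>(i, j)\<in>{(i, j). k \<le> i \<and> i < n \<and> j < k}. (f' * g * f) $$ (i, j) = 0) \<longleftrightarrow> act n g ` F k \<subseteq> F k"
        if g: "g \<in> ?X" for g
      proof -
        have gC: "g \<in> carrier_mat n n" using g X_carrier by blast
        define t where "t = f' * g * f"
        have t: "t \<in> carrier_mat n n" using C gC by (simp add: t_def)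
        have "act n g ` F k \<subseteq> F k \<longleftrightarrow> act n t ` coord {..<k} \<subseteq> coord {..<k}"
          using FC[OF t, of k] undo[OF gC] k by (simp add: t_def)
        also have "\<dots> \<longleftrightarrow> (\<forall>i j. k \<le> i \<and> i < n \<and> j < k \<longrightarrow> t $$ (i, j) = 0)"
          by (rule coord_stable_iff) (use k in simp)
        finally show ?thesis by (auto simp: t_def)
      qed
      then show ?thesis by blast
    qed
    ultimately show "closedin (zariski n) ?P" by simp
    show "borel_subgroup n G B" by (rule B(1))
    show "B \<subseteq> ?P" unfolding F(2) fstab_def using less_imp_le[OF k(2)] by blast
  qed
  moreover have "?P \<noteq> ?X"
  proof
    assume eq: "?P = ?X"
    \<comment> \<open>An elementary matrix that moves the coordinate subspace of dimension \<open>k\<close>.\<close>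
    let ?t = "elem n k (k - 1) 1"
    have "det ?t = 1" using k by (simp add: det_addrow_mat)
    then have "f * ?t * f' \<in> ?X" using cj(1)[of ?t] by simp
    then have "act n ?t ` coord {..<k} \<subseteq> coord {..<k}" using eq FC[of ?t k] k by auto
    moreover have "unit (k - 1) \<in> coord {..<k}" using k by (auto simp: unit_def coord_def)
    ultimately have "act n ?t (unit (k - 1)) \<in> coord {..<k}" by blast
    then have "act n ?t (unit (k - 1)) k = 0" by (auto simp: coord_def)
    moreover have "act n ?t (unit (k - 1)) k = 1" using k by (simp add: act_elem unit_V) (simp add: addc_def unit_def)
    ultimately show False by simp
  qed
  ultimately have "?P = P" by (intro max)
  then show thesis using that[OF Fk] by (auto simp: SL_isom mat_group_def)
qed

section \<open>Counting orbits\<close>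

lemma act_mult_image: "A \<in> carrier_mat n n \<Longrightarrow> B \<in> carrier_mat n n \<Longrightarrow> act n (A * B) ` Z = act n A ` (act n B ` Z)"
  unfolding image_image by (rule image_cong) (simp_all add: act_mult)

lemma l_coset_mat_group: "a <#\<^bsub>mat_group n Y\<^esub> H = (\<lambda>h. a * h) ` H"
  by (auto simp: l_coset_def mat_group_def)

text \<open>It suffices to attach finitely many types to the pairs \<open>(g, k)\<close> such that pairs of equal
  type represent points of the same orbit.\<close>

lemma finite_orbits_pairs:
  fixes R :: "'d \<Rightarrow> complex mat \<Rightarrow> complex mat \<Rightarrow> bool"
  assumes Y: "Y \<subseteq> carrier_mat n n" and K: "regular_group n X \<iota>"
    and P: "P \<subseteq> carrier_mat n n" "\<And>p q. p \<in> P \<Longrightarrow> q \<in> P \<Longrightarrow> p * q \<in> P" "\<And>p. p \<in> P \<Longrightarrow> \<exists>p'\<in>P. p * p' = 1\<^sub>m n"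
    and Q: "Q \<subseteq> carrier_mat n n" "\<And>p q. p \<in> Q \<Longrightarrow> q \<in> Q \<Longrightarrow> p * q \<in> Q" "\<And>p. p \<in> Q \<Longrightarrow> \<exists>p'\<in>Q. p * p' = 1\<^sub>m n"
    and D: "finite D" "\<And>g k. g \<in> Y \<Longrightarrow> k \<in> X \<Longrightarrow> \<exists>d\<in>D. R d g k"
    and R: "\<And>d g k g' k'. g \<in> Y \<Longrightarrow> k \<in> X \<Longrightarrow> g' \<in> Y \<Longrightarrow> k' \<in> X \<Longrightarrow> R d g k \<Longrightarrow> R d g' k' \<Longrightarrow>
      \<exists>\<kappa>\<in>X. \<exists>p\<in>P. \<exists>q\<in>Q. \<kappa> * g = g' * p \<and> \<kappa> * k = k' * q"
  shows "finite (orbits (mat_group n X) ((lcosets\<^bsub>mat_group n Y\<^esub> P) \<times> (lcosets\<^bsub>mat_group n X\<^esub> Q))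
           (\<lambda>k (A, B). (k <#\<^bsub>mat_group n Y\<^esub> A, k <#\<^bsub>mat_group n X\<^esub> B)))"
proof -
  interpret regular_group n X \<iota> by (rule K)
  let ?\<phi> = "\<lambda>k (A, B). (k <#\<^bsub>mat_group n Y\<^esub> A, k <#\<^bsub>mat_group n X\<^esub> B)"
  let ?pt = "\<lambda>g k. ((\<lambda>h. g * h) ` P, (\<lambda>h. k * h) ` Q)"
  let ?orb = "\<lambda>x. orbit (mat_group n X) ?\<phi> x"
  have shift: "(\<lambda>h. g * h) ` ((\<lambda>h. p * h) ` Z) = (\<lambda>h. (g * p) * h) ` Z"
    if "g \<in> carrier_mat n n" "p \<in> carrier_mat n n" "Z \<subseteq> carrier_mat n n" for g p Z
    unfolding image_image by (rule image_cong) (use that in \<open>auto intro!: assoc_mult_mat[symmetric]\<close>)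
  have absorb: "(\<lambda>h. p * h) ` Z = Z" if pZ: "p \<in> Z" and Z: "Z \<subseteq> carrier_mat n n" "\<And>p q. p \<in> Z \<Longrightarrow> q \<in> Z \<Longrightarrow> p * q \<in> Z"
      "\<And>p. p \<in> Z \<Longrightarrow> \<exists>p'\<in>Z. p * p' = 1\<^sub>m n" for p :: "complex mat" and Z
  proof
    show "(\<lambda>h. p * h) ` Z \<subseteq> Z" using pZ Z(2) by auto
    show "Z \<subseteq> (\<lambda>h. p * h) ` Z"
    proof
      fix z assume z: "z \<in> Z"
      obtain p' where p': "p' \<in> Z" "p * p' = 1\<^sub>m n" using Z(3)[OF pZ] by blast
      have C: "p \<in> carrier_mat n n" "p' \<in> carrier_mat n n" "z \<in> carrier_mat n n" using Z(1) pZ p'(1) z by auto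
      have "p * (p' * z) = (p * p') * z" by (rule assoc_mult_mat[symmetric, OF C])
      then have "z = p * (p' * z)" unfolding p'(2) left_mult_one_mat[OF C(3)] ..
      then show "z \<in> (\<lambda>h. p * h) ` Z" using Z(2)[OF p'(1) z] by blast
    qed
  qed
  have orb_shift: "?orb ((\<lambda>h. \<kappa> * h) ` A, (\<lambda>h. \<kappa> * h) ` B) = ?orb (A, B)"
    if \<kappa>: "\<kappa> \<in> X" and AB: "A \<subseteq> carrier_mat n n" "B \<subseteq> carrier_mat n n" for \<kappa> A B
  proof -
    have C: "u \<in> carrier_mat n n" if "u \<in> X" for u using X_carrier that by blast
    have "?\<phi> u ((\<lambda>h. \<kappa> * h) ` A, (\<lambda>h. \<kappa> * h) ` B) = ?\<phi> (u * \<kappa>) (A, B)" if "u \<in> X" for u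
      using shift[OF C[OF that] C[OF \<kappa>]] AB by (simp add: l_coset_mat_group)
    then have "?orb ((\<lambda>h. \<kappa> * h) ` A, (\<lambda>h. \<kappa> * h) ` B) = {?\<phi> (u * \<kappa>) (A, B) |u. u \<in> X}"
      unfolding orbit_def by auto
    also have "\<dots> = {?\<phi> u (A, B) |u. u \<in> X}"
    proof -
      have "\<exists>v. u = v * \<kappa> \<and> v \<in> X" if u: "u \<in> X" for u
      proof (intro exI[of _ "u * \<iota> \<kappa>"] conjI)
        have "u * \<iota> \<kappa> * \<kappa> = u * (\<iota> \<kappa> * \<kappa>)"
          by (rule assoc_mult_mat[OF C[OF u] C[OF inv_props(1)[OF \<kappa>]] C[OF \<kappa>]])
        then show "u = u * \<iota> \<kappa> * \<kappa>" using inv_props(3)[OF \<kappa>] C[OF u] by simp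
        show "u * \<iota> \<kappa> \<in> X" by (rule mult_X[OF u inv_props(1)[OF \<kappa>]])
      qed
      moreover have "u * \<kappa> \<in> X" if "u \<in> X" for u by (rule mult_X[OF that \<kappa>])
      ultimately show ?thesis by blast
    qed
    finally show ?thesis by (simp add: orbit_def)
  qed
  have same: "?orb (?pt g k) = ?orb (?pt g' k')"
    if gk: "g \<in> Y" "k \<in> X" "g' \<in> Y" "k' \<in> X" "R d g k" "R d g' k'" for d g k g' k'
  proof -
    obtain \<kappa> p q where \<kappa>: "\<kappa> \<in> X" "p \<in> P" "q \<in> Q" "\<kappa> * g = g' * p" "\<kappa> * k = k' * q"
      using R[OF gk] by blast
    have C: "g \<in> carrier_mat n n" "g' \<in> carrier_mat n n" "k \<in> carrier_mat n n" "k' \<in> carrier_mat n n"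
      "\<kappa> \<in> carrier_mat n n" "p \<in> carrier_mat n n" "q \<in> carrier_mat n n"
      using gk Y X_carrier \<kappa>(1-3) P(1) Q(1) by auto
    have "(\<lambda>h. \<kappa> * h) ` ((\<lambda>h. g * h) ` P) = (\<lambda>h. g' * h) ` ((\<lambda>h. p * h) ` P)"
      by (simp only: shift[OF C(5,1) P(1)] shift[OF C(2,6) P(1)] \<kappa>(4))
    also have "(\<lambda>h. p * h) ` P = P" by (rule absorb[OF \<kappa>(2) P])
    finally have "(\<lambda>h. \<kappa> * h) ` ((\<lambda>h. g * h) ` P) = (\<lambda>h. g' * h) ` P" .
    moreover have "(\<lambda>h. \<kappa> * h) ` ((\<lambda>h. k * h) ` Q) = (\<lambda>h. k' * h) ` Q"
    proof -
      have "(\<lambda>h. \<kappa> * h) ` ((\<lambda>h. k * h) ` Q) = (\<lambda>h. k' * h) ` ((\<lambda>h. q * h) ` Q)"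
        by (simp only: shift[OF C(5,3) Q(1)] shift[OF C(4,7) Q(1)] \<kappa>(5))
      also have "(\<lambda>h. q * h) ` Q = Q" by (rule absorb[OF \<kappa>(3) Q])
      finally show ?thesis .
    qed
    moreover have "(\<lambda>h. g * h) ` P \<subseteq> carrier_mat n n" "(\<lambda>h. k * h) ` Q \<subseteq> carrier_mat n n"
      using C P(1) Q(1) by auto
    ultimately show ?thesis using orb_shift[OF \<kappa>(1), of "(\<lambda>h. g * h) ` P" "(\<lambda>h. k * h) ` Q"] by (simp only:)
  qed
  define rep where "rep d = (SOME p. fst p \<in> Y \<and> snd p \<in> X \<and> R d (fst p) (snd p))" for d
  have "orbits (mat_group n X) ((lcosets\<^bsub>mat_group n Y\<^esub> P) \<times> (lcosets\<^bsub>mat_group n X\<^esub> Q)) ?\<phi>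
      \<subseteq> (\<lambda>d. ?orb (?pt (fst (rep d)) (snd (rep d)))) ` D"
  proof
    fix O' assume "O' \<in> orbits (mat_group n X) ((lcosets\<^bsub>mat_group n Y\<^esub> P) \<times> (lcosets\<^bsub>mat_group n X\<^esub> Q)) ?\<phi>"
    then obtain A B where AB: "A \<in> lcosets\<^bsub>mat_group n Y\<^esub> P" "B \<in> lcosets\<^bsub>mat_group n X\<^esub> Q" "O' = ?orb (A, B)"
      by (auto simp: orbits_def)
    obtain g where g: "g \<in> Y" "A = (\<lambda>h. g * h) ` P"
      using AB(1) by (auto simp: LCOSETS_def l_coset_mat_group) (auto simp: mat_group_def)
    obtain k where k: "k \<in> X" "B = (\<lambda>h. k * h) ` Q"
      using AB(2) by (auto simp: LCOSETS_def l_coset_mat_group)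
    obtain d where d: "d \<in> D" "R d g k" using D(2)[OF g(1) k(1)] by blast
    have "fst (rep d) \<in> Y \<and> snd (rep d) \<in> X \<and> R d (fst (rep d)) (snd (rep d))"
      unfolding rep_def by (rule someI[of _ "(g, k)"]) (use g k d in auto)
    then have "?orb (?pt g k) = ?orb (?pt (fst (rep d)) (snd (rep d)))"
      using same[OF g(1) k(1) _ _ d(2)] by blast
    then show "O' \<in> (\<lambda>d. ?orb (?pt (fst (rep d)) (snd (rep d)))) ` D"
      using d(1) AB(3) g(2) k(2) by blast
  qed
  then show ?thesis by (rule finite_subset) (use D(1) in simp)
qed

context eps_form begin

text \<open>Two members of the same linear class differ by an isometry, whose determinant is 1 or -1. In
  each class a base member is fixed, and the type of a member records the class and the
  determinant of some isometry from the base member to it. Equal types are thus related by an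
  isometry of determinant 1.\<close>

lemma isometry_classes:
  fixes Z :: "'p \<Rightarrow> nat \<Rightarrow> (nat \<Rightarrow> complex) set" and mdl :: "'d \<Rightarrow> nat \<Rightarrow> (nat \<Rightarrow> complex) set"
  assumes D: "finite D"
    and \<iota>: "\<And>j. j \<in> J \<Longrightarrow> \<iota>' j \<in> J" and dual: "\<And>p j. p \<in> E \<Longrightarrow> j \<in> J \<Longrightarrow> Z p j = perp n S (Z p (\<iota>' j))"
    and nf: "\<And>p. p \<in> E \<Longrightarrow> \<exists>d\<in>D. \<exists>h h'. inv2 n h h' \<and> (\<forall>j\<in>J. act n h ` Z p j = mdl d j)"
  obtains D' :: "('d \<times> complex) set" and R :: "'d \<times> complex \<Rightarrow> 'p \<Rightarrow> bool"
  where "finite D'" "\<And>p. p \<in> E \<Longrightarrow> \<exists>d\<in>D'. R d p"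
    "\<And>d p p'. p \<in> E \<Longrightarrow> p' \<in> E \<Longrightarrow> R d p \<Longrightarrow> R d p' \<Longrightarrow> \<exists>\<kappa>\<in>isom n S True. \<forall>j\<in>J. act n \<kappa> ` Z p j = Z p' j"
proof -
  interpret O: regular_group n "isom n S False" "\<lambda>A. S' * (transpose_mat A * S)"
    by (rule regular_isom_form[OF S_inv])
  define R0 where "R0 d p \<longleftrightarrow> p \<in> E \<and> (\<exists>h h'. inv2 n h h' \<and> (\<forall>j\<in>J. act n h ` Z p j = mdl d j))" for d p
  have ZV: "Z p j \<subseteq> V n" if "p \<in> E" "j \<in> J" for p j using dual[OF that] perp_V by simp
  have iso: "\<exists>\<kappa>\<in>isom n S False. \<forall>j\<in>J. act n \<kappa> ` Z p j = Z p' j" if r: "R0 d p" "R0 d p'" for d p p'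
  proof -
    have E: "p \<in> E" "p' \<in> E" using r by (auto simp: R0_def)
    obtain h h' where h: "inv2 n h h'" "\<And>j. j \<in> J \<Longrightarrow> act n h ` Z p j = mdl d j" using r(1) by (auto simp: R0_def)
    obtain u u' where u: "inv2 n u u'" "\<And>j. j \<in> J \<Longrightarrow> act n u ` Z p' j = mdl d j" using r(2) by (auto simp: R0_def)
    have "act n (u' * h) ` Z p j = Z p' j" if j: "j \<in> J" for j
      using inv2_image_cancel[OF u(1) ZV[OF E(2) j]] h(2)[OF j] u(2)[OF j]
      by (simp add: act_mult_image[OF inv2D(2)[OF u(1)] inv2D(1)[OF h(1)]])
    then obtain \<kappa> where "\<kappa> \<in> carrier_mat n n" "transpose_mat \<kappa> * S * \<kappa> = S" "\<And>j. j \<in> J \<Longrightarrow> act n \<kappa> ` Z p j = Z p' j"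
      using isometry_of_linear_iso[where Z = "Z p" and Z' = "Z p'" and \<iota> = \<iota>',
          OF S_inv form_sym inv2_mult[OF inv2D(5)[OF u(1)] h(1)] \<iota> dual[OF E(1)] dual[OF E(2)]]
      by blast
    then show ?thesis by (intro bexI[of _ \<kappa>]) (auto simp: isom_def)
  qed
  have det: "det \<kappa> \<in> {1, - 1}" if \<kappa>: "\<kappa> \<in> isom n S False" for \<kappa>
  proof -
    have C: "\<kappa> \<in> carrier_mat n n" "transpose_mat \<kappa> * S * \<kappa> = S" using \<kappa> by (auto simp: isom_def)
    have "det \<kappa> * det S * det \<kappa> = det S"
      using arg_cong[OF C(2), of det] C(1) S_carrier by (simp add: det_mult[of _ n] mult_square det_transpose[OF C(1)])
    then have "(det \<kappa> * det \<kappa> - 1) * det S = 0" by (simp add: algebra_simps)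
    then have "det \<kappa> * det \<kappa> = 1" using inv2_det[OF S_inv] by simp
    then show ?thesis by (simp add: square_eq_1_iff)
  qed
  define base where "base d = (SOME p. R0 d p)" for d
  define R where "R de p \<longleftrightarrow> R0 (fst de) p \<and>
      (\<exists>\<kappa>\<in>isom n S False. det \<kappa> = snd de \<and> (\<forall>j\<in>J. act n \<kappa> ` Z (base (fst de)) j = Z p j))" for de p
  have base: "R0 d (base d)" if "R0 d p" for d p unfolding base_def using that by (rule someI)
  show thesis
  proof (rule that[of "D \<times> {1, - 1}" R])
    show "finite (D \<times> {1, - 1 :: complex})" using D by simp
    show "\<exists>d\<in>D \<times> {1, - 1}. R d p" if p: "p \<in> E" for p
    proof -
      obtain d where d: "d \<in> D" "R0 d p" using nf[OF p] p unfolding R0_def by blast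
      obtain \<kappa> where "\<kappa> \<in> isom n S False" "\<forall>j\<in>J. act n \<kappa> ` Z (base d) j = Z p j" using iso[OF base[OF d(2)] d(2)] by blast
      then show ?thesis using d det[of \<kappa>] by (intro bexI[of _ "(d, det \<kappa>)"]) (auto simp: R_def)
    qed
    show "\<exists>\<kappa>\<in>isom n S True. \<forall>j\<in>J. act n \<kappa> ` Z p j = Z p' j"
      if E: "p \<in> E" "p' \<in> E" and Rp: "R d p" "R d p'" for d p p'
    proof -
      obtain u where u: "u \<in> isom n S False" "det u = snd d" "\<And>j. j \<in> J \<Longrightarrow> act n u ` Z (base (fst d)) j = Z p j"
        using Rp(1) by (auto simp: R_def)
      obtain v where v: "v \<in> isom n S False" "det v = snd d" "\<And>j. j \<in> J \<Longrightarrow> act n v ` Z (base (fst d)) j = Z p' j"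
        using Rp(2) by (auto simp: R_def)
      let ?i = "S' * (transpose_mat u * S)"
      note i = O.inv_props[OF u(1)]
      have C: "u \<in> carrier_mat n n" "?i \<in> carrier_mat n n" "v \<in> carrier_mat n n"
        using O.X_carrier u(1) v(1) i(1) by auto
      have b: "base (fst d) \<in> E" using base[of "fst d" p] Rp(1) by (auto simp: R_def R0_def)
      have "det u * det ?i = 1" using det_mult[OF C(1,2)] i(2) by simp
      then have "det (v * ?i) = 1" using det_mult[OF C(3,2)] u(2) v(2) by simp
      moreover have "v * ?i \<in> isom n S False" by (rule O.mult_X[OF v(1) i(1)])
      ultimately have "v * ?i \<in> isom n S True" by (auto simp: isom_def)
      moreover have "act n (v * ?i) ` Z p j = Z p' j" if j: "j \<in> J" for j
        unfolding act_mult_image[OF C(3,2)] u(3)[OF j, symmetric] inv2_image_cancel[OF i(4) ZV[OF b j]] by (rule v(3)[OF j])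
      ultimately show ?thesis by blast
    qed
  qed
qed

end

context form_group begin

lemma perp_image:
  assumes k: "k \<in> isom n S d" and A: "A \<subseteq> V n"
  shows "perp n S (act n k ` A) = act n k ` perp n S A"
proof
  show "act n k ` perp n S A \<subseteq> perp n S (act n k ` A)"
    using frm_invariant[OF k] by (auto simp: perp_def)
  show "perp n S (act n k ` A) \<subseteq> act n k ` perp n S A"
  proof
    fix y assume y: "y \<in> perp n S (act n k ` A)"
    have yV: "y \<in> V n" using y perp_V by blast
    have e: "act n k (act n (\<iota> k) y) = y" by (rule iota_act(2)[OF k yV])
    have "frm n S x (act n (\<iota> k) y) = 0" if "x \<in> A" for x
      using frm_invariant[OF k, of x "act n (\<iota> k) y"] y that unfolding e by (auto simp: perp_def)
    then have "act n (\<iota> k) y \<in> perp n S A" by (auto simp: perp_def)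
    then show "y \<in> act n k ` perp n S A" using e by (metis image_eqI)
  qed
qed

end

lemma isom_True_sub: "isom n S True \<subseteq> isom n S d" "isom n S True \<subseteq> isom n (0\<^sub>m n n) True"
  by (auto simp: isom_def)

lemma composite_in_stabilizer:
  assumes X: "regular_group n X \<iota>" and k: "k \<in> X" "k' \<in> X" "\<kappa> \<in> X"
    and Z: "Z \<subseteq> V n" "act n \<kappa> ` (act n k ` Z) = act n k' ` Z"
  shows "\<iota> k' * (\<kappa> * k) \<in> X" "act n (\<iota> k' * (\<kappa> * k)) ` Z = Z" "\<kappa> * k = k' * (\<iota> k' * (\<kappa> * k))"
proof -
  interpret regular_group n X \<iota> by (rule X)
  have C: "k \<in> carrier_mat n n" "k' \<in> carrier_mat n n" "\<kappa> \<in> carrier_mat n n" "\<iota> k' \<in> carrier_mat n n"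
    using X_carrier k inv_props(1)[OF k(2)] by auto
  have kk: "\<kappa> * k \<in> carrier_mat n n" using C by simp
  show "\<iota> k' * (\<kappa> * k) \<in> X" by (intro mult_X inv_props(1) k)
  show "act n (\<iota> k' * (\<kappa> * k)) ` Z = Z"
    unfolding act_mult_image[OF C(4) kk] act_mult_image[OF C(3,1)] Z(2)
    by (rule inv2_image_cancel[OF inv_props(4)[OF k(2)] Z(1)])
  have "k' * (\<iota> k' * (\<kappa> * k)) = (k' * \<iota> k') * (\<kappa> * k)"
    by (rule assoc_mult_mat[symmetric, OF C(2,4) kk])
  then show "\<kappa> * k = k' * (\<iota> k' * (\<kappa> * k))" unfolding inv_props(2)[OF k(2)] left_mult_one_mat[OF kk] by (rule HOL.sym)
qed

lemma subgroup_mat_props: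
  assumes "regular_group n X \<iota>" "subgroup P (mat_group n X)"
  shows "P \<subseteq> carrier_mat n n" "\<And>p q. p \<in> P \<Longrightarrow> q \<in> P \<Longrightarrow> p * q \<in> P" "\<And>p. p \<in> P \<Longrightarrow> \<exists>p'\<in>P. p * p' = 1\<^sub>m n"
proof -
  interpret regular_group n X \<iota> by (rule assms(1))
  note S = subgroup_props[OF assms(2)]
  show "P \<subseteq> carrier_mat n n" using S(1) X_carrier by blast
  show "\<And>p q. p \<in> P \<Longrightarrow> q \<in> P \<Longrightarrow> p * q \<in> P" using S(3) by blast
  show "\<And>p. p \<in> P \<Longrightarrow> \<exists>p'\<in>P. p * p' = 1\<^sub>m n" using S(1,4) inv_props(2) by blast
qed

text \<open>The configuration consists of a self-dual complete flag, a subspace and its orthogonal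
  space. After a linear map the flag is the standard one, and the other two spaces are normalized
  one after the other.\<close>

theorem (in form_group) finite_orbits_maximal:
  assumes P: "maximal_parabolic n (SL n) P" and Q: "parabolic n G Q" and d: "d \<or> even n"
  shows "finite (orbits G ((lcosets\<^bsub>SL n\<^esub> P) \<times> (lcosets\<^bsub>G\<^esub> Q)) (\<lambda>k (A, B). (k <#\<^bsub>SL n\<^esub> A, k <#\<^bsub>G\<^esub> B)))"
proof -
  let ?Y = "isom n (0\<^sub>m n n) True" and ?X = "isom n S d"
  interpret SL: regular_group n ?Y adj_mat by (rule regular_isom_SL)
  have Psub: "subgroup P SL.G" using P by (simp add: maximal_parabolic_def parabolic_def SL_isom)
  have Qsub: "subgroup Q G" using Q by (simp add: parabolic_def)
  obtain W where W: "subsp W" "W \<subseteq> V n" "\<And>g. g \<in> ?Y \<Longrightarrow> act n g ` W \<subseteq> W \<Longrightarrow> g \<in> P"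
    using maximal_parabolic_contains_stabilizer[OF P] by (auto simp: SL_isom)
  obtain B where B: "borel_subgroup n G B" "B \<subseteq> Q" using Q by (auto simp: parabolic_def)
  obtain F f f' where F: "full_flag n F" "B = fstab n ?X F" "\<And>j. j \<le> n \<Longrightarrow> F (n - j) = perp n S (F j)"
      "inv2 n f f'" "\<And>j. j \<le> n \<Longrightarrow> act n f ` coord {..<j} = F j"
    using borel_form_flag[OF B(1) d] by blast
  note FD = full_flagD[OF F(1)]
  \<comment> \<open>The flag, the moved subspace and its orthogonal space, as one family closed under taking
    orthogonal spaces.\<close>
  define Z where "Z p j = (if j \<le> n then act n (snd p) ` F j else if j = n + 1 then act n (fst p) ` W
      else perp n S (act n (fst p) ` W))" for p :: "complex mat \<times> complex mat" and j
  define \<iota>' where "\<iota>' j = (if j \<le> n then n - j else if j = n + 1 then n + 2 else n + 1)" for j :: nat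
  define mdl where "mdl e j = (case e of (R1, R2, \<pi>) \<Rightarrow>
      if j \<le> n then coord {..<j} else if j = n + 1 then coord R1 else NF R2 \<pi>)"
    for e :: "nat set \<times> nat set \<times> (nat \<Rightarrow> nat)" and j :: nat
  let ?E = "?Y \<times> ?X" and ?J = "{..n + 2}"
  let ?D = "Pow {..<n} \<times> Pow {..<n} \<times> {\<pi>. \<pi> permutes {..<n}}"
  have finD: "finite ?D" by (intro finite_cartesian_product finite_permutations) auto
  have dual: "Z p j = perp n S (Z p (\<iota>' j))" if p: "p \<in> ?E" and j: "j \<in> ?J" for p j
  proof -
    have k: "snd p \<in> ?X" using p by auto
    have gW: "subsp (act n (fst p) ` W)" "act n (fst p) ` W \<subseteq> V n" using subsp_act_image[OF W(1)] by auto
    consider "j \<le> n" | "j = n + 1" | "j = n + 2" using j by fastforce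
    then show ?thesis
    proof cases
      case 1
      then have "perp n S (act n (snd p) ` F (n - j)) = act n (snd p) ` perp n S (F (n - j))"
        by (intro perp_image[OF k] FD(2)) simp
      then show ?thesis using 1 F(3)[of "n - j"] by (simp add: Z_def \<iota>'_def)
    next
      case 2
      then show ?thesis using perp_perp[OF gW] by (simp add: Z_def \<iota>'_def)
    next
      case 3
      then show ?thesis by (simp add: Z_def \<iota>'_def)
    qed
  qed
  have nf: "\<exists>e\<in>?D. \<exists>h h'. inv2 n h h' \<and> (\<forall>j\<in>?J. act n h ` Z p j = mdl e j)" if p: "p \<in> ?E" for p
  proof -
    have g: "fst p \<in> ?Y" and k: "snd p \<in> ?X" using p by auto
    obtain b b' where b: "inv2 n b b'" and bF: "\<And>j. j \<le> n \<Longrightarrow> act n b ` coord {..<j} = act n (snd p) ` F j"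
    proof -
      have "inv2 n (snd p * f) (f' * \<iota> (snd p))" by (rule inv2_mult[OF inv_props(4)[OF k] F(4)])
      moreover have "snd p \<in> carrier_mat n n" using k X_carrier by blast
      ultimately show thesis using that act_mult_image inv2D(1)[OF F(4)] F(5) by metis
    qed
    let ?W = "act n b' ` (act n (fst p) ` W)" and ?W' = "act n b' ` perp n S (act n (fst p) ` W)"
    have s: "subsp ?W" "?W \<subseteq> V n" "subsp ?W'" "?W' \<subseteq> V n"
      using subsp_act_image subsp_perp W(1) by auto
    obtain m R1 R2 \<pi> where m: "\<exists>A A'. inv2 n A A' \<and> (\<forall>x\<in>V n. act n A x = m x)"
      "\<And>t. m ` coord {i. i < n \<and> i < t} = coord {i. i < n \<and> i < t}"
      "m ` ?W = coord R1" "R1 \<subseteq> {..<n}" "m ` ?W' = NF R2 \<pi>" "R2 \<subseteq> {..<n}" "pairing (\<lambda>i. i) (mark R1) R2 \<pi>"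
      by (rule chain_pair_normal_form[OF s, where w = "\<lambda>i. i"]) blast
    obtain A A' where A: "inv2 n A A'" "\<And>x. x \<in> V n \<Longrightarrow> act n A x = m x" using m(1) by blast
    have Am: "act n A ` Y = m ` Y" if "Y \<subseteq> V n" for Y by (rule image_cong) (use A(2) that in auto)
    have h: "inv2 n (A * b') (b * A')" by (rule inv2_mult[OF A(1) inv2D(5)[OF b]])
    have hi: "act n (A * b') ` Y = act n A ` (act n b' ` Y)" for Y
      by (rule act_mult_image[OF inv2D(1)[OF A(1)] inv2D(2)[OF b]])
    have "act n (A * b') ` Z p j = mdl (R1, R2, \<pi>) j" if j: "j \<in> ?J" for j
    proof -
      consider "j \<le> n" | "j = n + 1" | "j = n + 2" using j by fastforce
      then show ?thesis
      proof cases
        case 1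
        have jV: "coord {..<j} \<subseteq> V n" using 1 by (auto simp: coord_def)
        have "act n (A * b') ` Z p j = act n A ` (act n b' ` (act n b ` coord {..<j}))"
          using 1 bF by (simp add: hi Z_def)
        also have "\<dots> = m ` coord {..<j}" by (simp add: inv2_image_cancel[OF b jV] Am[OF jV])
        also have "{..<j} = {i. i < n \<and> i < j}" using 1 by auto
        finally show ?thesis unfolding m(2) using \<open>{..<j} = _\<close> 1 by (simp add: mdl_def)
      next
        case 2
        then show ?thesis using Am[OF s(2)] m(3) by (simp add: hi Z_def mdl_def)
      next
        case 3
        then show ?thesis using Am[OF s(4)] m(5) by (simp add: hi Z_def mdl_def)
      qed
    qed
    moreover have "(R1, R2, \<pi>) \<in> ?D" using m(4,6) pairing_permutes[OF m(7,6)] by simp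
    ultimately show ?thesis using h by blast
  qed
  obtain D' :: "((nat set \<times> nat set \<times> (nat \<Rightarrow> nat)) \<times> complex) set" and R
    where DR: "finite D'" "\<And>p. p \<in> ?E \<Longrightarrow> \<exists>d\<in>D'. R d p"
    "\<And>d p p'. p \<in> ?E \<Longrightarrow> p' \<in> ?E \<Longrightarrow> R d p \<Longrightarrow> R d p' \<Longrightarrow> \<exists>\<kappa>\<in>isom n S True. \<forall>j\<in>?J. act n \<kappa> ` Z p j = Z p' j"
    by (rule isometry_classes[where \<iota>' = \<iota>' and E = ?E and J = ?J, OF finD _ dual nf]) (auto simp: \<iota>'_def)
  show ?thesis unfolding SL_isom
  proof (rule finite_orbits_pairs[OF SL.X_carrier regular_group_axioms subgroup_mat_props[OF regular_isom_SL Psub]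
        subgroup_mat_props[OF regular_group_axioms Qsub] DR(1), of "\<lambda>e g k. R e (g, k)"])
    show "\<exists>e\<in>D'. R e (g, k)" if "g \<in> ?Y" "k \<in> ?X" for g k using DR(2)[of "(g, k)"] that by simp
    fix e g k g' k' assume gk: "g \<in> ?Y" "k \<in> ?X" "g' \<in> ?Y" "k' \<in> ?X" "R e (g, k)" "R e (g', k')"
    then obtain \<kappa> where \<kappa>: "\<kappa> \<in> isom n S True" and Zj: "\<And>j. j \<le> n + 2 \<Longrightarrow> act n \<kappa> ` Z (g, k) j = Z (g', k') j"
      using DR(3)[of "(g, k)" "(g', k')" e] by auto
    have \<kappa>X: "\<kappa> \<in> ?X" "\<kappa> \<in> ?Y" using subsetD[OF isom_True_sub(1) \<kappa>] subsetD[OF isom_True_sub(2) \<kappa>] .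
    have "act n \<kappa> ` (act n g ` W) = act n g' ` W" using Zj[of "n + 1"] by (simp add: Z_def)
    note c1 = composite_in_stabilizer[OF regular_isom_SL gk(1,3) \<kappa>X(2) W(2) this]
    have "act n \<kappa> ` (act n k ` F j) = act n k' ` F j" if "j \<le> n" for j using Zj[of j] that by (simp add: Z_def)
    note c2 = composite_in_stabilizer[OF regular_group_axioms gk(2,4) \<kappa>X(1) FD(2) this]
    have "adj_mat g' * (\<kappa> * g) \<in> P" by (rule W(3)[OF c1(1)]) (simp add: c1(2))
    moreover have "\<iota> k' * (\<kappa> * k) \<in> Q" using B(2) c2(1)[of 0] c2(2) unfolding F(2) fstab_def by auto
    ultimately show "\<exists>\<kappa>\<in>?X. \<exists>p\<in>P. \<exists>q\<in>Q. \<kappa> * g = g' * p \<and> \<kappa> * k = k' * q"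
      using \<kappa>X(1) c1(3) c2(3)[of 0] by blast
  qed
qed

text \<open>The configuration consists of \<open>U = U\<^sup>\<bottom>\<close>, two nested subspaces and their orthogonal
  spaces. After a linear map the nested subspaces are coordinate subspaces; they are the flag of a
  label \<open>w\<close> with three values. Then \<open>U\<close>, the larger orthogonal space and, inside the latter, the
  smaller orthogonal space are normalized in turn.\<close>

theorem (in form_group) finite_orbits_siegel:
  assumes s: "s1 \<le> s2" "s2 \<le> n"
    and P: "subgroup P (SL n)"
      "\<And>g. g \<in> carrier (SL n) \<Longrightarrow> act n g ` coord {..<s1} \<subseteq> coord {..<s1} \<Longrightarrow> act n g ` coord {..<s2} \<subseteq> coord {..<s2} \<Longrightarrow> g \<in> P"
    and U: "U = perp n S U" and Q: "subgroup Q G" "\<And>g. g \<in> isom n S d \<Longrightarrow> act n g ` U = U \<Longrightarrow> g \<in> Q"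
  shows "finite (orbits G ((lcosets\<^bsub>SL n\<^esub> P) \<times> (lcosets\<^bsub>G\<^esub> Q)) (\<lambda>k (A, B). (k <#\<^bsub>SL n\<^esub> A, k <#\<^bsub>G\<^esub> B)))"
proof -
  let ?Y = "isom n (0\<^sub>m n n) True" and ?X = "isom n S d"
  define w where "w i = (if i < s1 then 0 else if i < s2 then 1 else 2 :: nat)" for i
  interpret SL: regular_group n ?Y adj_mat by (rule regular_isom_SL)
  have Psub: "subgroup P SL.G" using P(1) by (simp add: SL_isom)
  let ?W1 = "coord {..<s1}" and ?W2 = "coord {..<s2}"
  have W: "subsp ?W1" "?W1 \<subseteq> V n" "subsp ?W2" "?W2 \<subseteq> V n" "?W1 \<subseteq> ?W2"
    using s by (auto simp: subsp_coord) (auto simp: coord_def)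
  have UV: "subsp U" "U \<subseteq> V n" using U subsp_perp perp_V by metis+
  define Z where "Z p j = (if j = 0 then act n (snd p) ` U else if j = 1 then act n (fst p) ` ?W1
      else if j = 2 then act n (fst p) ` ?W2 else if j = 3 then perp n S (act n (fst p) ` ?W1)
      else perp n S (act n (fst p) ` ?W2))" for p :: "complex mat \<times> complex mat" and j :: nat
  define \<iota>' where "\<iota>' j = (if j = 0 then 0 else if j \<le> 2 then j + 2 else j - 2)" for j :: nat
  define mdl where "mdl e j = (case e of (R1, R2, \<pi>, R3, \<pi>3) \<Rightarrow>
      if j = 0 then coord R1 else if j = 1 then ?W1 else if j = 2 then ?W2 else if j = 3 then NF R2 \<pi>
      else unfold_NF (reps R1 R2 \<pi>) R2 \<pi> ` NF R3 \<pi>3)"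
    for e :: "nat set \<times> nat set \<times> (nat \<Rightarrow> nat) \<times> nat set \<times> (nat \<Rightarrow> nat)" and j :: nat
  let ?E = "?Y \<times> ?X" and ?J = "{..4 :: nat}"
  let ?D = "Pow {..<n} \<times> Pow {..<n} \<times> {\<pi>. \<pi> permutes {..<n}} \<times> Pow {..<n} \<times> {\<pi>. \<pi> permutes {..<n}}"
  have finD: "finite ?D" by (intro finite_cartesian_product finite_permutations) auto
  have cases: "j = 0 \<or> j = 1 \<or> j = 2 \<or> j = 3 \<or> j = 4" if "j \<in> ?J" for j using that by fastforce
  have dual: "Z p j = perp n S (Z p (\<iota>' j))" if p: "p \<in> ?E" and j: "j \<in> ?J" for p j
  proof -
    have k: "snd p \<in> ?X" using p by auto
    have gW: "subsp (act n (fst p) ` ?W1)" "act n (fst p) ` ?W1 \<subseteq> V n"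
      "subsp (act n (fst p) ` ?W2)" "act n (fst p) ` ?W2 \<subseteq> V n" using subsp_act_image W by auto
    show ?thesis
      using cases[OF j] perp_image[OF k UV(2)] U perp_perp[OF gW(1,2)] perp_perp[OF gW(3,4)]
      by (elim disjE) (simp_all add: Z_def \<iota>'_def)
  qed
  have wt: "{i. i < n \<and> w i < 1} = {..<s1}" "{i. i < n \<and> w i < 2} = {..<s2}"
    using s by (auto simp: w_def)
  have nf: "\<exists>e\<in>?D. \<exists>h h'. inv2 n h h' \<and> (\<forall>j\<in>?J. act n h ` Z p j = mdl e j)" if p: "p \<in> ?E" for p
  proof -
    have g: "fst p \<in> ?Y" and k: "snd p \<in> ?X" using p by auto
    let ?b' = "adj_mat (fst p)"
    note b = SL.inv_props(4)[OF g]
    let ?U = "act n ?b' ` (act n (snd p) ` U)" and ?X2 = "act n ?b' ` perp n S (act n (fst p) ` ?W1)"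
      and ?X1 = "act n ?b' ` perp n S (act n (fst p) ` ?W2)"
    have sub: "subsp ?U" "?U \<subseteq> V n" "subsp ?X2" "?X2 \<subseteq> V n" "subsp ?X1"
      using subsp_act_image subsp_perp UV(1) by auto
    have X12: "?X1 \<subseteq> ?X2" by (intro image_mono perp_mono W(5))
    obtain m R1 R2 \<pi> where
      mc: "\<And>h t. h \<in> moves w (mark R1) {..<n} \<Longrightarrow> h ` coord {i. i < n \<and> w i < t} = coord {i. i < n \<and> w i < t}"
        "\<And>h t. h \<in> moves w (mark R1) {..<n} \<Longrightarrow> h ` coord R1 = coord R1"
      and m: "\<exists>A A'. inv2 n A A' \<and> (\<forall>x\<in>V n. act n A x = m x)"
      "\<And>t. m ` coord {i. i < n \<and> w i < t} = coord {i. i < n \<and> w i < t}"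
      "m ` ?U = coord R1" "R1 \<subseteq> {..<n}" "m ` ?X2 = NF R2 \<pi>" "R2 \<subseteq> {..<n}" "pairing w (mark R1) R2 \<pi>"
      by (rule chain_pair_normal_form[OF sub(1-4), where w = w]) blast
    obtain A A' where A: "inv2 n A A'" "\<And>x. x \<in> V n \<Longrightarrow> act n A x = m x" using m(1) by blast
    have Am: "act n A ` Y = m ` Y" if "Y \<subseteq> V n" for Y by (rule image_cong) (use A(2) that in auto)
    have X1: "subsp (act n A ` ?X1)" "act n A ` ?X1 \<subseteq> NF R2 \<pi>"
      using subsp_act_image[OF sub(5)] image_mono[OF X12, of "act n A"] Am[OF sub(4)] m(5) by auto
    have w2: "w i \<le> 2" for i by (simp add: w_def)
    obtain h R3 \<pi>3 where h: "h \<in> moves w (mark R1) {..<n}" "R3 \<subseteq> {..<n}" "\<pi>3 permutes {..<n}" "h ` NF R2 \<pi> = NF R2 \<pi>"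
        "h ` (act n A ` ?X1) = unfold_NF (reps R1 R2 \<pi>) R2 \<pi> ` NF R3 \<pi>3"
      using sub_normal_form[OF m(6,7) w2 X1] by (elim bexE exE conjE) (rule that)
    obtain A2 A2' where A2: "inv2 n A2 A2'" "\<And>x. x \<in> V n \<Longrightarrow> act n A2 x = h x"
      using moves_matrix[OF h(1) subset_refl] by blast
    have A2h: "act n A2 ` Y = h ` Y" if "Y \<subseteq> V n" for Y by (rule image_cong) (use A2(2) that in auto)
    let ?h = "A2 * (A * ?b')"
    have inv: "inv2 n ?h (fst p * A' * A2')" by (rule inv2_mult[OF A2(1) inv2_mult[OF A(1) inv2D(5)[OF b]]])
    have hi: "act n ?h ` Y = act n A2 ` (act n A ` (act n ?b' ` Y))" for Y
      using act_mult_image[OF inv2D(1)[OF A2(1)] mult_square[OF inv2D(1)[OF A(1)] inv2D(2)[OF b]]]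
        act_mult_image[OF inv2D(1)[OF A(1)] inv2D(2)[OF b]] by simp
    have fin: "act n ?h ` Y = h ` (m ` (act n ?b' ` Y))" for Y
    proof -
      have bV: "act n ?b' ` Y \<subseteq> V n" by auto
      have "m ` (act n ?b' ` Y) \<subseteq> V n" unfolding Am[OF bV, symmetric] by auto
      then show ?thesis unfolding hi Am[OF bV] by (rule A2h)
    qed
    have "act n ?h ` Z p j = mdl (R1, R2, \<pi>, R3, \<pi>3) j" if j: "j \<in> ?J" for j
    proof -
      have 1: "act n ?h ` (act n (fst p) ` coord {i. i < n \<and> w i < t}) = coord {i. i < n \<and> w i < t}" for t
      proof -
        have tV: "coord {i. i < n \<and> w i < t} \<subseteq> V n" by (auto simp: coord_def)
        show ?thesis unfolding fin inv2_image_cancel[OF b tV] m(2) by (rule mc(1)[OF h(1)])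
      qed
      have 2: "act n ?h ` perp n S (act n (fst p) ` ?W2) = unfold_NF (reps R1 R2 \<pi>) R2 \<pi> ` NF R3 \<pi>3"
        unfolding fin h(5)[symmetric] by (subst Am) auto
      show ?thesis
        using cases[OF j] 1[of 1] 1[of 2] 2 mc(2)[OF h(1)] fin m(3,5) h(4) unfolding wt
        by (elim disjE) (simp_all add: Z_def mdl_def)
    qed
    moreover have "(R1, R2, \<pi>, R3, \<pi>3) \<in> ?D" using m(4,6) h(2,3) pairing_permutes[OF m(7,6)] by simp
    ultimately show ?thesis using inv by blast
  qed
  obtain D' :: "((nat set \<times> nat set \<times> (nat \<Rightarrow> nat) \<times> nat set \<times> (nat \<Rightarrow> nat)) \<times> complex) set" and R
    where DR: "finite D'" "\<And>p. p \<in> ?E \<Longrightarrow> \<exists>d\<in>D'. R d p"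
    "\<And>d p p'. p \<in> ?E \<Longrightarrow> p' \<in> ?E \<Longrightarrow> R d p \<Longrightarrow> R d p' \<Longrightarrow> \<exists>\<kappa>\<in>isom n S True. \<forall>j\<in>?J. act n \<kappa> ` Z p j = Z p' j"
    by (rule isometry_classes[where \<iota>' = \<iota>' and E = ?E and J = ?J, OF finD _ dual nf]) (auto simp: \<iota>'_def)
  show ?thesis unfolding SL_isom
  proof (rule finite_orbits_pairs[OF SL.X_carrier regular_group_axioms subgroup_mat_props[OF regular_isom_SL Psub]
        subgroup_mat_props[OF regular_group_axioms Q(1)] DR(1), of "\<lambda>e g k. R e (g, k)"])
    show "\<exists>e\<in>D'. R e (g, k)" if "g \<in> ?Y" "k \<in> ?X" for g k using DR(2)[of "(g, k)"] that by simp
    fix e g k g' k' assume gk: "g \<in> ?Y" "k \<in> ?X" "g' \<in> ?Y" "k' \<in> ?X" "R e (g, k)" "R e (g', k')"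
    then obtain \<kappa> where \<kappa>: "\<kappa> \<in> isom n S True" and Zj: "\<And>j. j \<le> 4 \<Longrightarrow> act n \<kappa> ` Z (g, k) j = Z (g', k') j"
      using DR(3)[of "(g, k)" "(g', k')" e] by auto
    have \<kappa>X: "\<kappa> \<in> ?X" "\<kappa> \<in> ?Y" using subsetD[OF isom_True_sub(1) \<kappa>] subsetD[OF isom_True_sub(2) \<kappa>] .
    have "act n \<kappa> ` (act n g ` ?W1) = act n g' ` ?W1" using Zj[of 1] by (simp add: Z_def)
    note c1 = composite_in_stabilizer[OF regular_isom_SL gk(1,3) \<kappa>X(2) W(2) this]
    have "act n \<kappa> ` (act n g ` ?W2) = act n g' ` ?W2" using Zj[of 2] by (simp add: Z_def)
    note c2 = composite_in_stabilizer[OF regular_isom_SL gk(1,3) \<kappa>X(2) W(4) this]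
    have "act n \<kappa> ` (act n k ` U) = act n k' ` U" using Zj[of 0] by (simp add: Z_def)
    note c3 = composite_in_stabilizer[OF regular_group_axioms gk(2,4) \<kappa>X(1) UV(2) this]
    have "adj_mat g' * (\<kappa> * g) \<in> P"
      by (rule P(2)) (use c1(1,2) c2(2) in \<open>simp_all add: SL_isom mat_group_def\<close>)
    moreover have "\<iota> k' * (\<kappa> * k) \<in> Q" by (rule Q(2)[OF c3(1,2)])
    ultimately show "\<exists>\<kappa>\<in>?X. \<exists>p\<in>P. \<exists>q\<in>Q. \<kappa> * g = g' * p \<and> \<kappa> * k = k' * q"
      using \<kappa>X(1) c1(3) c3(3) by blast
  qed
qed

section \<open>Subspaces of vectors and Siegel parabolic subgroups\<close>

definition fv :: "nat \<Rightarrow> complex vec \<Rightarrow> nat \<Rightarrow> complex" where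
  "fv n v = (\<lambda>i. if i < n then v $ i else 0)"

lemma fv_vec: "x \<in> V n \<Longrightarrow> fv n (vec n x) = x"
  by (auto simp: fv_def coord_def)

lemma vec_fv: "v \<in> carrier_vec n \<Longrightarrow> vec n (fv n v) = v"
  by (rule eq_vecI) (auto simp: fv_def)

lemma fv_V: "fv n v \<in> V n" by (auto simp: fv_def coord_def)

lemma fv_mult_mat_vec:
  assumes "g \<in> carrier_mat n n" "v \<in> carrier_vec n"
  shows "fv n (g *\<^sub>v v) = act n g (fv n v)"
  using assms by (auto simp: fv_def act_def scalar_prod_def lessThan_atLeast0 intro!: sum.cong)

lemma scalar_prod_frm:
  assumes S: "S \<in> carrier_mat n n" and "u \<in> carrier_vec n" "v \<in> carrier_vec n"
  shows "u \<bullet> (S *\<^sub>v v) = frm n S (fv n u) (fv n v)"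
proof -
  have "u \<bullet> (S *\<^sub>v v) = (\<Sum>i<n. u $ i * (S *\<^sub>v v) $ i)"
    using S by (simp add: scalar_prod_def lessThan_atLeast0)
  also have "\<dots> = (\<Sum>i<n. fv n u i * fv n (S *\<^sub>v v) i)" by (simp add: fv_def)
  finally show ?thesis by (simp add: frm_def fv_mult_mat_vec assms)
qed

lemma subspace_fv:
  assumes "VectorSpace.subspace class_ring W (module_vec TYPE(complex) n)"
  shows "W \<subseteq> carrier_vec n" "subsp (fv n ` W)"
proof -
  interpret submodule class_ring W "module_vec TYPE(complex) n" using assms by (rule subspace.submod)
  show W: "W \<subseteq> carrier_vec n" using subset by (simp add: module_vec_simps)
  show "subsp (fv n ` W)" unfolding subsp_def
  proof (intro conjI ballI allI)
    have "fv n (0\<^sub>v n) = (\<lambda>_. 0)" by (auto simp: fv_def)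
    then show "(\<lambda>_. 0) \<in> fv n ` W" using zero_closed by (metis imageI module_vec_simps(2))
    fix x y and c d :: complex assume "x \<in> fv n ` W" "y \<in> fv n ` W"
    then obtain u v where uv: "u \<in> W" "v \<in> W" "x = fv n u" "y = fv n v" by blast
    have "c \<cdot>\<^sub>v u \<in> W" "d \<cdot>\<^sub>v v \<in> W"
      using smult_closed[of c u] smult_closed[of d v] uv by (simp_all add: module_vec_simps)
    then have "c \<cdot>\<^sub>v u + d \<cdot>\<^sub>v v \<in> W" using m_closed by (simp add: module_vec_simps)
    moreover have "fv n (c \<cdot>\<^sub>v u + d \<cdot>\<^sub>v v) = (\<lambda>i. c * x i + d * y i)"
    proof -
      have "u \<in> carrier_vec n" "v \<in> carrier_vec n" using W uv(1,2) by auto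
      then show ?thesis unfolding uv(3,4) fv_def by (intro ext) simp
    qed
    ultimately show "(\<lambda>i. c * x i + d * y i) \<in> fv n ` W" by (metis imageI)
  qed
qed

lemma subspace_vec:
  assumes U: "subsp U" "U \<subseteq> V n"
  shows "VectorSpace.subspace class_ring (vec n ` U) (module_vec TYPE(complex) n)"
proof (intro subspace.intro submodule.intro vec_vs vec_module)
  have add: "vec n (\<lambda>i. c * x i + d * y i) \<in> vec n ` U" if "x \<in> U" "y \<in> U" for x y c d
    using subsp_comb[OF U(1) that] by (rule imageI)
  show "vec n ` U \<subseteq> carrier (module_vec TYPE(complex) n)" by (auto simp: module_vec_simps)
  show "\<zero>\<^bsub>module_vec TYPE(complex) n\<^esub> \<in> vec n ` U"
  proof -
    have "0\<^sub>v n = vec n (\<lambda>_. 0 :: complex)" by (rule eq_vecI) auto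
    then show ?thesis using subsp_zero[OF U(1)] by (simp add: module_vec_simps)
  qed
  fix u v assume "u \<in> vec n ` U" "v \<in> vec n ` U"
  then obtain x y where xy: "x \<in> U" "y \<in> U" "u = vec n x" "v = vec n y" by blast
  have "u + v = vec n (\<lambda>i. 1 * x i + 1 * y i)" unfolding xy by (rule eq_vecI) auto
  then show "u \<oplus>\<^bsub>module_vec TYPE(complex) n\<^esub> v \<in> vec n ` U" using add[OF xy(1,2), of 1 1] by (simp add: module_vec_simps)
next
  fix c :: complex and v assume "v \<in> vec n ` U"
  then obtain x where x: "x \<in> U" "v = vec n x" by blast
  have "c \<cdot>\<^sub>v v = vec n (\<lambda>i. c * x i + 0 * x i)" unfolding x by (rule eq_vecI) auto
  then show "c \<odot>\<^bsub>module_vec TYPE(complex) n\<^esub> v \<in> vec n ` U"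
    using subsp_comb[OF U(1) x(1) x(1), of c 0] by (simp add: module_vec_simps)
qed

text \<open>A vector of \<open>U\<^sup>\<bottom>\<close> outside \<open>U\<close> cannot be isotropic, which settles alternating forms.
  For a symmetric form in even dimension, \<open>U\<^sup>\<bottom> / U\<close> has even dimension, so it would be at
  least two-dimensional, and some combination \<open>t x + y\<close> of independent vectors is isotropic over
  the complex numbers.\<close>

lemma (in eps_form) maximal_isotropic_self_perp:
  assumes W: "maximal_isotropic n S W" and par: "\<epsilon> = 1 \<Longrightarrow> even n"
  shows "fv n ` W = perp n S (fv n ` W)"
proof -
  define U where "U = fv n ` W"
  have iso: "VectorSpace.subspace class_ring W (module_vec TYPE(complex) n)" "\<And>u v. u \<in> W \<Longrightarrow> v \<in> W \<Longrightarrow> u \<bullet> (S *\<^sub>v v) = 0"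
    and max: "\<And>W'. isotropic n S W' \<Longrightarrow> W \<subseteq> W' \<Longrightarrow> W' = W"
    using W by (auto simp: maximal_isotropic_def isotropic_def)
  note WC = subspace_fv(1)[OF iso(1)]
  have U: "subsp U" "U \<subseteq> V n" using subspace_fv(2)[OF iso(1)] fv_V by (auto simp: U_def)
  have U0: "frm n S a b = 0" if "a \<in> U" "b \<in> U" for a b
  proof -
    obtain u v where uv: "u \<in> W" "v \<in> W" "a = fv n u" "b = fv n v" using \<open>a \<in> U\<close> \<open>b \<in> U\<close> by (auto simp: U_def)
    have "frm n S a b = u \<bullet> (S *\<^sub>v v)" unfolding uv(3,4)
      by (rule scalar_prod_frm[OF S_carrier, symmetric]) (use uv WC in auto)
    then show ?thesis using iso(2)[OF uv(1,2)] by simp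
  qed
  have Up: "U \<subseteq> perp n S U" using U(2) U0 by (auto simp: perp_def)
  have ext: "x \<in> U" if x: "x \<in> perp n S U" "frm n S x x = 0" for x
  proof -
    have xV: "x \<in> V n" using x(1) perp_V by blast
    let ?U' = "ins U x"
    have U': "subsp ?U'" "?U' \<subseteq> V n" by (rule subsp_ins[OF U(1)]) (rule ins_V[OF U(2) xV])
    have r: "frm n S a x = 0" "frm n S x a = 0" if a: "a \<in> U" for a
    proof -
      show "frm n S a x = 0" using x(1) a by (auto simp: perp_def)
      then show "frm n S x a = 0" using form_sym[of x a] by simp
    qed
    have z: "frm n S p q = 0" if "p \<in> ?U'" "q \<in> ?U'" for p q
    proof -
      obtain a c where a: "a \<in> U" "p = (\<lambda>i. 1 * a i + c * x i)" using \<open>p \<in> ?U'\<close> by (auto simp: ins_def)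
      obtain b d where b: "b \<in> U" "q = (\<lambda>i. 1 * b i + d * x i)" using \<open>q \<in> ?U'\<close> by (auto simp: ins_def)
      show ?thesis unfolding a(2) b(2) frm_comb_left frm_comb_right using r[OF a(1)] r[OF b(1)] U0[OF a(1) b(1)] x(2) by simp
    qed
    have "isotropic n S (vec n ` ?U')" unfolding isotropic_def
    proof (intro conjI ballI)
      show "VectorSpace.subspace class_ring (vec n ` ?U') (module_vec TYPE(complex) n)" by (rule subspace_vec[OF U'])
      fix u v assume "u \<in> vec n ` ?U'" "v \<in> vec n ` ?U'"
      then obtain p q where pq: "p \<in> ?U'" "q \<in> ?U'" "u = vec n p" "v = vec n q" by blast
      have "u \<bullet> (S *\<^sub>v v) = frm n S (fv n u) (fv n v)" by (rule scalar_prod_frm[OF S_carrier]) (simp_all add: pq)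
      also have "fv n u = p" unfolding pq by (rule fv_vec) (use U'(2) pq in blast)
      also have "fv n v = q" unfolding pq by (rule fv_vec) (use U'(2) pq in blast)
      finally show "u \<bullet> (S *\<^sub>v v) = 0" using z[OF pq(1,2)] by simp
    qed
    moreover have "W \<subseteq> vec n ` ?U'"
    proof
      fix w assume w: "w \<in> W"
      then have "fv n w \<in> ?U'" using ins_sub[of U x] by (auto simp: U_def)
      moreover have "w = vec n (fv n w)" using vec_fv w WC by auto
      ultimately show "w \<in> vec n ` ?U'" by (rule rev_image_eqI[where f = "vec n"])
    qed
    ultimately have "vec n ` ?U' = W" by (rule max)
    then have "vec n x \<in> W" using ins_mem[OF U(1)] by blast
    then have "fv n (vec n x) \<in> U" unfolding U_def by (rule imageI)
    then show ?thesis by (simp only: fv_vec[OF xV])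
  qed
  have "perp n S U \<subseteq> U"
  proof
    fix x assume x: "x \<in> perp n S U"
    show "x \<in> U"
    proof (rule ccontr)
      assume xU: "x \<notin> U"
      then have a: "frm n S x x \<noteq> 0" using ext[OF x] by blast
      then have e1: "\<epsilon> = 1" using form_sym[of x x] eps by auto
      have sub: "ins U x \<subseteq> perp n S U" by (rule ins_least[OF subsp_perp Up x])
      have "dm (ins U x) = Suc (dm U)" using dm_ins[OF U _ xU] x perp_V by blast
      moreover have "dm (perp n S U) = n - dm U" by (rule dm_perp_eq[OF U])
      moreover have "dm U \<le> n" by (rule dm_le[OF U(2)])
      moreover have "n - dm U \<noteq> Suc (dm U)" using par[OF e1] by presburger
      ultimately have "ins U x \<noteq> perp n S U" by metis
      then obtain y where y: "y \<in> perp n S U" "y \<notin> ins U x" using sub by blast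
      define t where "t = (- frm n S x y + csqrt (frm n S x y ^ 2 - frm n S x x * frm n S y y)) / frm n S x x"
      let ?z = "\<lambda>i. t * x i + 1 * y i"
      have "(frm n S x x * t + frm n S x y) ^ 2 = frm n S x y ^ 2 - frm n S x x * frm n S y y"
        using a by (simp add: t_def)
      then have "frm n S x x * (t * t * frm n S x x + 2 * t * frm n S x y + frm n S y y) = 0"
        by (simp add: power2_eq_square algebra_simps)
      moreover have "frm n S ?z ?z = t * t * frm n S x x + 2 * t * frm n S x y + frm n S y y"
        unfolding frm_comb_left frm_comb_right using form_sym[of y x] e1 by (simp add: algebra_simps)
      ultimately have "frm n S ?z ?z = 0" using a by simp
      then have zU: "?z \<in> U" using ext subsp_comb[OF subsp_perp x y(1)] by blast
      have "y = (\<lambda>i. ?z i + (- t) * x i)" by simp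
      then have "y \<in> ins U x" by (rule insI[OF zU])
      then show False using y(2) by blast
    qed
  qed
  then show ?thesis using Up by (simp add: U_def subset_antisym)
qed

lemma invertible_inv2:
  assumes "S \<in> carrier_mat n n" "invertible_mat S"
  obtains S' where "inv2 n S S'"
proof -
  obtain B where B: "inverts_mat S B" "inverts_mat B S" using assms(2) by (auto simp: invertible_mat_def)
  have r: "dim_row B = n" "dim_col B = n"
    using arg_cong[OF B(1)[unfolded inverts_mat_def], of dim_col] arg_cong[OF B(2)[unfolded inverts_mat_def], of dim_col] assms(1) by auto
  then have BC: "B \<in> carrier_mat n n" by blast
  show thesis by (rule that[of B]) (use B assms(1) BC in \<open>auto simp: inv2_def inverts_mat_def\<close>)
qed

lemma std_parabolic_three:
  assumes g: "g \<in> carrier (SL n)" and l: "a + b + c = n"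
    and st: "act n g ` coord {..<a} \<subseteq> coord {..<a}" "act n g ` coord {..<a + b} \<subseteq> coord {..<a + b}"
  shows "g \<in> std_parabolic n [a, b, c]"
proof -
  have ent: "g $$ (i, j) = 0" if s: "act n g ` coord {..<s} \<subseteq> coord {..<s}" and ij: "i < n" "j < n" "j < s" "s \<le> i" for s i j
    using coord_stable_iff[of s n g] s ij by auto
  have "g $$ (i, j) = 0" if k: "k \<le> 3" and ij: "i < n" "j < n" "j < sum_list (take k [a, b, c])" "sum_list (take k [a, b, c]) \<le> i" for k i j
  proof -
    consider "k = 0" | "k = 1" | "k = 2" | "k = 3" using k by fastforce
    then show ?thesis
    proof cases
      case 1 then show ?thesis using ij(3) by simp
    next
      case 2 then show ?thesis using ent[OF st(1) ij(1,2)] ij(3,4) by simp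
    next
      case 3 then show ?thesis using ent[OF st(2) ij(1,2)] ij(3,4) by (simp add: numeral_2_eq_2)
    next
      case 4 then show ?thesis using ij(1,4) l by (simp add: numeral_3_eq_3)
    qed
  qed
  moreover have "length [a, b, c] = 3" by simp
  ultimately show ?thesis unfolding std_parabolic_def using g by (intro CollectI conjI allI impI) (simp, metis)
qed

theorem proposition6p1:
  fixes n :: nat and S :: "complex mat" and G K :: "complex mat monoid"
    and P Q :: "complex mat set"
  assumes pair: "G = SL n \<and>
      ((3 \<le> n \<and> nondeg_symmetric n S \<and> K = SO n S) \<or>
       (\<exists>m\<ge>2. n = 2 * m \<and> nondeg_alternating n S \<and> K = Sp n S))"
    and "parabolic n G P" and "parabolic n K Q"
    and "maximal_parabolic n G P \<or>
      ((nondeg_symmetric n S \<longrightarrow> 4 \<le> n \<and> even n) \<and>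
       (\<exists>lam. composition n lam \<and> length lam = 3 \<and> P = std_parabolic n lam) \<and>
       siegel_parabolic n S K Q)"
  shows "finite (orbits K ((lcosets\<^bsub>G\<^esub> P) \<times> (lcosets\<^bsub>K\<^esub> Q))
           (\<lambda>k (A, B). (k <#\<^bsub>G\<^esub> A, k <#\<^bsub>K\<^esub> B)))"
proof -
  have G: "G = SL n" using pair by blast
  obtain d \<epsilon> where S: "S \<in> carrier_mat n n" "invertible_mat S" and K: "K = mat_group n (isom n S d)"
    and d: "d \<or> even n" and \<epsilon>: "\<epsilon> = 1 \<or> \<epsilon> = - 1" "\<And>x y. frm n S x y = \<epsilon> * frm n S y x"
    and sy: "\<epsilon> = 1 \<Longrightarrow> nondeg_symmetric n S"
  proof -
    from pair consider "nondeg_symmetric n S" "K = SO n S" | "even n" "nondeg_alternating n S" "K = Sp n S" by auto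
    then show thesis
    proof cases
      case 1
      then have c: "S \<in> carrier_mat n n" "transpose_mat S = S" "invertible_mat S" by (auto simp: nondeg_symmetric_def)
      show thesis
        by (rule that[of True 1]) (use 1 c frm_transpose[OF c(1)] in \<open>auto simp: SO_def isom_def\<close>)
    next
      case 2
      then have c: "S \<in> carrier_mat n n" "transpose_mat S = - S" "invertible_mat S" by (auto simp: nondeg_alternating_def)
      have "frm n S x y = - 1 * frm n S y x" for x y
      proof -
        have "frm n (- S) y x = - frm n S y x" using c(1) by (simp add: frm_sum sum_negf)
        then show ?thesis using frm_transpose[OF c(1), of y x] c(2) by simp
      qed
      then show thesis by (rule that[of False "- 1", OF c(1,3), rotated 3]) (use 2 in \<open>simp_all add: Sp_def isom_def\<close>)
    qed
  qed
  obtain S' where S': "inv2 n S S'" using invertible_inv2[OF S] by blast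
  interpret F: form_group n S S' \<epsilon> d "\<lambda>A. S' * (transpose_mat A * S)"
    by (intro form_group.intro eps_form.intro regular_isom_form S' \<epsilon>)
  from assms(4) show ?thesis
  proof (elim disjE conjE exE)
    assume "maximal_parabolic n G P"
    then show ?thesis using F.finite_orbits_maximal[of P Q] assms(3) d by (simp add: G K)
  next
    fix lam assume ev: "nondeg_symmetric n S \<longrightarrow> 4 \<le> n \<and> even n" and lam: "composition n lam" "length lam = 3" "P = std_parabolic n lam"
      and Q: "siegel_parabolic n S K Q"
    obtain W where W: "maximal_isotropic n S W" "Q = {g \<in> carrier K. (\<lambda>v. g *\<^sub>v v) ` W = W}"
      using Q by (auto simp: siegel_parabolic_def)
    have WC: "W \<subseteq> carrier_vec n" using W(1) subspace_fv(1) by (auto simp: maximal_isotropic_def isotropic_def)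
    obtain a b c where l: "lam = [a, b, c]" using lam(2) by (auto simp: numeral_3_eq_3 length_Suc_conv)
    have n: "a + b + c = n" using lam(1) by (auto simp: composition_def l)
    show ?thesis unfolding G K
    proof (rule F.finite_orbits_siegel[where U = "fv n ` W" and ?s1.0 = a and ?s2.0 = "a + b"])
      show "a \<le> a + b" "a + b \<le> n" using n by auto
      show "subgroup P (SL n)" using assms(2) by (simp add: parabolic_def G)
      show "subgroup Q F.G" using assms(3) unfolding parabolic_def K by blast
      show "fv n ` W = perp n S (fv n ` W)" by (rule F.maximal_isotropic_self_perp[OF W(1)]) (use sy ev in blast)
      show "g \<in> P" if "g \<in> carrier (SL n)" "act n g ` coord {..<a} \<subseteq> coord {..<a}"
        "act n g ` coord {..<a + b} \<subseteq> coord {..<a + b}" for g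
        unfolding lam(3) l by (rule std_parabolic_three[OF that(1) n that(2,3)])
      show "g \<in> Q" if g: "g \<in> isom n S d" "act n g ` fv n ` W = fv n ` W" for g
      proof -
        have gC: "g \<in> carrier_mat n n" using g(1) by (simp add: isom_def)
        let ?gW = "(\<lambda>v. g *\<^sub>v v) ` W"
        have vec_image: "vec n ` (fv n ` Z) = Z" if "Z \<subseteq> carrier_vec n" for Z
        proof -
          have "(\<lambda>v. vec n (fv n v)) ` Z = (\<lambda>v. v) ` Z" by (rule image_cong) (use that vec_fv in auto)
          then show ?thesis by (simp add: image_image)
        qed
        have gWC: "?gW \<subseteq> carrier_vec n" using gC WC by (auto intro!: mult_mat_vec_carrier)
        have "fv n ` ?gW = act n g ` fv n ` W"
          unfolding image_image by (rule image_cong) (use fv_mult_mat_vec[OF gC] WC in auto)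
        then have eq: "fv n ` ?gW = fv n ` W" by (simp only: g(2))
        have "?gW = vec n ` (fv n ` ?gW)" by (rule vec_image[OF gWC, symmetric])
        also have "\<dots> = W" unfolding eq by (rule vec_image[OF WC])
        finally show ?thesis using g(1) by (simp add: W(2) K mat_group_def)
      qed
    qed
  qed
qed

end
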